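(* For $\Gamma\in[1-2^{-12},1[$ let $f_\Gamma$ be the weak static solution constructed in the context. Let $I\subset\mathbb R$ be an open interval and let $\phi=\phi(t)$, $t\in I$, be a solution to $$\ddot\phi=-\frac1{\phi^2}+\frac1{\phi^3},\qquad\phi>0.$$ Then $$f_{\Gamma,\phi}(t,x,v)=f_\Gamma\Big(\frac{x}{\phi(t)},\ \phi(t)v-\dot\phi(t)x\Big),\quad t\in I,\ (x,v)\in\mathbb R^3\times\mathbb R^3,$$ is a weak solution on $I$. In particular, if for $|\varepsilon|<1$ the function $\phi_\varepsilon$ denotes the solution to this equation with $\phi_\varepsilon(0)=1$ and $\dot\phi_\varepsilon(0)=\varepsilon$, then $$f_{\Gamma,\varepsilon}(t,x,v)=f_\Gamma\Big(\frac{x}{\phi_\varepsilon(t)},\ \phi_\varepsilon(t)v-\dot\phi_\varepsilon(t)x\Big),\quad t\in\mathbb R,\ (x,v)\in\mathbb R^3\times\mathbb R^3,$$ is a weak solution on $\mathbb R$ that is $T_\varepsilon$-periodic in $t$, where $T_\varepsilon=\frac{2\pi}{(1-\varepsilon^2)^{3/2}}$.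
   Context: $x\wedge v$ is the cross product in $\mathbb R^3$; $]a,b]$, $[a,b[$ denote half-open intervals. Weak solution (of the gravitational Vlasov-Poisson system) on an open interval $I\subset\mathbb R$: a continuous function $f:I\to L^1_+(\mathbb R^3\times\mathbb R^3)=\{f\in L^1(\mathbb R^3\times\mathbb R^3): f\ge0\text{ a.e.}\}$ such that (a) for every compact subinterval $J\subset I$ there is a compact $K_J\subset\mathbb R^3\times\mathbb R^3$ such that for each $t\in J$, $f(t,x,v)=0$ for a.e. $(x,v)\notin K_J$; (b) $\rho_f(t,x)=\int_{\mathbb R^3}f(t,x,v)\,dv$ is in $L^\infty(J\times\mathbb R^3)$ for every compact subinterval $J\subset I$; (c) with $U_f(t,x)=-\int_{\mathbb R^3}\frac{\rho_f(t,y)}{|x-y|}\,dy$, $$\int_I\int_{\mathbb R^3}\int_{\mathbb R^3}f\,\big(\partial_t\varphi+v\cdot\nabla_x\varphi-\nabla_xU_f(t,x)\cdot\nabla_v\varphi\big)\,dt\,dx\,dv=0\quad\text{for all }\varphi\in C_c^\infty(I\times\mathbb R^3\times\mathbb R^3).$$ A weak static solution is a time-independent weak solution (with $I=\mathbb R$). Construction of $f_\Gamma$ for $\Gamma\in[1-2^{-12},1[$: let $R=2(1-\Gamma)^{1/3}$ and $h_c(z)=z\big(1-\frac{\Gamma}{1-z}\big)$ for $z\in\mathbb C$, $|z|\le R$ (it maps this disc into itself), with iterates $h_c^0(z)=z$, $h_c^k=h_c\circ h_c^{k-1}$. Let $\tilde\psi(z)=\sum_{k=0}^\infty h_c^k(z)$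 for $|z|<R$ (a holomorphic function), and let $\psi(s)=\tilde\psi(s)$ for $s\in[0,1-\Gamma]$, $\psi(s)=s$ for $s\in[1-\Gamma,1]$. Let $\varphi_\Gamma:[0,1]\to\mathbb R$ be given by $\varphi_\Gamma(0)=0$ and $\varphi_\Gamma(s)=\frac1{\pi^2}\frac{d}{ds}\int_0^s\frac{\psi(s-\sigma)}{\sqrt\sigma}\,d\sigma$ for $s\in]0,1]$; it is $C^\infty$ on $]0,1-\Gamma[$ and on $]1-\Gamma,1]$. Finally, with $s(x,v)=1+|x\wedge v|^2-|x|^2-|v|^2$, $$f_\Gamma(x,v)=\frac{3}{4\pi}\,\varphi_\Gamma'(s(x,v))\quad\text{if } |x\wedge v|^2\le\Gamma\text{ and } s(x,v)\in]0,1]\setminus\{1-\Gamma\},$$ and $f_\Gamma(x,v)=0$ otherwise. *)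

theory Defs
  imports "HOL-Analysis.Analysis"
begin

type_synonym phase_density = "real^3 \<Rightarrow> real^3 \<Rightarrow> real"

section \<open>Test functions and gradients\<close>

definition gradient :: "('a::euclidean_space \<Rightarrow> real) \<Rightarrow> 'a \<Rightarrow> 'a" where
  "gradient g x = (THE D. GDERIV g x :> D)"

fun C_k :: "nat \<Rightarrow> ('a::euclidean_space \<Rightarrow> real) \<Rightarrow> bool" where
  "C_k 0 g \<longleftrightarrow> continuous_on UNIV g"
| "C_k (Suc k) g \<longleftrightarrow> (\<forall>x. g differentiable (at x)) \<and>
     (\<forall>b\<in>Basis. C_k k (\<lambda>x. frechet_derivative g (at x) b))"

text \<open>A test function on an open set \<open>S\<close> is represented by its extension by zero to the
  whole space.\<close>

definition test_function :: "'a::euclidean_space set \<Rightarrow> ('a \<Rightarrow> real) \<Rightarrow> bool" where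
  "test_function S g \<longleftrightarrow> (\<forall>k. C_k k g) \<and> (\<exists>K. compact K \<and> K \<subseteq> S \<and> (\<forall>x. x \<notin> K \<longrightarrow> g x = 0))"

section \<open>Weak solutions of the gravitational Vlasov-Poisson system\<close>

definition spatial_density :: "phase_density \<Rightarrow> real^3 \<Rightarrow> real" where
  "spatial_density g x = (\<integral>v. g x v \<partial>lebesgue)"

definition potential :: "phase_density \<Rightarrow> real^3 \<Rightarrow> real" where
  "potential g x = - (\<integral>y. spatial_density g y / norm (x - y) \<partial>lebesgue)"

text \<open>A nonnegative class in \<open>L\<^sup>1\<close> is represented by an integrable function that is
  nonnegative almost everywhere.\<close>

definition L1_nonneg :: "phase_density \<Rightarrow> bool" where
  "L1_nonneg g \<longleftrightarrow> integrable lebesgue (\<lambda>(x, v). g x v) \<and> (AE (x, v) in lebesgue. 0 \<le> g x v)"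

definition L1_dist :: "phase_density \<Rightarrow> phase_density \<Rightarrow> real" where
  "L1_dist g h = (\<integral>(x, v). \<bar>g x v - h x v\<bar> \<partial>lebesgue)"

text \<open>A continuous curve in \<open>L\<^sup>1\<close> is represented by a function that is also measurable jointly in
  time and phase space; this makes the density measurable in space-time and the weak formulation
  an integral over space-time. The last condition uses \<open>has_bochner_integral\<close>, so that it
  includes integrability (the library integral of a nonintegrable function is zero).\<close>

definition weak_solution :: "real set \<Rightarrow> (real \<Rightarrow> phase_density) \<Rightarrow> bool" where
  "weak_solution I f \<longleftrightarrow>
     (\<lambda>(t, x, v). f t x v) \<in> borel_measurable (lebesgue_on (I \<times> UNIV)) \<and>
     (\<forall>t\<in>I. L1_nonneg (f t)) \<and>
     (\<forall>t\<in>I. ((\<lambda>\<tau>. L1_dist (f \<tau>) (f t)) \<longlongrightarrow> 0) (at t within I)) \<and>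
     (\<forall>a b. {a..b} \<subseteq> I \<longrightarrow>
        (\<exists>K. compact K \<and> (\<forall>t\<in>{a..b}. AE (x, v) in lebesgue. (x, v) \<notin> K \<longrightarrow> f t x v = 0))) \<and>
     (\<forall>a b. {a..b} \<subseteq> I \<longrightarrow>
        (\<lambda>(t, x). spatial_density (f t) x) \<in> borel_measurable (lebesgue_on ({a..b} \<times> UNIV)) \<and>
        (\<exists>C. AE (t, x) in lebesgue_on ({a..b} \<times> UNIV). \<bar>spatial_density (f t) x\<bar> \<le> C)) \<and>
     (\<forall>\<phi>. test_function (I \<times> UNIV \<times> UNIV) \<phi> \<longrightarrow>
        has_bochner_integral (lebesgue_on (I \<times> UNIV \<times> UNIV))
          (\<lambda>(t, x, v). f t x v *
             (deriv (\<lambda>\<tau>. \<phi> (\<tau>, x, v)) t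
              + v \<bullet> gradient (\<lambda>y. \<phi> (t, y, v)) x
              - gradient (potential (f t)) x \<bullet> gradient (\<lambda>w. \<phi> (t, x, w)) v))
          0)"

section \<open>The function \<open>f\<^sub>\<Gamma>\<close>\<close>

definition h_c :: "real \<Rightarrow> complex \<Rightarrow> complex" where
  "h_c \<Gamma> z = z * (1 - of_real \<Gamma> / (1 - z))"

text \<open>The following series converges on the disc of radius \<open>2 (1 - \<Gamma>)\<^bsup>1/3\<^esup>\<close>; only its
  values on \<open>[0, 1 - \<Gamma>]\<close>, where it is real, are used below.\<close>

definition psi_tilde :: "real \<Rightarrow> complex \<Rightarrow> complex" where
  "psi_tilde \<Gamma> z = (\<Sum>k. (h_c \<Gamma> ^^ k) z)"

definition psi :: "real \<Rightarrow> real \<Rightarrow> real" where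
  "psi \<Gamma> s = (if s \<le> 1 - \<Gamma> then Re (psi_tilde \<Gamma> (of_real s)) else s)"

text \<open>Derivatives are taken within \<open>[0, 1]\<close>, the domain of \<open>\<psi>\<close> and \<open>\<phi>\<^sub>\<Gamma>\<close>, and so are
  one-sided at \<open>1\<close>.\<close>

definition phi_Gamma :: "real \<Rightarrow> real \<Rightarrow> real" where
  "phi_Gamma \<Gamma> s =
     (if s = 0 then 0
      else 1 / pi\<^sup>2 *
        vector_derivative
          (\<lambda>r. LINT \<sigma>:{0..r}|lborel. psi \<Gamma> (r - \<sigma>) / sqrt \<sigma>) (at s within {0..1}))"

definition s_fun :: "real^3 \<Rightarrow> real^3 \<Rightarrow> real" where
  "s_fun x v = 1 + (norm (cross3 x v))\<^sup>2 - (norm x)\<^sup>2 - (norm v)\<^sup>2"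

definition f_Gamma :: "real \<Rightarrow> phase_density" where
  "f_Gamma \<Gamma> x v =
     (if (norm (cross3 x v))\<^sup>2 \<le> \<Gamma> \<and> s_fun x v \<in> {0<..1} - {1 - \<Gamma>}
      then 3 / (4 * pi) * vector_derivative (phi_Gamma \<Gamma>) (at (s_fun x v) within {0..1})
      else 0)"

section \<open>The radial equation and the transformed function\<close>

definition radial_solution :: "real set \<Rightarrow> (real \<Rightarrow> real) \<Rightarrow> bool" where
  "radial_solution I \<phi> \<longleftrightarrow>
     (\<forall>t\<in>I. \<phi> t > 0 \<and> \<phi> differentiable (at t) \<and>
        (deriv \<phi> has_real_derivative - 1 / (\<phi> t)^2 + 1 / (\<phi> t)^3) (at t))"

definition f_Gamma_phi :: "real \<Rightarrow> (real \<Rightarrow> real) \<Rightarrow> real \<Rightarrow> phase_density" where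
  "f_Gamma_phi \<Gamma> \<phi> t x v = f_Gamma \<Gamma> (x /\<^sub>R \<phi> t) (\<phi> t *\<^sub>R v - deriv \<phi> t *\<^sub>R x)"

end

theory Submission
  imports Defs
begin

text \<open>
  Write \<open>\<delta> = 1 - \<Gamma>\<close>. In cylindrical velocity coordinates about the axis \<open>x\<close>, the function \<open>s\<close> becomes
  \<open>a (1 - q) - u\<^sup>2\<close> with \<open>a = 1 - |x|\<^sup>2\<close>, and the density of \<open>f\<^sub>\<Gamma>\<close> at \<open>x\<close> is a double integral of \<open>\<phi>\<^sub>\<Gamma>'\<close>. The integral in
  \<open>u\<close> is inverted by the Abel transform and yields \<open>\<psi>'\<close>; the one in \<open>q\<close> then yields
  \<open>\<psi>(a) - \<psi>(max 0 (h(a)))\<close>, which equals \<open>a\<close> because \<open>\<psi>\<close> sums the iterates of \<open>h\<close>. Hence the density is constant on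
  the unit ball. Since \<open>|h'| \<le> 1/4\<close> on \<open>[0, \<delta>]\<close>, the sum of the iterates can be differentiated twice
  termwise on the real interval, and smallness of \<open>\<delta>\<close> gives \<open>\<phi>\<^sub>\<Gamma>' \<ge> 0\<close>.

  After the transformation the density is constant on the ball of radius \<open>\<phi>(t)\<close>, so the force is \<open>- x / \<phi>\<^sup>3\<close>
  there. In the variables \<open>x / \<phi>\<close> and \<open>\<phi> v - \<phi>' x\<close>, with time rescaled by \<open>1 / \<phi>\<^sup>2\<close>, the characteristics are uniform rotations.
  These preserve volume and leave \<open>f\<^sub>\<Gamma>\<close> invariant, so the weak formulation reduces to integrating the
  \<open>t\<close>-derivative of a test function along each trajectory.
\<close>

section \<open>Cylindrical coordinates\<close>

text \<open>The cut \<open>|x wedge v|^2 <= \<Gamma>\<close> is the origin of \<open>h\<close>: in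
  the variable q, the squared velocity component orthogonal to x, it reads
  \<open>q <= \<Gamma> / (1 - a)\<close>, and at this limit \<open>a (1 - q)\<close> equals
  \<open>h a\<close>. For \<open>a >= \<delta>\<close> the cut holds for all q up to 1, and beyond
  that s is negative anyway. The main obstacle is that the derivative of psi jumps at 0 and at
  \<open>\<delta>\<close>. Hence the derivative of \<open>phi_Gamma\<close> has inverse square root
  singularities at these two levels, and \<open>f_Gamma\<close> is unbounded. The jumps are split
  off and transformed explicitly; the remainder is Lipschitz and can be differentiated under the
  Abel integral. Unboundedness also shapes the time-dependent part: continuity in L1 comes from
  Scheffe's lemma, and Fubini is justified by domination with the solution itself, whose integral is
  constant in time. The prefactor \<open>3 / (4 * pi)\<close> gives total mass 1, so the force of
  the static solution inside the unit ball is exactly -x, that of the harmonic oscillator. Only the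
  force inside the ball ever enters, because the solution vanishes outside.\<close>

lemma distr_lborel_orthogonal:
  fixes f :: "real^3 \<Rightarrow> real^3"
  assumes f: "orthogonal_transformation f"
  shows "distr lborel borel f = lborel"
proof (rule sym, rule lborel_eqI)
  obtain g where g: "orthogonal_transformation g" "\<And>x. g (f x) = x" "\<And>x. f (g x) = x"
    using orthogonal_transformation_inv[OF f] orthogonal_transformation_bij[OF f]
    by (metis bij_inv_eq_iff)
  have [measurable]: "f \<in> borel_measurable borel"
    using f by (intro borel_measurable_continuous_onI linear_continuous_on)
      (simp add: linear_conv_bounded_linear[symmetric] orthogonal_transformation_linear)
  fix l u :: "real^3" assume lu: "\<And>b. b \<in> Basis \<Longrightarrow> l \<bullet> b \<le> u \<bullet> b"
  have eq: "f -` box l u = g ` box l u"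
    using g(2,3) by (auto simp: image_iff) metis
  have "emeasure (distr lborel borel f) (box l u) = emeasure lborel (f -` box l u)"
    by (simp add: emeasure_distr)
  also have "\<dots> = emeasure lebesgue (g ` box l u)"
    unfolding eq[symmetric] by (simp add: measurable_sets_borel[of f borel, simplified])
  also have "\<dots> = emeasure lebesgue (box l u)"
    using measurable_orthogonal_image[OF g(1), of "box l u"] measure_orthogonal_image[OF g(1), of "box l u"]
    by (simp add: emeasure_eq_measure2)
  also have "\<dots> = (\<Prod>b\<in>Basis. (u - l) \<bullet> b)"
    using lu by (simp add: emeasure_lborel_box)
  finally show "emeasure (distr lborel borel f) (box l u) = (\<Prod>b\<in>Basis. (u - l) \<bullet> b)" .
qed simp

lemma nn_integral_orthogonal:
  fixes f :: "real^3 \<Rightarrow> real^3"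
  assumes "orthogonal_transformation f" and [measurable]: "F \<in> borel_measurable borel"
  shows "(\<integral>\<^sup>+v. F (f v) \<partial>lborel) = (\<integral>\<^sup>+v. F v \<partial>lborel)"
proof -
  have [measurable]: "f \<in> borel_measurable borel"
    using assms(1) by (intro borel_measurable_continuous_onI linear_continuous_on)
      (simp add: linear_conv_bounded_linear[symmetric] orthogonal_transformation_linear)
  show ?thesis
    by (subst (2) distr_lborel_orthogonal[OF assms(1), symmetric]) (simp add: nn_integral_distr)
qed

text \<open>Both versions serve below: the preimage of an open interval under the squared radius is
  an open disc minus a closed one. The \<open>max 0 t\<close> covers the empty disc.\<close>

lemma disc_area:
  fixes t :: real
  shows "emeasure lborel {w :: real \<times> real. (fst w)\<^sup>2 + (snd w)\<^sup>2 \<le> t} = ennreal (pi * max 0 t)" (is "emeasure _ ?C = _")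
    and "emeasure lborel {w :: real \<times> real. (fst w)\<^sup>2 + (snd w)\<^sup>2 < t} = ennreal (pi * max 0 t)" (is "emeasure _ ?D = _")
proof -
  have "emeasure lborel ?C = ennreal (pi * max 0 t) \<and> emeasure lborel ?D = ennreal (pi * max 0 t)"
  proof (cases "t < 0")
    case True
    have "\<not> (fst w)\<^sup>2 + (snd w)\<^sup>2 \<le> t" for w :: "real \<times> real"
      using True sum_power2_ge_zero[of "fst w" "snd w"] by linarith
    then have "?C = {}" "?D = {}" by (blast intro: less_imp_le)+
    then show ?thesis using True by (simp only:) simp
  next
    case False
    then have "?C = cball 0 (sqrt t)" "?D = ball 0 (sqrt t)"
      by (auto simp: norm_Pair mem_cball_0 mem_ball_0)
    then show ?thesis using False
      by (simp add: emeasure_cball emeasure_ball unit_ball_vol_2 max_def)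
  qed
  then show "emeasure lborel ?C = ennreal (pi * max 0 t)" "emeasure lborel ?D = ennreal (pi * max 0 t)"
    by auto
qed

text \<open>The area of a disc is proportional to its squared radius, so the squared radius is
  uniformly distributed.\<close>

lemma distr_plane_norm_sq:
  "distr lborel borel (\<lambda>w :: real \<times> real. (fst w)\<^sup>2 + (snd w)\<^sup>2)
     = density lborel (\<lambda>q. ennreal pi * indicator {0..} q)" (is "?A = ?B")
proof -
  define M where "M = density lborel (\<lambda>q::real. indicator {..<0} q)"
  have box_eq: "emeasure ?A {l<..<u} = ennreal (pi * (max 0 u - max 0 l))" if "l \<le> u" for l u :: real
  proof -
    let ?D = "\<lambda>t. {w :: real \<times> real. (fst w)\<^sup>2 + (snd w)\<^sup>2 < t}"
    let ?C = "\<lambda>t. {w :: real \<times> real. (fst w)\<^sup>2 + (snd w)\<^sup>2 \<le> t}"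
    have "(\<lambda>w :: real \<times> real. (fst w)\<^sup>2 + (snd w)\<^sup>2) -` {l<..<u} = ?D u - ?C l" by auto
    then have "emeasure ?A {l<..<u} = emeasure lborel (?D u - ?C l)"
      by (subst emeasure_distr) (auto intro!: borel_measurable_continuous_onI continuous_intros)
    also have "\<dots> = ennreal (pi * (max 0 u - max 0 l))"
    proof (cases "l = u")
      case True
      then have "?D u - ?C l = {}" by auto
      then show ?thesis unfolding \<open>?D u - ?C l = {}\<close> using True by simp
    next
      case False
      have "emeasure lborel (?D u - ?C l) = emeasure lborel (?D u) - emeasure lborel (?C l)"
        using that False
        by (intro emeasure_Diff) (auto simp: disc_area intro!: borel_open[OF open_Collect_less] borel_closed[OF closed_Collect_le] continuous_intros)
      then show ?thesis
        by (simp add: disc_area ennreal_minus right_diff_distrib)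
    qed
    finally show ?thesis .
  qed
  have "emeasure ?B {l<..<u} = ennreal (pi * (max 0 u - max 0 l))" if "l \<le> u" for l u :: real
  proof -
    have "emeasure ?B {l<..<u} = (\<integral>\<^sup>+q. ennreal pi * indicator ({0..} \<inter> {l<..<u}) q \<partial>lborel)"
      by (subst emeasure_density) (auto simp: mult.assoc indicator_inter_arith[symmetric] intro!: nn_integral_cong split: split_indicator)
    also have "\<dots> = ennreal pi * emeasure lborel ({0..} \<inter> {l<..<u})"
      by (subst nn_integral_cmult_indicator) auto
    also have "emeasure lborel ({0..} \<inter> {l<..<u}) = ennreal (max 0 u - max 0 l)"
    proof (cases "l < 0")
      case True
      then have "{0..} \<inter> {l<..<u} = {0..<u}" by auto
      then show ?thesis using True by (cases "0 \<le> u") (auto simp: max_def)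
    next
      case False
      then have "{0..} \<inter> {l<..<u} = {l<..<u}" by auto
      then show ?thesis using False that by (auto simp: max_def)
    qed
    finally show ?thesis by (simp add: ennreal_mult')
  qed
  note B = this
  show ?thesis
  proof (rule measure_eqI_generator_eq[where \<Omega>=UNIV and E="range (\<lambda>(a,b). box a b :: real set)" and A="\<lambda>n. box (- real n) (real n)"])
    show "Int_stable (range (\<lambda>(a,b). box a b :: real set))"
      by (auto simp: Int_stable_def box_Int_box)
    show "sets ?A = sigma_sets UNIV (range (\<lambda>(a,b). box a b :: real set))"
         "sets ?B = sigma_sets UNIV (range (\<lambda>(a,b). box a b :: real set))"
      by (simp_all add: borel_eq_box)
    show "(\<Union>i. box (- real i) (real i)) = UNIV"
      by (auto simp: box_real) (metis abs_less_iff minus_less_iff reals_Archimedean2)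
    show "emeasure ?A X = emeasure ?B X" if X_in: "X \<in> range (\<lambda>(a,b). box a b :: real set)" for X
    proof -
      obtain l u where "X = box l u" using X_in by auto
      then have X: "X = {l<..<u}" by (simp add: box_real)
      show ?thesis unfolding X
        by (cases "l \<le> u") (simp_all add: box_eq B)
    qed
    show "emeasure ?A (box (- real i) (real i)) \<noteq> \<infinity>" for i
      by (simp add: box_real box_eq)
  qed auto
qed

lemma emeasure_lborel_Times:
  fixes A :: "'a::euclidean_space set" and B :: "'b::euclidean_space set"
  assumes "A \<in> sets borel" "B \<in> sets borel"
  shows "emeasure lborel (A \<times> B) = emeasure lborel A * emeasure lborel B"
  using assms by (simp add: lborel_prod[symmetric] lborel.emeasure_pair_measure_Times)

lemma nn_integral_lborel_pair:
  fixes F :: "'a::euclidean_space \<times> 'b::euclidean_space \<Rightarrow> ennreal"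
  assumes F: "F \<in> borel_measurable borel"
  shows "(\<integral>\<^sup>+p. F p \<partial>lborel) = (\<integral>\<^sup>+x. (\<integral>\<^sup>+y. F (x, y) \<partial>lborel) \<partial>lborel)"
proof -
  have F': "F \<in> borel_measurable (lborel \<Otimes>\<^sub>M lborel)"
    using F by (simp add: lborel_prod)
  show ?thesis
    using lborel.nn_integral_fst[OF F'] by (simp add: lborel_prod)
qed

lemma nn_integral_lborel_pair':
  fixes F :: "'a::euclidean_space \<times> 'b::euclidean_space \<Rightarrow> ennreal"
  assumes F: "F \<in> borel_measurable borel"
  shows "(\<integral>\<^sup>+p. F p \<partial>lborel) = (\<integral>\<^sup>+y. (\<integral>\<^sup>+x. F (x, y) \<partial>lborel) \<partial>lborel)"
proof -
  have F': "F \<in> borel_measurable (lborel \<Otimes>\<^sub>M lborel)"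
    using F by (simp add: lborel_prod)
  show ?thesis
    using lborel_pair.nn_integral_snd[of "\<lambda>p. F p"] F' by (simp add: lborel_prod)
qed

text \<open>Passes from the vector type to nested pairs, where Tonelli's theorem applies. Comparing
  the volumes of boxes suffices.\<close>

lemma lborel_vector_3:
  "distr lborel borel (\<lambda>(a, b, c). vector [a, b, c] :: real^3) = lborel"
proof (rule sym, rule lborel_eqI)
  let ?f = "\<lambda>(a, b, c). vector [a, b, c] :: real^3"
  have f_eq: "?f = (\<lambda>p. fst p *\<^sub>R axis 1 1 + fst (snd p) *\<^sub>R axis 2 1 + snd (snd p) *\<^sub>R axis 3 1)"
    by (auto simp: fun_eq_iff vec_eq_iff forall_3 axis_def)
  have [measurable]: "?f \<in> borel_measurable borel"
    unfolding f_eq by (intro borel_measurable_continuous_onI continuous_intros)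
  fix l u :: "real^3" assume lu: "\<And>b. b \<in> Basis \<Longrightarrow> l \<bullet> b \<le> u \<bullet> b"
  have B3: "Basis = {axis 1 1, axis 2 1, axis 3 (1::real) :: real^3}"
    by (auto simp: Basis_vec_def UNIV_3)
  have ne: "axis 1 1 \<noteq> (axis 2 1 :: real^3)" "axis 1 1 \<noteq> (axis 3 1 :: real^3)" "axis 2 1 \<noteq> (axis 3 1 :: real^3)"
    by (auto simp: axis_eq_axis)
  have le: "l $ i \<le> u $ i" for i
    using lu[of "axis i 1"] by (simp add: inner_axis)
  have pre: "?f -` box l u = box (l$1) (u$1) \<times> box (l$2) (u$2) \<times> box (l$3) (u$3)"
    by (auto simp: mem_box_cart forall_3 box_real)
  have "emeasure (distr lborel borel ?f) (box l u) = emeasure lborel (?f -` box l u)"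
    by (simp add: emeasure_distr)
  also have "\<dots> = emeasure (lborel \<Otimes>\<^sub>M (lborel \<Otimes>\<^sub>M lborel)) (box (l$1) (u$1) \<times> box (l$2) (u$2) \<times> box (l$3) (u$3))"
    by (simp only: pre lborel_prod)
  also have "\<dots> = ennreal (u$1 - l$1) * (ennreal (u$2 - l$2) * ennreal (u$3 - l$3))"
    using le by (simp add: lborel_prod emeasure_lborel_Times borel_Times box_real)
  also have "\<dots> = (\<Prod>b\<in>Basis. (u - l) \<bullet> b)"
    using le ne by (simp add: B3 inner_axis ennreal_mult'[symmetric] flip: ennreal_mult)
  finally show "emeasure (distr lborel borel ?f) (box l u) = (\<Prod>b\<in>Basis. (u - l) \<bullet> b)" .
qed simp

text \<open>The radial variable \<open>q\<close> is the squared distance to the axis \<open>e\<close>.\<close>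

lemma nn_integral_cylindrical:
  fixes e :: "real^3" and F :: "real \<times> real \<Rightarrow> ennreal"
  assumes e: "norm e = 1" and [measurable]: "F \<in> borel_measurable borel"
  shows "(\<integral>\<^sup>+v. F (v \<bullet> e, (norm v)\<^sup>2 - (v \<bullet> e)\<^sup>2) \<partial>lborel)
    = (\<integral>\<^sup>+u. ennreal pi * (\<integral>\<^sup>+q. F (u, q) * indicator {0..} q \<partial>lborel) \<partial>lborel)"
proof -
  have "norm (axis 1 1 :: real^3) = norm e"
    using e by simp
  then obtain f :: "real^3 \<Rightarrow> real^3" where f: "orthogonal_transformation f" "f (axis 1 1) = e"
    using orthogonal_transformation_exists by blast
  have "(\<integral>\<^sup>+v. F (v \<bullet> e, (norm v)\<^sup>2 - (v \<bullet> e)\<^sup>2) \<partial>lborel)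
      = (\<integral>\<^sup>+v. F (f v \<bullet> e, (norm (f v))\<^sup>2 - (f v \<bullet> e)\<^sup>2) \<partial>lborel)"
    by (rule nn_integral_orthogonal[OF f(1), symmetric]) measurable
  also have "\<dots> = (\<integral>\<^sup>+v. F (v \<bullet> axis 1 1, (norm v)\<^sup>2 - (v \<bullet> axis 1 1)\<^sup>2) \<partial>(lborel :: (real^3) measure))"
    using f orthogonal_transformation_norm[OF f(1)]
    by (simp add: f(2)[symmetric] orthogonal_transformation_def)
  also have "\<dots> = (\<integral>\<^sup>+p. F (fst p, (fst (snd p))\<^sup>2 + (snd (snd p))\<^sup>2) \<partial>(lborel :: (real \<times> real \<times> real) measure))"
  proof -
    have f_eq: "(\<lambda>(a, b, c). vector [a, b, c] :: real^3) = (\<lambda>p. fst p *\<^sub>R axis 1 1 + fst (snd p) *\<^sub>R axis 2 1 + snd (snd p) *\<^sub>R axis 3 1)"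
      by (auto simp: fun_eq_iff vec_eq_iff forall_3 axis_def)
    have [measurable]: "(\<lambda>(a, b, c). vector [a, b, c] :: real^3) \<in> borel_measurable borel"
      unfolding f_eq by (intro borel_measurable_continuous_onI continuous_intros)
    show ?thesis
      by (subst lborel_vector_3[symmetric], subst nn_integral_distr)
         (auto intro!: nn_integral_cong simp: inner_axis norm_vec_def L2_set_def sum_3 power2_eq_square[symmetric] sum_nonneg)
  qed
  also have "\<dots> = (\<integral>\<^sup>+u. (\<integral>\<^sup>+w. F (u, (fst w)\<^sup>2 + (snd w)\<^sup>2) \<partial>(lborel :: (real \<times> real) measure)) \<partial>lborel)"
    by (subst nn_integral_lborel_pair)
       (auto intro!: measurable_compose[OF borel_measurable_continuous_onI assms(2)] continuous_intros)
  also have "\<dots> = (\<integral>\<^sup>+u. ennreal pi * (\<integral>\<^sup>+q. F (u, q) * indicator {0..} q \<partial>lborel) \<partial>lborel)"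
  proof (rule nn_integral_cong)
    fix u :: real
    have "(\<integral>\<^sup>+w. F (u, (fst w)\<^sup>2 + (snd w)\<^sup>2) \<partial>(lborel :: (real \<times> real) measure))
      = (\<integral>\<^sup>+q. F (u, q) \<partial>distr lborel borel (\<lambda>w :: real \<times> real. (fst w)\<^sup>2 + (snd w)\<^sup>2))"
      by (subst nn_integral_distr)
         (auto intro!: borel_measurable_continuous_onI continuous_intros measurable_compose[OF _ assms(2)])
    also have "\<dots> = ennreal pi * (\<integral>\<^sup>+q. F (u, q) * indicator {0..} q \<partial>lborel)"
      by (simp add: distr_plane_norm_sq nn_integral_density nn_integral_cmult[symmetric] mult_ac)
    finally show "(\<integral>\<^sup>+w. F (u, (fst w)\<^sup>2 + (snd w)\<^sup>2) \<partial>(lborel :: (real \<times> real) measure)) = ennreal pi * (\<integral>\<^sup>+q. F (u, q) * indicator {0..} q \<partial>lborel)" .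
  qed
  finally show ?thesis .
qed

section \<open>The radial equation\<close>

text \<open>The primitive is based at a fixed point c of I. Around each t there is a compact
  interval in I that contains both c and a neighbourhood of t; on it the primitive differs by a
  constant from the integral taken from the left end.\<close>

lemma antiderivative_open_interval:
  fixes f :: "real \<Rightarrow> real"
  assumes "open I" "is_interval I" and f: "continuous_on I f"
  obtains F where "\<And>t. t \<in> I \<Longrightarrow> (F has_real_derivative f t) (at t)"
proof (cases "I = {}")
  case False
  then obtain c where c: "c \<in> I" by auto
  define F where "F t = (if t \<le> c then - integral {t..c} f else integral {c..t} f)" for t
  have "(F has_real_derivative f t) (at t)" if t: "t \<in> I" for t
  proof -
    obtain e where e: "e > 0" "cball t e \<subseteq> I"
      using \<open>open I\<close> t open_contains_cball by blast
    define a where "a = min c (t - e)"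
    define b where "b = max c (t + e)"
    have ab: "a \<in> I" "b \<in> I" "a \<le> c" "c \<le> b" "a < t" "t < b"
    proof -
      have "t - e \<in> cball t e" "t + e \<in> cball t e"
        using e(1) by (simp_all add: dist_real_def)
      then show "a \<in> I" "b \<in> I" "a \<le> c" "c \<le> b" "a < t" "t < b"
        using c e by (auto simp: a_def b_def min_def max_def)
    qed
    then have sub: "{a..b} \<subseteq> I"
      using mem_is_interval_1_I[OF \<open>is_interval I\<close> ab(1,2)] by auto
    then have cont: "continuous_on {a..b} f"
      using f continuous_on_subset by blast
    then have int: "f integrable_on {u..v}" if "a \<le> u" "v \<le> b" for u v
      using that by (intro integrable_continuous_interval continuous_on_subset[OF cont]) auto
    have eq: "F u = integral {a..u} f - integral {a..c} f" if "u \<in> {a..b}" for u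
    proof (cases "u \<le> c")
      case True
      have "integral {a..u} f + integral {u..c} f = integral {a..c} f"
        using True that ab by (intro Henstock_Kurzweil_Integration.integral_combine int) auto
      then show ?thesis using True by (simp add: F_def)
    next
      case False
      have "integral {a..c} f + integral {c..u} f = integral {a..u} f"
        using False that ab by (intro Henstock_Kurzweil_Integration.integral_combine int) auto
      then show ?thesis using False by (simp add: F_def)
    qed
    have "((\<lambda>u. integral {a..u} f - integral {a..c} f) has_real_derivative f t) (at t within {a..b})"
      using DERIV_diff[OF integral_has_real_derivative[OF cont, of t] DERIV_const] ab by simp
    then have "(F has_real_derivative f t) (at t within {a..b})"
      by (rule has_field_derivative_transform_within[OF _ zero_less_one]) (use ab in \<open>auto simp: eq[symmetric]\<close>)
    then show ?thesis
      using ab by (simp add: at_within_Icc_at)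
  qed
  then show ?thesis using that by blast
qed (use that in auto)

lemma has_real_derivative_zero_eq:
  fixes f :: "real \<Rightarrow> real"
  assumes "\<And>t. (f has_real_derivative 0) (at t)"
  shows "f t = f s"
  using DERIV_isconst_all[of f t s] assms by blast

lemma radial_solutionD:
  assumes "radial_solution I \<phi>" "t \<in> I"
  shows "\<phi> t > 0" "(\<phi> has_real_derivative deriv \<phi> t) (at t)"
    "(deriv \<phi> has_real_derivative - 1 / (\<phi> t)^2 + 1 / (\<phi> t)^3) (at t)"
  using assms by (auto simp: radial_solution_def DERIV_deriv_iff_real_differentiable)

lemma one_plus_eps_sin_pos:
  fixes \<epsilon> :: real
  assumes "\<bar>\<epsilon>\<bar> < 1"
  shows "1 - \<epsilon> * sin x > 0" "1 - \<epsilon> * cos x > 0"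
proof -
  have "\<bar>\<epsilon> * sin x\<bar> \<le> \<bar>\<epsilon>\<bar> * 1" "\<bar>\<epsilon> * cos x\<bar> \<le> \<bar>\<epsilon>\<bar> * 1"
    unfolding abs_mult by (intro mult_left_mono; simp)+
  then show "1 - \<epsilon> * sin x > 0" "1 - \<epsilon> * cos x > 0"
    using assms by linarith+
qed

text \<open>In the rescaled time \<open>\<Theta>\<close> with \<open>\<Theta>' = 1 / \<phi>\<^sup>2\<close>, the pair \<open>(1 / \<phi> - 1, - \<phi>')\<close> rotates uniformly. Hence \<open>\<phi>\<close> is a
  function of \<open>\<Theta>\<close>, and \<open>\<Theta>\<close> solves an autonomous scalar equation.\<close>

lemma radial_solution_unique:
  assumes \<epsilon>: "\<bar>\<epsilon>\<bar> < 1"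
    and 1: "radial_solution UNIV \<phi>1" "\<phi>1 0 = 1" "deriv \<phi>1 0 = \<epsilon>"
    and 2: "radial_solution UNIV \<phi>2" "\<phi>2 0 = 1" "deriv \<phi>2 0 = \<epsilon>"
  shows "\<phi>1 = \<phi>2"
proof -
  \<comment> \<open>Since the orbit will turn out to be
    \<open>1 / (1 - \<epsilon> * sin \<Theta>)\<close>, the integrand is
    \<open>dt / d\<Theta>\<close> = \<open>\<phi>\<close> squared, and G is time as a function of
    the angle.\<close>
  have "continuous_on UNIV (\<lambda>x. 1 / (1 - \<epsilon> * sin x)\<^sup>2)"
    using one_plus_eps_sin_pos(1)[OF \<epsilon>] by (intro continuous_intros) (simp add: less_imp_neq[symmetric])
  then obtain G where G: "\<And>x. (G has_real_derivative 1 / (1 - \<epsilon> * sin x)\<^sup>2) (at x)"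
    using antiderivative_open_interval[of UNIV] by (metis UNIV_I is_interval_univ open_UNIV)
  have key: "\<exists>\<Theta>. (\<forall>t. \<phi> t = 1 / (1 - \<epsilon> * sin (\<Theta> t))) \<and> (\<forall>t. G (\<Theta> t) = t + G 0)"
    if \<phi>: "radial_solution UNIV \<phi>" "\<phi> 0 = 1" "deriv \<phi> 0 = \<epsilon>" for \<phi>
  proof -
    note D = radial_solutionD[OF \<phi>(1) UNIV_I]
    have nz: "\<phi> t \<noteq> 0" for t using D(1)[of t] by simp
    have "continuous_on UNIV (\<lambda>t. 1 / (\<phi> t)\<^sup>2)"
      using nz by (intro continuous_intros) (auto intro!: continuous_at_imp_continuous_on DERIV_isCont[OF D(2)])
    then obtain \<Theta>0 where "\<And>x. (\<Theta>0 has_real_derivative 1 / (\<phi> x)\<^sup>2) (at x)"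
      using antiderivative_open_interval[of UNIV] by (metis UNIV_I is_interval_univ open_UNIV)
    then have \<Theta>0: "((\<lambda>x. \<Theta>0 x - \<Theta>0 0) has_real_derivative 1 / (\<phi> x)\<^sup>2) (at x)" for x
      by (auto intro!: derivative_eq_intros)
    define \<Theta> where "\<Theta> x = \<Theta>0 x - \<Theta>0 0" for x
    have \<Theta>: "(\<Theta> has_real_derivative 1 / (\<phi> x)\<^sup>2) (at x)" "\<Theta> 0 = 0" for x
      using \<Theta>0[of x] by (simp_all add: \<Theta>_def[abs_def])
    define A where "A t = 1 / \<phi> t - 1" for t
    have A: "(A has_real_derivative - deriv \<phi> t / (\<phi> t)\<^sup>2) (at t)" for t
      unfolding A_def[abs_def] using nz[of t]
      by (auto intro!: derivative_eq_intros D(2) simp: power2_eq_square field_simps)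
    have B: "(deriv \<phi> has_real_derivative A t / (\<phi> t)\<^sup>2) (at t)" for t
      using D(3)[of t] nz[of t] by (simp add: A_def field_simps power2_eq_square power3_eq_cube)
    \<comment> \<open>\<open>?P\<close> and \<open>?Q\<close> are the rotating pair turned back by
      the angle \<open>\<Theta>\<close>, hence constants of motion; the initial data fix them as 0
      and \<open>- \<epsilon>\<close>.\<close>
    let ?P = "\<lambda>t. A t * cos (\<Theta> t) + deriv \<phi> t * sin (\<Theta> t)"
    let ?Q = "\<lambda>t. A t * sin (\<Theta> t) - deriv \<phi> t * cos (\<Theta> t)"
    have "(?P has_real_derivative 0) (at t)" for t
      by (rule derivative_eq_intros A B \<Theta>(1) refl)+ (simp add: field_simps)
    then have P: "?P t = 0" for t
      using has_real_derivative_zero_eq[of ?P t 0] \<phi> \<Theta>(2) by (simp add: A_def)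
    have "(?Q has_real_derivative 0) (at t)" for t
      by (rule derivative_eq_intros A B \<Theta>(1) refl)+ (simp add: field_simps)
    then have Q: "?Q t = - \<epsilon>" for t
      using has_real_derivative_zero_eq[of ?Q t 0] \<phi> \<Theta>(2) by (simp add: A_def)
    have AA: "A t = - \<epsilon> * sin (\<Theta> t)" for t
    proof -
      have "A t * ((sin (\<Theta> t))\<^sup>2 + (cos (\<Theta> t))\<^sup>2) = ?P t * cos (\<Theta> t) + ?Q t * sin (\<Theta> t)"
        by algebra
      then show ?thesis using P Q by simp
    qed
    have inv: "1 / \<phi> t = 1 - \<epsilon> * sin (\<Theta> t)" for t
      using AA[of t] by (simp add: A_def)
    then have \<phi>_eq: "\<phi> t = 1 / (1 - \<epsilon> * sin (\<Theta> t))" for t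
      by (metis nz inverse_eq_divide inverse_inverse_eq)
    have "((\<lambda>t. G (\<Theta> t) - t) has_real_derivative 0) (at t)" for t
      using one_plus_eps_sin_pos(1)[OF \<epsilon>, of "\<Theta> t"] nz[of t]
      by (auto intro!: derivative_eq_intros DERIV_chain2[OF G \<Theta>(1)] simp: inv[symmetric] power_divide)
    then have "G (\<Theta> t) - t = G (\<Theta> 0) - 0" for t
      by (rule has_real_derivative_zero_eq)
    then have "G (\<Theta> t) = t + G 0" for t
      using \<Theta>(2) by (simp add: algebra_simps)
    with \<phi>_eq show ?thesis by blast
  qed
  \<comment> \<open>Injectivity of G makes \<open>G (\<Theta> t) = t + G 0\<close> determine the
    angle, and with it the orbit.\<close>
  have "strict_mono G"
  proof (rule strict_monoI)
    fix x y :: real assume "x < y"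
    then show "G x < G y"
      by (rule DERIV_pos_imp_increasing)
        (metis G one_plus_eps_sin_pos(1)[OF \<epsilon>] zero_less_divide_1_iff zero_less_power)
  qed
  then have "inj G" by (rule strict_mono_imp_inj_on)
  obtain T1 where T1: "\<And>t. \<phi>1 t = 1 / (1 - \<epsilon> * sin (T1 t))" "\<And>t. G (T1 t) = t + G 0"
    using key[OF 1] by blast
  obtain T2 where T2: "\<And>t. \<phi>2 t = 1 / (1 - \<epsilon> * sin (T2 t))" "\<And>t. G (T2 t) = t + G 0"
    using key[OF 2] by blast
  have "T1 t = T2 t" for t using T1(2) T2(2) \<open>inj G\<close> by (metis injD)
  then show ?thesis using T1(1) T2(1) by auto
qed

lemma deriv_shift:
  fixes \<phi> :: "real \<Rightarrow> real"
  shows "deriv (\<lambda>s. \<phi> (s + T)) t = deriv \<phi> (t + T)"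
  by (simp add: deriv_def DERIV_shift)

text \<open>Kepler's parametrisation by the eccentric anomaly, with semi-major axis \<open>1 / (1 - \<epsilon>\<^sup>2)\<close> and
  signed eccentricity \<open>\<epsilon>\<close>.\<close>

lemma radial_solution_exists_periodic:
  assumes \<epsilon>: "\<bar>\<epsilon>\<bar> < 1"
  obtains \<phi> where "radial_solution UNIV \<phi>" "\<phi> 0 = 1" "deriv \<phi> 0 = \<epsilon>"
    "\<And>t. \<phi> (t + 2 * pi / (1 - \<epsilon>\<^sup>2) powr (3/2)) = \<phi> t"
proof -
  define b where "b = sqrt (1 - \<epsilon>\<^sup>2)"
  have b2: "b\<^sup>2 = 1 - \<epsilon>\<^sup>2" and b: "b > 0"
    using \<epsilon> by (auto simp: b_def abs_square_less_1 power_le_one_iff abs_square_le_1 less_imp_le)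
  \<comment> \<open>Kepler's equation: time as a function of the eccentric anomaly x. The mean
    motion is \<open>b^3\<close> because the semi-major axis is \<open>1 / b^2\<close>.\<close>
  define K where "K x = (x - \<epsilon> * sin x) / b^3" for x
  note pos = one_plus_eps_sin_pos[OF \<epsilon>]
  have K: "(K has_real_derivative (1 - \<epsilon> * cos x) / b^3) (at x)" for x
    unfolding K_def[abs_def] by (intro DERIV_cdivide) (auto intro!: derivative_eq_intros)
  have K_cont: "continuous_on S K" for S
    using K by (meson DERIV_isCont continuous_at_imp_continuous_on)
  have K_mono: "strict_mono K"
  proof (rule strict_monoI)
    fix x y :: real assume "x < y"
    then show "K x < K y"
      by (rule DERIV_pos_imp_increasing)
        (use K pos(2) b in \<open>metis zero_less_divide_iff zero_less_power\<close>)
  qed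
  have K_surj: "\<exists>x. K x = y" for y
  proof -
    \<comment> \<open>K differs from the line \<open>x / b^3\<close> by at most
      \<open>1 / b^3\<close>, so the points \<open>y * b^3 - 1\<close> and
      \<open>y * b^3 + 1\<close> bracket a preimage of y.\<close>
    have es: "\<bar>\<epsilon> * sin x\<bar> \<le> 1" for x
      using \<epsilon> abs_sin_le_one[of x] by (simp add: abs_mult mult_le_one)
    have "K (y * b^3 - 1) \<le> y" "y \<le> K (y * b^3 + 1)"
      using b es[of "y * b^3 - 1"] es[of "y * b^3 + 1"] by (simp_all add: K_def field_simps)
    then show ?thesis
      using IVT'[of K "y * b^3 - 1" y "y * b^3 + 1"] K_cont by auto
  qed
  then obtain E where E: "\<And>y. K (E y) = y"
    by metis
  have EK: "E (K x) = x" for x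
    using E[of "K x"] K_mono by (simp add: strict_mono_eq)
  have DE: "(E has_real_derivative b^3 / (1 - \<epsilon> * cos (E y))) (at y)" for y
  proof -
    have "isCont E (K (E y))"
      by (rule isCont_inverse_function[where d=1])
        (simp_all add: EK DERIV_isCont[OF K])
    then have "isCont E y" by (simp add: E)
    then have "(E has_real_derivative inverse ((1 - \<epsilon> * cos (E y)) / b^3)) (at y)"
      by (intro DERIV_inverse_function[where f=K and a="y - 1" and b="y + 1"])
        (use K[of "E y"] b pos(2)[of "E y"] in \<open>auto simp: E\<close>)
    then show ?thesis by simp
  qed
  \<comment> \<open>The anomaly \<open>arccos \<epsilon>\<close> is where the orbit has distance 1
    and radial velocity \<open>\<epsilon>\<close>; shifting time by \<open>t0\<close> puts this
    point at time 0.\<close>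
  define t0 where "t0 = K (arccos \<epsilon>)"
  define e where "e t = E (t + t0)" for t
  have De: "(e has_real_derivative b^3 / (1 - \<epsilon> * cos (e t))) (at t)" for t
    unfolding e_def using DE[of "t + t0"] by (simp add: DERIV_shift)
  have e0: "e 0 = arccos \<epsilon>" by (simp add: e_def t0_def EK)
  have cs: "cos (arccos \<epsilon>) = \<epsilon>" "sin (arccos \<epsilon>) = b"
    using \<epsilon> by (simp_all add: b_def sin_arccos_abs)
  define \<phi> where "\<phi> t = (1 - \<epsilon> * cos (e t)) / b\<^sup>2" for t
  define \<phi>' where "\<phi>' t = b * \<epsilon> * sin (e t) / (1 - \<epsilon> * cos (e t))" for t
  have D1: "(\<phi> has_real_derivative \<phi>' t) (at t)" for t
  proof -
    have "(\<phi> has_real_derivative (\<epsilon> * sin (e t) * (b^3 / (1 - \<epsilon> * cos (e t)))) / b\<^sup>2) (at t)"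
      unfolding \<phi>_def[abs_def] by (intro DERIV_cdivide) (auto intro!: derivative_eq_intros De)
    then show ?thesis
      using b by (simp add: \<phi>'_def power2_eq_square power3_eq_cube mult_ac)
  qed
  then have d: "deriv \<phi> = \<phi>'" by (auto intro: DERIV_imp_deriv)
  have D2: "(\<phi>' has_real_derivative - 1 / (\<phi> t)^2 + 1 / (\<phi> t)^3) (at t)" for t
  proof -
    let ?c = "cos (e t)" and ?s = "sin (e t)"
    let ?r = "1 - \<epsilon> * ?c"
    have r: "?r > 0" by (rule pos)
    have "(\<phi>' has_real_derivative (b * \<epsilon> * (?c * (b^3 / ?r)) * ?r - b * \<epsilon> * ?s * (\<epsilon> * ?s * (b^3 / ?r))) / (?r * ?r)) (at t)"
      unfolding \<phi>'_def[abs_def] using r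
      by (auto intro!: derivative_eq_intros De)
    also have "(b * \<epsilon> * (?c * (b^3 / ?r)) * ?r - b * \<epsilon> * ?s * (\<epsilon> * ?s * (b^3 / ?r))) / (?r * ?r)
       = - 1 / (\<phi> t)^2 + 1 / (\<phi> t)^3"
    proof -
      have alg: "(b * \<epsilon> * (c * (b^3 / r)) * r - b * \<epsilon> * s * (\<epsilon> * s * (b^3 / r))) / (r * r)
        = b^4 * (\<epsilon> * c * r - \<epsilon>\<^sup>2 * s\<^sup>2) / r^3" if "r > 0" for c s r :: real
        using that by (simp add: divide_simps) (simp add: algebra_simps eval_nat_numeral)
      have alg2: "b^4 * (b\<^sup>2 - r) / r^3 = - 1 / (r / b\<^sup>2)^2 + 1 / (r / b\<^sup>2)^3" if "r > 0" for r :: real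
        using that b by (simp add: divide_simps) (simp add: algebra_simps eval_nat_numeral)
      \<comment> \<open>The anomaly drops out: the cosine is expressed through \<open>?r\<close>,
        and the squares of sine and cosine combine to \<open>\<epsilon>\<close> squared, that is
        \<open>1 - b^2\<close>.\<close>
      have "\<epsilon> * ?c * ?r - \<epsilon>\<^sup>2 * ?s\<^sup>2 = b\<^sup>2 - ?r"
        unfolding sin_squared_eq b2 by (simp add: algebra_simps power2_eq_square)
      then show ?thesis
        unfolding alg[OF r] \<phi>_def alg2[OF r, symmetric] by simp
    qed
    finally show ?thesis .
  qed
  show ?thesis
  proof
    show "radial_solution UNIV \<phi>"
      unfolding radial_solution_def d using D1 D2 pos(2) b
      by (auto simp: \<phi>_def real_differentiable_def)
    show "\<phi> 0 = 1" using b b2[symmetric] by (simp add: \<phi>_def e0 cs power2_eq_square[symmetric])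
    show "deriv \<phi> 0 = \<epsilon>"
      using b b2[symmetric] by (simp add: d \<phi>'_def e0 cs power2_eq_square[symmetric]) (simp add: power2_eq_square)
    fix t
    have "b^3 = (1 - \<epsilon>\<^sup>2) powr (3/2)"
    proof -
      have "b^3 = b powr 3" using b by (simp add: powr_numeral)
      also have "\<dots> = (1 - \<epsilon>\<^sup>2) powr (3/2)"
        using b b2 by (simp add: b_def powr_half_sqrt[symmetric] powr_powr)
      finally show ?thesis .
    qed
    moreover have "E (y + 2 * pi / b^3) = E y + 2 * pi" for y
    proof -
      have "K (E y + 2 * pi) = K (E y) + 2 * pi / b^3"
        by (simp only: K_def sin_periodic add_divide_distrib diff_divide_distrib)
      then show ?thesis using EK[of "E y + 2 * pi"] by (simp add: E)
    qed
    ultimately have "e (t + 2 * pi / (1 - \<epsilon>\<^sup>2) powr (3/2)) = e t + 2 * pi"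
      by (simp add: e_def) (metis add.assoc add.commute)
    then show "\<phi> (t + 2 * pi / (1 - \<epsilon>\<^sup>2) powr (3/2)) = \<phi> t"
      by (simp add: \<phi>_def)
  qed
qed

section \<open>The Abel kernel\<close>

text \<open>Dominated convergence for difference quotients: the Lipschitz bound gives the majorant
  \<open>L * |k|\<close>, and the corners of f concern only finitely many y. All smoothness is taken
  from f, so k may be singular.\<close>

lemma has_real_derivative_convolution:
  fixes f f' k :: "real \<Rightarrow> real"
  assumes k: "integrable lborel k"
    and fk: "\<And>r. integrable lborel (\<lambda>y. f (r - y) * k y)"
    and lip: "\<And>x y. \<bar>f x - f y\<bar> \<le> L * \<bar>x - y\<bar>"
    and [measurable]: "f' \<in> borel_measurable borel"
    and N: "finite N" and f': "\<And>x. x \<notin> N \<Longrightarrow> (f has_real_derivative f' x) (at x)"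
  shows "((\<lambda>r. \<integral>y. f (r - y) * k y \<partial>lborel) has_real_derivative (\<integral>y. f' (r - y) * k y \<partial>lborel)) (at r)"
proof -
  have [measurable]: "k \<in> borel_measurable borel" using k by auto
  have "continuous_on UNIV f"
  proof (intro lipschitz_on_continuous_on[of "max L 0"] lipschitz_onI)
    show "dist (f x) (f y) \<le> max L 0 * dist x y" for x y
      using lip[of x y] mult_right_mono[of L "max L 0" "\<bar>x - y\<bar>"] by (simp add: dist_real_def)
  qed simp
  then have [measurable]: "f \<in> borel_measurable borel"
    by (rule borel_measurable_continuous_onI)
  have "(\<lambda>i. ((\<integral>y. f (r + X i - y) * k y \<partial>lborel) - (\<integral>y. f (r - y) * k y \<partial>lborel)) / X i)
      \<longlonglongrightarrow> (\<integral>y. f' (r - y) * k y \<partial>lborel)" if X: "\<And>i. X i \<noteq> 0" "X \<longlonglongrightarrow> 0" for X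
  proof -
    let ?q = "\<lambda>i y. (f (r + X i - y) - f (r - y)) / X i * k y"
    have "(\<lambda>i. \<integral>y. ?q i y \<partial>lborel) \<longlonglongrightarrow> (\<integral>y. f' (r - y) * k y \<partial>lborel)"
    proof (rule integral_dominated_convergence[where w="\<lambda>y. L * \<bar>k y\<bar>"])
      have "AE y in lborel. \<forall>n\<in>N. y \<noteq> r - n"
        using N by (simp add: AE_finite_all AE_lborel_singleton)
      then show "AE y in lborel. (\<lambda>i. ?q i y) \<longlonglongrightarrow> f' (r - y) * k y"
      proof eventually_elim
        case (elim y)
        then have "r - y \<notin> N" by (metis diff_diff_eq2 add_diff_cancel_left')
        then have "((\<lambda>h. (f (r - y + h) - f (r - y)) / h) \<longlongrightarrow> f' (r - y)) (at 0)"
          using f' by (simp add: DERIV_def)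
        then have "(\<lambda>i. (f (r - y + X i) - f (r - y)) / X i) \<longlonglongrightarrow> f' (r - y)"
          using X by (auto simp: tendsto_at_iff_sequentially o_def)
        then show ?case by (intro tendsto_mult tendsto_const) (simp add: algebra_simps)
      qed
      show "AE y in lborel. norm (?q i y) \<le> L * \<bar>k y\<bar>" for i
      proof (rule AE_I2)
        fix y
        have "\<bar>f (r + X i - y) - f (r - y)\<bar> \<le> L * \<bar>X i\<bar>"
          using lip[of "r + X i - y" "r - y"] by simp
        then have "\<bar>(f (r + X i - y) - f (r - y)) / X i\<bar> \<le> L"
          using X(1)[of i] by (simp add: abs_divide divide_le_eq)
        then show "norm (?q i y) \<le> L * \<bar>k y\<bar>"
          by (simp only: real_norm_def abs_mult) (rule mult_right_mono, auto)
      qed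
    qed (use k in auto)
    moreover have "(\<integral>y. ?q i y \<partial>lborel) = ((\<integral>y. f (r + X i - y) * k y \<partial>lborel) - (\<integral>y. f (r - y) * k y \<partial>lborel)) / X i" for i
    proof -
      have "(\<integral>y. ?q i y \<partial>lborel) = (\<integral>y. (f (r + X i - y) * k y - f (r - y) * k y) / X i \<partial>lborel)"
        by (intro Bochner_Integration.integral_cong) (auto simp: field_simps)
      then show ?thesis using fk by simp
    qed
    ultimately show ?thesis by (simp only:)
  qed
  then show ?thesis
    by (auto simp: DERIV_def tendsto_at_iff_sequentially o_def)
qed

lemma isCont_convolution:
  fixes g k :: "real \<Rightarrow> real"
  assumes k: "integrable lborel k"
    and [measurable]: "g \<in> borel_measurable borel" and bd: "\<And>x. \<bar>g x\<bar> \<le> M"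
    and N: "finite N" and g: "\<And>x. x \<notin> N \<Longrightarrow> isCont g x"
  shows "isCont (\<lambda>r. \<integral>y. g (r - y) * k y \<partial>lborel) r"
  unfolding continuous_at_sequentially o_def
proof (intro allI impI)
  have [measurable]: "k \<in> borel_measurable borel" using k by auto
  fix X assume X: "X \<longlonglongrightarrow> r"
  show "(\<lambda>n. \<integral>y. g (X n - y) * k y \<partial>lborel) \<longlonglongrightarrow> (\<integral>y. g (r - y) * k y \<partial>lborel)"
  proof (rule integral_dominated_convergence[where w="\<lambda>y. M * \<bar>k y\<bar>"])
    have "AE y in lborel. \<forall>n\<in>N. y \<noteq> r - n"
      using N by (simp add: AE_finite_all AE_lborel_singleton)
    then show "AE y in lborel. (\<lambda>i. g (X i - y) * k y) \<longlonglongrightarrow> g (r - y) * k y"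
    proof eventually_elim
      case (elim y)
      then have "r - y \<notin> N" by (metis diff_diff_eq2 add_diff_cancel_left')
      then have "(\<lambda>i. g (X i - y)) \<longlonglongrightarrow> g (r - y)"
        by (intro isCont_tendsto_compose[OF g] tendsto_diff X tendsto_const)
      then show ?case by (intro tendsto_mult tendsto_const)
    qed
    show "AE y in lborel. norm (g (X i - y) * k y) \<le> M * \<bar>k y\<bar>" for i
      using bd by (auto simp: abs_mult intro!: AE_I2 mult_right_mono)
  qed (use k in auto)
qed

text \<open>Nonnegativity turns the gauge integral of the fundamental theorem into a Lebesgue
  integral. This covers integrands that are unbounded at the ends, such as inverse square
  roots.\<close>

lemma has_bochner_integral_FTC:
  fixes F f :: "real \<Rightarrow> real"
  assumes "finite N" "a \<le> b"
    and "\<And>x. x \<in> {a<..<b} - N \<Longrightarrow> (F has_real_derivative f x) (at x)"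
    and "continuous_on {a..b} F" "\<And>x. x \<in> {a..b} \<Longrightarrow> 0 \<le> f x"
    and "f \<in> borel_measurable borel"
  shows "has_bochner_integral lborel (\<lambda>x. indicator {a..b} x * f x) (F b - F a)"
proof (rule has_bochner_integral_nn_integral)
  have *: "(f has_integral F b - F a) {a..b}"
    using assms by (intro fundamental_theorem_of_calculus_interior_strong[of N])
      (auto simp: has_real_derivative_iff_has_vector_derivative)
  show "0 \<le> F b - F a"
    using has_integral_nonneg[OF * assms(5)] by simp
  show "(\<integral>\<^sup>+x. ennreal (indicator {a..b} x * f x) \<partial>lborel) = ennreal (F b - F a)"
    using nn_integral_has_integral_lebesgue[OF assms(5) *] by simp
qed (use assms(5,6) in \<open>auto split: split_indicator\<close>)

lemma nn_integral_has_bochner_integral: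
  fixes f :: "'a \<Rightarrow> real"
  assumes "has_bochner_integral M f c" "\<And>y. 0 \<le> f y"
  shows "(\<integral>\<^sup>+y. ennreal (f y) \<partial>M) = ennreal c"
  using assms by (simp add: has_bochner_integral_iff nn_integral_eq_integral)

text \<open>The kernel is cut off at 2 to be integrable on the whole line. Convolution with a
  function supported in the nonnegative reals does not notice the cut at points up to 2, and only
  points up to 1 matter.\<close>

definition abel_kernel :: "real \<Rightarrow> real" where
  "abel_kernel y = (if 0 < y \<and> y < 2 then 1 / sqrt y else 0)"

lemma abel_kernel_measurable [measurable]: "abel_kernel \<in> borel_measurable borel"
  unfolding abel_kernel_def[abs_def] by measurable

lemma abel_kernel_nonneg: "0 \<le> abel_kernel y"
  by (simp add: abel_kernel_def)

lemma has_bochner_integral_abel_kernel_Icc: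
  assumes "0 \<le> p" "p \<le> 2"
  shows "has_bochner_integral lborel (\<lambda>y. indicator {0..p} y * abel_kernel y) (2 * sqrt p)"
proof -
  have "has_bochner_integral lborel (\<lambda>y. indicator {0..p} y * abel_kernel y) (2 * sqrt p - 2 * sqrt 0)"
  proof (rule has_bochner_integral_FTC[of "{}"])
    fix x assume "x \<in> {0<..<p} - {}"
    then show "((\<lambda>y. 2 * sqrt y) has_real_derivative abel_kernel x) (at x)"
      using assms by (auto intro!: derivative_eq_intros simp: abel_kernel_def field_simps)
  qed (use assms in \<open>auto simp: abel_kernel_nonneg intro!: continuous_intros\<close>)
  then show ?thesis by simp
qed

lemma integrable_abel_kernel: "integrable lborel abel_kernel"
proof -
  have "(\<lambda>y. indicator {0..2} y * abel_kernel y) = abel_kernel"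
    by (auto simp: abel_kernel_def indicator_def fun_eq_iff)
  then show ?thesis
    using has_bochner_integral_abel_kernel_Icc[of 2] by (auto simp: has_bochner_integral_iff)
qed

text \<open>The primitive is \<open>arcsin (u / sqrt m)\<close>. That the value \<open>pi\<close>
  does not depend on m is what makes the Abel transform invertible.\<close>

lemma has_bochner_integral_abel_kernel_quadratic:
  assumes "m < 2"
  shows "has_bochner_integral lborel (\<lambda>u. abel_kernel (m - u\<^sup>2)) (if 0 < m then pi else 0)"
proof (cases "0 < m")
  case False
  then have "abel_kernel (m - u\<^sup>2) = 0" for u
  proof -
    have "\<not> 0 < m - u\<^sup>2" using False zero_le_power2[of u] by linarith
    then show ?thesis by (simp only: abel_kernel_def simp_thms if_False)
  qed
  then show ?thesis using False by (simp add: has_bochner_integral_zero)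
next
  case True
  let ?r = "sqrt m"
  have r: "0 < ?r" "?r\<^sup>2 = m" using True by auto
  have bd: "-1 \<le> x / ?r \<and> x / ?r \<le> 1" if "x \<in> {-?r..?r}" for x
    using that r by (auto simp: divide_simps)
  have "has_bochner_integral lborel (\<lambda>u. indicator {-?r..?r} u * abel_kernel (m - u\<^sup>2))
      (arcsin (?r / ?r) - arcsin ((-?r) / ?r))"
  proof (rule has_bochner_integral_FTC[of "{}"])
    fix x assume x: "x \<in> {-?r<..<?r} - {}"
    then have x2: "x\<^sup>2 < m" using r by (metis abs_less_iff DiffD1 greaterThanLessThan_iff minus_less_iff real_sqrt_abs real_sqrt_less_iff)
    have *: "-1 < x / ?r" "x / ?r < 1" using x r by (auto simp: divide_simps)
    have "sqrt (1 - (x / ?r)\<^sup>2) = sqrt (m - x\<^sup>2) / ?r"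
      using True by (simp add: power_divide real_sqrt_divide[symmetric] diff_divide_distrib)
    then have "((\<lambda>u. arcsin (u / ?r)) has_real_derivative inverse (sqrt (m - x\<^sup>2) / ?r) * (1 / ?r)) (at x)"
      using DERIV_chain2[OF DERIV_arcsin[OF *] DERIV_cdivide[OF DERIV_ident]] by simp
    then show "((\<lambda>u. arcsin (u / ?r)) has_real_derivative abel_kernel (m - x\<^sup>2)) (at x)"
    proof -
      have "inverse (sqrt (m - x\<^sup>2) / ?r) * (1 / ?r) = 1 / sqrt (m - x\<^sup>2)"
        using r(1) by (simp add: inverse_eq_divide)
      moreover have "m - x\<^sup>2 < 2" using assms zero_le_power2[of x] by linarith
      ultimately show ?thesis
        using x2 \<open>((\<lambda>u. arcsin (u / ?r)) has_real_derivative inverse (sqrt (m - x\<^sup>2) / ?r) * (1 / ?r)) (at x)\<close>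
        by (simp add: abel_kernel_def)
    qed
  next
    show "continuous_on {-?r..?r} (\<lambda>u. arcsin (u / ?r))"
      using r bd by (intro continuous_on_arcsin continuous_intros) auto
  qed (use r in \<open>auto simp: abel_kernel_nonneg\<close>)
  moreover have "indicator {-?r..?r} u * abel_kernel (m - u\<^sup>2) = abel_kernel (m - u\<^sup>2)" for u
  proof (cases "u \<in> {-?r..?r}")
    case False
    then have "?r < \<bar>u\<bar>" by auto
    then have "?r\<^sup>2 < \<bar>u\<bar>\<^sup>2" using r by (intro power_strict_mono) auto
    then show ?thesis using r by (simp add: abel_kernel_def)
  qed simp
  ultimately show ?thesis using True by simp
qed

lemma lipschitz_of_derivative_bound:
  fixes f f' :: "real \<Rightarrow> real"
  assumes N: "finite N" and f: "continuous_on UNIV f"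
    and f': "\<And>x. x \<notin> N \<Longrightarrow> (f has_real_derivative f' x) (at x)" and bd: "\<And>x. \<bar>f' x\<bar> \<le> L"
  shows "\<bar>f x - f y\<bar> \<le> L * \<bar>x - y\<bar>"
proof -
  have *: "\<bar>f b - f a\<bar> \<le> L * (b - a)" if "a \<le> b" for a b
  proof -
    have "(f' has_integral f b - f a) {a..b}"
      using N f' that continuous_on_subset[OF f]
      by (intro fundamental_theorem_of_calculus_interior_strong[of N])
        (auto simp: has_real_derivative_iff_has_vector_derivative)
    moreover have "0 \<le> L" using bd[of 0] by linarith
    ultimately have "norm (f b - f a) \<le> L * measure lborel (cbox a b)"
      by (intro has_integral_bound[where f=f']) (use bd in auto)
    then show ?thesis using that by simp
  qed
  show ?thesis
  proof (cases "x \<le> y")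
    case True then show ?thesis using *[of x y] by (simp add: abs_minus_commute)
  next
    case False then show ?thesis using *[of y x] by simp
  qed
qed

section \<open>The iterates of \<open>h\<close>\<close>

locale static_parameter =
  fixes \<Gamma> :: real
  assumes Gamma_ge: "1 - 1 / 2 ^ 12 \<le> \<Gamma>" and Gamma_less: "\<Gamma> < 1"
begin

definition \<delta> :: real where "\<delta> = 1 - \<Gamma>"

lemma delta_pos: "0 < \<delta>" and delta_le: "\<delta> \<le> 1 / 4096" and Gamma_pos: "0 < \<Gamma>" and Gamma_eq: "\<Gamma> = 1 - \<delta>"
  using Gamma_ge Gamma_less by (auto simp: \<delta>_def)

text \<open>The real restriction of \<open>h_c\<close>. It maps \<open>{0..\<delta>}\<close> into
  itself, so the series can be treated by real analysis on this interval.\<close>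

definition h :: "real \<Rightarrow> real" where "h z = z * (1 - \<Gamma> / (1 - z))"
definition h' :: "real \<Rightarrow> real" where "h' z = 1 - \<Gamma> / (1 - z)\<^sup>2"
definition h'' :: "real \<Rightarrow> real" where "h'' z = - 2 * \<Gamma> / (1 - z) ^ 3"

text \<open>The factor \<open>1 - \<Gamma> / (1 - z)\<close> equals
  \<open>(\<delta> - z) / (1 - z)\<close>, which lies between 0 and 1.\<close>

lemma h_in: assumes "z \<in> {0..\<delta>}" shows "h z \<in> {0..\<delta>}" "h z \<le> z"
proof -
  have z: "0 \<le> z" "z \<le> \<delta>" "0 < 1 - z" using assms delta_le by auto
  have eq: "1 - \<Gamma> / (1 - z) = (\<delta> - z) / (1 - z)"
    using z by (simp add: \<delta>_def field_simps)
  have "0 \<le> (\<delta> - z) / (1 - z)" "(\<delta> - z) / (1 - z) \<le> 1"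
    using z delta_le by (auto simp: divide_simps)
  then have "0 \<le> z * ((\<delta> - z) / (1 - z))" "z * ((\<delta> - z) / (1 - z)) \<le> z * 1"
    using z(1) by (blast intro: mult_nonneg_nonneg mult_left_mono)+
  then have "0 \<le> h z" "h z \<le> z"
    unfolding h_def eq by simp_all
  then show "h z \<in> {0..\<delta>}" "h z \<le> z" using z by auto
qed

lemma h_zero [simp]: "h 0 = 0" and h_delta [simp]: "h \<delta> = 0"
  using Gamma_pos by (auto simp: h_def \<delta>_def)

lemma h_deriv: assumes "z \<in> {0..\<delta>}" shows "(h has_real_derivative h' z) (at z)"
proof -
  have z: "1 - z \<noteq> 0" using assms delta_le by auto
  have "(h has_real_derivative 1 * (1 - \<Gamma> / (1 - z)) + (- (\<Gamma> / (1 - z)\<^sup>2)) * z) (at z)"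
    unfolding h_def[abs_def] using z
    by (auto intro!: derivative_eq_intros simp: power2_eq_square)
  moreover have "1 * (1 - \<Gamma> / (1 - z)) + (- (\<Gamma> / (1 - z)\<^sup>2)) * z = h' z"
  proof -
    have "1 * (1 - \<Gamma> / w) + (- (\<Gamma> / w\<^sup>2)) * (1 - w) = 1 - \<Gamma> / w\<^sup>2" if "w \<noteq> 0" for w
      using that by (simp add: field_simps power2_eq_square)
    from this[OF z] show ?thesis by (simp add: h'_def)
  qed
  ultimately show ?thesis by simp
qed

lemma h'_deriv: assumes "z \<in> {0..\<delta>}" shows "(h' has_real_derivative h'' z) (at z)"
proof -
  have z: "1 - z \<noteq> 0" using assms delta_le by auto
  have "(h' has_real_derivative - (\<Gamma> * (2 * (1 - z)) / ((1 - z)\<^sup>2 * (1 - z)\<^sup>2))) (at z)"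
    unfolding h'_def[abs_def] using z
    by (auto intro!: derivative_eq_intros simp: power2_eq_square) (simp add: minus_divide_left right_diff_distrib)
  moreover have "- (\<Gamma> * (2 * (1 - z)) / ((1 - z)\<^sup>2 * (1 - z)\<^sup>2)) = h'' z"
    using z unfolding h''_def by (simp add: divide_simps eval_nat_numeral)
  ultimately show ?thesis by simp
qed

lemma h''_cont: "continuous_on {0..\<delta>} h''"
  unfolding h''_def using delta_le by (intro continuous_intros) auto

text \<open>Over the common denominator \<open>(1 - z)^2\<close> the numerator is a difference of
  two numbers close to 1. The ratio 1/4 drives the geometric decay below and leaves room for the
  positivity in \<open>Psi'_pos\<close>.\<close>

lemma h'_bound: assumes "z \<in> {0..\<delta>}" shows "\<bar>h' z\<bar> \<le> 1 / 4"
proof -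
  have z: "3 / 4 \<le> (1 - z)\<^sup>2" "(1 - z)\<^sup>2 \<le> 1" "0 < (1 - z)\<^sup>2"
  proof -
    have "1 - 2 * z \<le> (1 - z)\<^sup>2" by (simp add: power2_eq_square algebra_simps)
    then show "3 / 4 \<le> (1 - z)\<^sup>2" using assms delta_le by auto
    then show "0 < (1 - z)\<^sup>2" by linarith
    show "(1 - z)\<^sup>2 \<le> 1" using assms delta_le by (intro power_le_one) auto
  qed
  have e: "1 - 2 * z \<le> (1 - z)\<^sup>2" by (simp add: power2_eq_square algebra_simps)
  have "\<bar>(1 - z)\<^sup>2 - \<Gamma>\<bar> \<le> 1 / 8"
  proof (rule abs_leI)
    show "(1 - z)\<^sup>2 - \<Gamma> \<le> 1 / 8" using z delta_le Gamma_eq by linarith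
    show "- ((1 - z)\<^sup>2 - \<Gamma>) \<le> 1 / 8" using e assms delta_le Gamma_eq delta_pos by simp
  qed
  moreover have "h' z = ((1 - z)\<^sup>2 - \<Gamma>) / (1 - z)\<^sup>2" using z by (simp add: h'_def diff_divide_distrib)
  ultimately show ?thesis using z by (simp add: abs_divide divide_le_eq)
qed

lemma h''_bound: assumes "z \<in> {0..\<delta>}" shows "\<bar>h'' z\<bar> \<le> 3"
proof -
  have z: "9 / 10 \<le> 1 - z" using assms delta_le by auto
  then have "(9 / 10)^3 \<le> (1 - z)^3" by (intro power_mono) auto
  then have "2 * \<Gamma> \<le> 3 * (1 - z)^3" "0 < (1 - z)^3"
    using Gamma_less z by (auto simp: power3_eq_cube)
  then show ?thesis using Gamma_pos by (simp add: h''_def abs_divide divide_le_eq abs_mult)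
qed

section \<open>Derivatives of the iterates\<close>

primrec iter_deriv :: "nat \<Rightarrow> real \<Rightarrow> real" where
  "iter_deriv 0 z = 1"
| "iter_deriv (Suc k) z = h' ((h ^^ k) z) * iter_deriv k z"

primrec iter_deriv2 :: "nat \<Rightarrow> real \<Rightarrow> real" where
  "iter_deriv2 0 z = 0"
| "iter_deriv2 (Suc k) z = h'' ((h ^^ k) z) * (iter_deriv k z)\<^sup>2 + h' ((h ^^ k) z) * iter_deriv2 k z"

lemma iter_in: "z \<in> {0..\<delta>} \<Longrightarrow> (h ^^ k) z \<in> {0..\<delta>}"
  by (induction k) (auto simp del: atLeastAtMost_iff intro: h_in)

lemma iter_deriv: "z \<in> {0..\<delta>} \<Longrightarrow> ((h ^^ k) has_real_derivative iter_deriv k z) (at z)"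
proof (induction k)
  case (Suc k)
  then show ?case
    using DERIV_chain[OF h_deriv[OF iter_in] Suc.IH] by (simp add: o_def)
qed (simp add: id_def)

lemma iter_deriv2: "z \<in> {0..\<delta>} \<Longrightarrow> (iter_deriv k has_real_derivative iter_deriv2 k z) (at z)"
proof (induction k)
  case 0
  then show ?case by (simp add: iter_deriv_def)
next
  case (Suc k)
  have "((\<lambda>z. h' ((h ^^ k) z) * iter_deriv k z) has_real_derivative
     h'' ((h ^^ k) z) * iter_deriv k z * iter_deriv k z + iter_deriv2 k z * h' ((h ^^ k) z)) (at z)"
    by (intro DERIV_mult DERIV_chain2[where g="h ^^ k" and f=h', OF h'_deriv[OF iter_in]] iter_deriv Suc)
  moreover have "iter_deriv (Suc k) = (\<lambda>z. h' ((h ^^ k) z) * iter_deriv k z)" by auto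
  ultimately show ?case by (simp add: power2_eq_square mult_ac)
qed

lemma iter_deriv_bound: "z \<in> {0..\<delta>} \<Longrightarrow> \<bar>iter_deriv k z\<bar> \<le> (1 / 4) ^ k"
proof (induction k)
  case (Suc k)
  have "\<bar>h' ((h ^^ k) z)\<bar> * \<bar>iter_deriv k z\<bar> \<le> 1 / 4 * (1 / 4) ^ k"
    using Suc by (intro mult_mono h'_bound iter_in) auto
  then show ?case by (simp add: abs_mult)
qed simp

text \<open>With the bounds 3 for \<open>h''\<close> and 1/4 for \<open>h'\<close>, a constant c
  times \<open>(1 / 2) ^ k\<close> survives the induction if \<open>3 + c / 4 <= c / 2\<close>; this
  gives c = 12.\<close>

lemma iter_deriv2_bound: "z \<in> {0..\<delta>} \<Longrightarrow> \<bar>iter_deriv2 k z\<bar> \<le> 12 * (1 / 2) ^ k"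
proof (induction k)
  case (Suc k)
  have "\<bar>iter_deriv k z\<bar>\<^sup>2 \<le> ((1 / 4) ^ k)\<^sup>2"
    using iter_deriv_bound[OF Suc.prems] by (intro power_mono) auto
  also have "((1 / 4 :: real) ^ k)\<^sup>2 = (1 / 16) ^ k"
    by (simp add: power2_eq_square power_mult_distrib[symmetric])
  also have "(1 / 16 :: real) ^ k \<le> (1 / 2) ^ k"
    by (rule power_mono) auto
  finally have "\<bar>h'' ((h ^^ k) z)\<bar> * \<bar>iter_deriv k z\<bar>\<^sup>2 \<le> 3 * (1 / 2) ^ k"
    using Suc by (intro mult_mono h''_bound iter_in) auto
  moreover have "\<bar>h' ((h ^^ k) z)\<bar> * \<bar>iter_deriv2 k z\<bar> \<le> 1 / 4 * (12 * (1 / 2) ^ k)"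
    using Suc by (intro mult_mono h'_bound iter_in) auto
  moreover have "\<bar>iter_deriv2 (Suc k) z\<bar> \<le> \<bar>h'' ((h ^^ k) z)\<bar> * \<bar>iter_deriv k z\<bar>\<^sup>2 + \<bar>h' ((h ^^ k) z)\<bar> * \<bar>iter_deriv2 k z\<bar>"
    unfolding iter_deriv2.simps by (rule order_trans[OF abs_triangle_ineq]) (simp add: abs_mult)
  ultimately show ?case by simp
qed simp

section \<open>The sum of the iterates and its derivatives\<close>

definition iter_sum :: "real \<Rightarrow> real" where "iter_sum z = (\<Sum>k. (h ^^ k) z)"
definition iter_sum' :: "real \<Rightarrow> real" where "iter_sum' z = (\<Sum>k. iter_deriv k z)"
definition iter_sum'' :: "real \<Rightarrow> real" where "iter_sum'' z = (\<Sum>k. iter_deriv2 k z)"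

lemma iter_zero: "(h ^^ k) 0 = 0"
  by (induction k) auto

lemma uniform_iter_deriv: "uniform_limit {0..\<delta>} (\<lambda>n z. \<Sum>k<n. iter_deriv k z) iter_sum' sequentially"
  unfolding iter_sum'_def
  by (rule Weierstrass_m_test[where M="\<lambda>k. (1 / 4) ^ k"]) (use iter_deriv_bound in auto)

lemma uniform_iter_deriv2: "uniform_limit {0..\<delta>} (\<lambda>n z. \<Sum>k<n. iter_deriv2 k z) iter_sum'' sequentially"
  unfolding iter_sum''_def
  by (rule Weierstrass_m_test[where M="\<lambda>k. 12 * (1 / 2) ^ k"])
    (use iter_deriv2_bound in \<open>auto intro!: summable_mult\<close>)

lemma summable_iter_deriv: "z \<in> {0..\<delta>} \<Longrightarrow> summable (\<lambda>k. iter_deriv k z)"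
  by (rule summable_comparison_test'[of "\<lambda>k. (1 / 4) ^ k" 0]) (use iter_deriv_bound in auto)

text \<open>Termwise differentiation asks for uniform convergence of the derivatives and convergence
  at a single point; at 0 all iterates vanish. Derivatives are one-sided at both ends.\<close>

lemma iter_sums_deriv:
  assumes "z \<in> {0..\<delta>}"
  shows "(\<lambda>k. (h ^^ k) z) sums iter_sum z"
    and "(iter_sum has_real_derivative iter_sum' z) (at z within {0..\<delta>})"
proof -
  have "\<exists>g. \<forall>x\<in>{0..\<delta>}. (\<lambda>n. (h ^^ n) x) sums g x \<and> (g has_field_derivative iter_sum' x) (at x within {0..\<delta>})"
    using delta_pos iter_zero
    by (intro has_field_derivative_series[where f'=iter_deriv and ?x0.0=0] uniform_iter_deriv)
      (auto intro!: has_field_derivative_at_within[OF iter_deriv])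
  then obtain g where g: "\<And>x. x \<in> {0..\<delta>} \<Longrightarrow> (\<lambda>n. (h ^^ n) x) sums g x"
    "\<And>x. x \<in> {0..\<delta>} \<Longrightarrow> (g has_field_derivative iter_sum' x) (at x within {0..\<delta>})" by blast
  then have eq: "iter_sum x = g x" if "x \<in> {0..\<delta>}" for x
    using that unfolding iter_sum_def by (intro sums_unique[symmetric]) auto
  show "(\<lambda>k. (h ^^ k) z) sums iter_sum z" using g(1) eq assms by simp
  show "(iter_sum has_real_derivative iter_sum' z) (at z within {0..\<delta>})"
    by (rule has_field_derivative_transform_within[OF g(2)[OF assms] zero_less_one])
      (use assms eq in auto)
qed

lemma iter_sum'_deriv:
  assumes "z \<in> {0..\<delta>}"
  shows "(iter_sum' has_real_derivative iter_sum'' z) (at z within {0..\<delta>})"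
proof -
  have "\<exists>g. \<forall>x\<in>{0..\<delta>}. (\<lambda>n. iter_deriv n x) sums g x \<and> (g has_field_derivative iter_sum'' x) (at x within {0..\<delta>})"
    using delta_pos
    by (intro has_field_derivative_series[where f'=iter_deriv2 and ?x0.0=0] uniform_iter_deriv2 summable_iter_deriv)
      (auto intro!: has_field_derivative_at_within[OF iter_deriv2])
  then obtain g where g: "\<And>x. x \<in> {0..\<delta>} \<Longrightarrow> (\<lambda>n. iter_deriv n x) sums g x"
    "\<And>x. x \<in> {0..\<delta>} \<Longrightarrow> (g has_field_derivative iter_sum'' x) (at x within {0..\<delta>})" by blast
  then have eq: "iter_sum' x = g x" if "x \<in> {0..\<delta>}" for x
    using that unfolding iter_sum'_def by (intro sums_unique[symmetric]) auto
  show ?thesis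
    by (rule has_field_derivative_transform_within[OF g(2)[OF assms] zero_less_one])
      (use assms eq in auto)
qed

lemma iter_sum''_cont: "continuous_on {0..\<delta>} iter_sum''"
proof (rule uniform_limit_theorem[OF _ uniform_iter_deriv2])
  have "continuous_on {0..\<delta>} (iter_deriv2 k)" for k
  proof (induction k)
    case 0
    then show ?case by (simp add: iter_deriv2_def)
  next
    case (Suc k)
    have 1: "continuous_on {0..\<delta>} (h ^^ k)" "continuous_on {0..\<delta>} (iter_deriv k)"
      using DERIV_continuous_on[OF has_field_derivative_at_within[OF iter_deriv]]
        DERIV_continuous_on[OF has_field_derivative_at_within[OF iter_deriv2]] by blast+
    have 2: "continuous_on {0..\<delta>} h'"
      using DERIV_continuous_on[OF has_field_derivative_at_within[OF h'_deriv]] by blast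
    have "continuous_on {0..\<delta>} (\<lambda>z. h'' ((h ^^ k) z) * (iter_deriv k z)\<^sup>2 + h' ((h ^^ k) z) * iter_deriv2 k z)"
      by (intro continuous_intros Suc 1 continuous_on_compose2[OF h''_cont] continuous_on_compose2[OF 2])
        (use iter_in in auto)
    moreover have "iter_deriv2 (Suc k) = (\<lambda>z. h'' ((h ^^ k) z) * (iter_deriv k z)\<^sup>2 + h' ((h ^^ k) z) * iter_deriv2 k z)" by auto
    ultimately show ?case by simp
  qed
  then show "\<forall>\<^sub>F n in sequentially. continuous_on {0..\<delta>} (\<lambda>z. \<Sum>k<n. iter_deriv2 k z)"
    by (intro always_eventually allI continuous_intros) auto
qed simp

lemma iter_sum'_bound: "z \<in> {0..\<delta>} \<Longrightarrow> \<bar>iter_sum' z\<bar> \<le> 2"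
proof -
  assume z: "z \<in> {0..\<delta>}"
  have "norm (iter_sum' z) \<le> (\<Sum>k. (1 / 4 :: real) ^ k)"
    unfolding iter_sum'_def using z iter_deriv_bound by (intro norm_suminf_le) auto
  then show ?thesis by (simp add: suminf_geometric)
qed

lemma iter_sum''_bound: "z \<in> {0..\<delta>} \<Longrightarrow> \<bar>iter_sum'' z\<bar> \<le> 24"
proof -
  assume z: "z \<in> {0..\<delta>}"
  have "norm (iter_sum'' z) \<le> (\<Sum>k. 12 * (1 / 2 :: real) ^ k)"
    unfolding iter_sum''_def using z iter_deriv2_bound
    by (intro norm_suminf_le) (auto intro!: summable_mult)
  then show ?thesis by (simp add: suminf_geometric suminf_mult)
qed

lemma iter_sum_eq: assumes "z \<in> {0..\<delta>}" shows "iter_sum z = z + iter_sum (h z)"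
proof -
  have "summable (\<lambda>k. (h ^^ k) z)" using iter_sums_deriv(1)[OF assms] by (rule sums_summable)
  then show ?thesis
    using suminf_split_head[of "\<lambda>k. (h ^^ k) z"] by (simp add: iter_sum_def funpow_swap1)
qed

lemma iter_sum_zero: "iter_sum 0 = 0"
  by (simp add: iter_sum_def iter_zero)

text \<open>As \<open>h\<close> sends \<open>\<delta>\<close> to the fixed point 0, only the first
  term survives. Hence the two branches of \<open>psi\<close> join continuously at
  \<open>\<delta>\<close>.\<close>

lemma iter_sum_delta: "iter_sum \<delta> = \<delta>"
  using iter_sum_eq[of \<delta>] delta_pos by (simp add: iter_sum_zero)

lemma iter_sum'_eq: assumes "z \<in> {0..\<delta>}" shows "iter_sum' z = 1 + h' z * iter_sum' (h z)"
proof -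
  have "iter_deriv (Suc k) z = h' z * iter_deriv k (h z)" for k
  proof (induction k)
    case (Suc k)
    have "(h ^^ Suc k) z = (h ^^ k) (h z)" by (simp add: funpow_swap1)
    then show ?case
      unfolding iter_deriv.simps(2)[of "Suc k" z] Suc.IH by simp
  qed simp
  then show ?thesis
    using suminf_split_head[OF summable_iter_deriv[OF assms]] suminf_mult[OF summable_iter_deriv[OF h_in(1)[OF assms]], of "h' z"]
    by (simp add: iter_sum'_def)
qed

text \<open>At the fixed point 0 the slope of \<open>h\<close> is \<open>\<delta>\<close>, and the
  geometric series of \<open>\<delta>\<close> sums to \<open>1 / \<Gamma>\<close>. This is the
  height of the first jump of psi'.\<close>

lemma iter_sum'_zero: "iter_sum' 0 = 1 / \<Gamma>"
  using iter_sum'_eq[of 0] delta_pos Gamma_pos by (simp add: h'_def field_simps)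

text \<open>The slope of \<open>h\<close> at \<open>\<delta>\<close> is
  \<open>1 - 1 / \<Gamma>\<close>, which is negative. So the slope of psi can only jump upwards at
  \<open>\<delta>\<close>; this sign is used for the positivity of \<open>Phi\<close>.\<close>

lemma iter_sum'_delta_le: "iter_sum' \<delta> \<le> 1"
proof -
  have "iter_sum' \<delta> = 1 + h' \<delta> * (1 / \<Gamma>)"
    using iter_sum'_eq[of \<delta>] delta_pos by (simp add: iter_sum'_zero)
  moreover have "h' \<delta> \<le> 0"
    using Gamma_pos Gamma_less by (simp add: h'_def \<delta>_def field_simps power2_eq_square)
  ultimately show ?thesis using Gamma_pos by (simp add: divide_le_0_iff)
qed

lemma psi_eq:
  assumes "0 \<le> s" shows "psi \<Gamma> s = (if s \<le> \<delta> then iter_sum s else s)"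
proof -
  have "(h_c \<Gamma> ^^ k) (of_real s) = of_real ((h ^^ k) s)" for k
    by (induction k) (auto simp: h_c_def h_def)
  then have "psi_tilde \<Gamma> (of_real s) = of_real (iter_sum s)" if "s \<le> \<delta>"
    unfolding psi_tilde_def iter_sum_def
    using that assms iter_sums_deriv(1)[of s] by (subst suminf_of_real) (auto simp: sums_iff)
  then show ?thesis by (auto simp: psi_def \<delta>_def)
qed

end

section \<open>The profile of the static solution\<close>

context static_parameter
begin

text \<open>\<open>psi\<close> extended by 0 to the negative reals, so that integrals over
  \<open>{0..r}\<close> become convolutions on the line.\<close>

definition Psi :: "real \<Rightarrow> real" where
  "Psi s = (if s < 0 then 0 else if s \<le> \<delta> then iter_sum s else s)"

definition Psi' :: "real \<Rightarrow> real" where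
  "Psi' s = (if s < 0 then 0 else if s \<le> \<delta> then iter_sum' s else 1)"

text \<open>What remains of \<open>Psi'\<close> after removing the steps of height
  \<open>1 / \<Gamma>\<close> at 0 and \<open>jump\<close> at \<open>\<delta>\<close>. It is
  Lipschitz, so one more derivative can be taken.\<close>

definition Psi'_regular :: "real \<Rightarrow> real" where
  "Psi'_regular s = (if s < 0 then 0 else if s \<le> \<delta> then iter_sum' s - 1 / \<Gamma> else iter_sum' \<delta> - 1 / \<Gamma>)"

definition Psi'' :: "real \<Rightarrow> real" where
  "Psi'' s = (if s < 0 then 0 else if s \<le> \<delta> then iter_sum'' s else 0)"

definition jump :: real where "jump = 1 - iter_sum' \<delta>"

lemma jump_nonneg: "0 \<le> jump"
  using iter_sum'_delta_le by (simp add: jump_def)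

lemma continuous_glue:
  fixes p q r :: "real \<Rightarrow> real"
  assumes "continuous_on {0..\<delta>} p" "p 0 = 0" "p \<delta> = q \<delta>" "continuous_on UNIV q"
  shows "continuous_on UNIV (\<lambda>s. if s < 0 then 0 else if s \<le> \<delta> then p s else q s)"
proof -
  have 1: "continuous_on ({0..\<delta>} \<union> {\<delta>..}) (\<lambda>s. if s \<le> \<delta> then p s else q s)"
    by (rule continuous_on_If) (use assms in \<open>auto intro: continuous_on_subset\<close>)
  have "{0..\<delta>} \<union> {\<delta>..} = {0..}" using delta_pos by auto
  with 1 have 2: "continuous_on {0..} (\<lambda>s. if s \<le> \<delta> then p s else q s)" by simp
  have "continuous_on ({..0} \<union> {0..}) (\<lambda>s. if s \<le> 0 then 0 else if s \<le> \<delta> then p s else q s)"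
    by (rule continuous_on_If) (use 2 assms delta_pos in auto)
  moreover have "{..0} \<union> {0..} = (UNIV :: real set)" by auto
  moreover have "(\<lambda>s. if s \<le> 0 then 0 else if s \<le> \<delta> then p s else q s) = (\<lambda>s. if s < 0 then 0 else if s \<le> \<delta> then p s else q s)"
    using assms delta_pos by (auto simp: fun_eq_iff)
  ultimately show ?thesis by (simp only:)
qed

lemma has_derivative_glue:
  fixes p q p' q' :: "real \<Rightarrow> real"
  assumes p: "\<And>s. s \<in> {0..\<delta>} \<Longrightarrow> (p has_real_derivative p' s) (at s within {0..\<delta>})"
    and q: "\<And>s. (q has_real_derivative q' s) (at s)" and s: "s \<notin> {0, \<delta>}"
  shows "((\<lambda>s. if s < 0 then 0 else if s \<le> \<delta> then p s else q s) has_real_derivative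
      (if s < 0 then 0 else if s \<le> \<delta> then p' s else q' s)) (at s)" (is "(?f has_real_derivative _) _")
proof -
  consider "s < 0" | "0 < s" "s < \<delta>" | "\<delta> < s" using s by fastforce
  then show ?thesis
  proof cases
    case 1
    have "(?f has_real_derivative 0) (at s)"
      by (rule has_field_derivative_transform_within_open[of "\<lambda>_. 0" _ _ "{..<0}"]) (use 1 in auto)
    then show ?thesis using 1 by simp
  next
    case 2
    have "(p has_real_derivative p' s) (at s)"
      using p[of s] 2 by (simp add: at_within_Icc_at)
    then have "(?f has_real_derivative p' s) (at s)"
      by (rule has_field_derivative_transform_within_open[of _ _ _ "{0<..<\<delta>}"]) (use 2 in auto)
    then show ?thesis using 2 by simp
  next
    case 3
    have "(?f has_real_derivative q' s) (at s)"
      by (rule has_field_derivative_transform_within_open[OF q, of "{\<delta><..}"]) (use 3 delta_pos in auto)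
    then show ?thesis using 3 delta_pos by simp
  qed
qed

lemma Psi_cont: "continuous_on UNIV Psi"
  unfolding Psi_def[abs_def]
  by (rule continuous_glue)
    (auto simp: iter_sum_zero iter_sum_delta intro!: DERIV_continuous_on[OF iter_sums_deriv(2)] continuous_intros)

lemma Psi_deriv: "s \<notin> {0, \<delta>} \<Longrightarrow> (Psi has_real_derivative Psi' s) (at s)"
  unfolding Psi_def[abs_def] Psi'_def
  by (rule has_derivative_glue) (auto intro: iter_sums_deriv(2))

lemma Psi'_regular_cont: "continuous_on UNIV Psi'_regular"
  unfolding Psi'_regular_def[abs_def]
  by (rule continuous_glue)
    (auto simp: iter_sum'_zero intro!: continuous_on_diff DERIV_continuous_on[OF iter_sum'_deriv])

lemma Psi'_regular_deriv:
  assumes "s \<notin> {0, \<delta>}" shows "(Psi'_regular has_real_derivative Psi'' s) (at s)"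
proof -
  have "((\<lambda>s. iter_sum' s - 1 / \<Gamma>) has_real_derivative iter_sum'' s) (at s within {0..\<delta>})" if "s \<in> {0..\<delta>}" for s
    using DERIV_diff[OF iter_sum'_deriv[OF that] DERIV_const] by simp
  from has_derivative_glue[OF this DERIV_const assms]
  show ?thesis unfolding Psi'_regular_def[abs_def] Psi''_def by simp
qed

lemma Psi'_decomp:
  assumes "s \<noteq> 0" "s \<noteq> \<delta>"
  shows "Psi' s = indicator {0<..} s / \<Gamma> + jump * indicator {0<..} (s - \<delta>) + Psi'_regular s"
  using assms delta_pos by (auto simp: Psi'_def Psi'_regular_def jump_def indicator_def)

lemma measurable_glue [measurable]:
  fixes p q :: "real \<Rightarrow> real"
  assumes "continuous_on {0..\<delta>} p"
  shows "(\<lambda>s. if s < 0 then 0 else if s \<le> \<delta> then p s else (c::real)) \<in> borel_measurable borel"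
proof -
  have [measurable]: "(\<lambda>s. indicator {0..\<delta>} s * p s) \<in> borel_measurable borel"
    using borel_measurable_continuous_on_indicator[OF _ assms] by simp
  have "(\<lambda>s. if s < 0 then 0 else if s \<le> \<delta> then p s else c)
      = (\<lambda>s. indicator {0..\<delta>} s * p s + c * indicator {\<delta><..} s)"
    using delta_pos by (auto simp: fun_eq_iff indicator_def)
  then show ?thesis by (simp only:) measurable
qed

lemma Psi'_measurable [measurable]: "Psi' \<in> borel_measurable borel"
  unfolding Psi'_def[abs_def] by (rule measurable_glue[OF DERIV_continuous_on[OF iter_sum'_deriv]])

lemma Psi''_measurable [measurable]: "Psi'' \<in> borel_measurable borel"
  unfolding Psi''_def[abs_def] by (rule measurable_glue[OF iter_sum''_cont])

lemma Psi'_bound: "\<bar>Psi' s\<bar> \<le> 2"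
  using iter_sum'_bound[of s] by (auto simp: Psi'_def)

lemma Psi''_bound: "\<bar>Psi'' s\<bar> \<le> 24"
  using iter_sum''_bound[of s] by (auto simp: Psi''_def)

lemma Psi''_isCont: assumes "s \<notin> {0, \<delta>}" shows "isCont Psi'' s"
proof -
  consider "s < 0" | "0 < s" "s < \<delta>" | "\<delta> < s" using assms by fastforce
  then show ?thesis
  proof cases
    case 1
    have "isCont Psi'' s \<longleftrightarrow> isCont (\<lambda>_. 0::real) s"
      by (rule isCont_cong) (use 1 in \<open>auto simp: Psi''_def eventually_nhds intro!: exI[of _ "{..<0}"]\<close>)
    then show ?thesis by simp
  next
    case 2
    have "isCont Psi'' s \<longleftrightarrow> isCont iter_sum'' s"
      by (rule isCont_cong) (use 2 in \<open>auto simp: Psi''_def eventually_nhds intro!: exI[of _ "{0<..<\<delta>}"]\<close>)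
    moreover have "isCont iter_sum'' s"
      using 2 by (intro continuous_on_interior[OF iter_sum''_cont]) auto
    ultimately show ?thesis by simp
  next
    case 3
    have "isCont Psi'' s \<longleftrightarrow> isCont (\<lambda>_. 0::real) s"
      by (rule isCont_cong) (use 3 delta_pos in \<open>auto simp: Psi''_def eventually_nhds intro!: exI[of _ "{\<delta><..}"]\<close>)
    then show ?thesis by simp
  qed
qed

section \<open>Abel transforms of \<open>Psi\<close> and its derivatives\<close>

lemma integrable_lipschitz_times_kernel:
  fixes f :: "real \<Rightarrow> real"
  assumes f: "continuous_on UNIV f" and "f 0 = 0" and lip: "\<And>x y. \<bar>f x - f y\<bar> \<le> L * \<bar>x - y\<bar>"
  shows "integrable lborel (\<lambda>y. f (r - y) * abel_kernel y)"
proof (rule Bochner_Integration.integrable_bound)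
  have [measurable]: "f \<in> borel_measurable borel" using f by (rule borel_measurable_continuous_onI)
  show "(\<lambda>y. f (r - y) * abel_kernel y) \<in> borel_measurable lborel" by measurable
  have "0 \<le> L" using order_trans[OF abs_ge_zero lip[of 1 0]] by simp
  show "integrable lborel (\<lambda>y. L * (\<bar>r\<bar> + 2) * abel_kernel y)"
    by (intro integrable_mult_right integrable_abel_kernel)
  show "AE y in lborel. norm (f (r - y) * abel_kernel y) \<le> norm (L * (\<bar>r\<bar> + 2) * abel_kernel y)"
  proof (rule AE_I2)
    fix y
    show "norm (f (r - y) * abel_kernel y) \<le> norm (L * (\<bar>r\<bar> + 2) * abel_kernel y)"
    proof (cases "0 < y \<and> y < 2")
      case True
      have "\<bar>f (r - y)\<bar> \<le> L * \<bar>r - y\<bar>" using lip[of "r - y" 0] \<open>f 0 = 0\<close> by simp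
      also have "\<dots> \<le> L * (\<bar>r\<bar> + 2)" using True \<open>0 \<le> L\<close> by (intro mult_left_mono) auto
      finally show ?thesis using \<open>0 \<le> L\<close> by (simp add: abs_mult mult_right_mono)
    next
      case False
      then have "abel_kernel y = 0" by (auto simp: abel_kernel_def)
      then show ?thesis by simp
    qed
  qed
qed

definition Abel :: "(real \<Rightarrow> real) \<Rightarrow> real \<Rightarrow> real" where
  "Abel f r = (\<integral>y. f (r - y) * abel_kernel y \<partial>lborel)"

lemma Psi_lipschitz: "\<bar>Psi x - Psi y\<bar> \<le> 2 * \<bar>x - y\<bar>"
  by (rule lipschitz_of_derivative_bound[of "{0, \<delta>}", OF _ Psi_cont Psi_deriv Psi'_bound]) auto

lemma Psi'_regular_lipschitz: "\<bar>Psi'_regular x - Psi'_regular y\<bar> \<le> 24 * \<bar>x - y\<bar>"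
  by (rule lipschitz_of_derivative_bound[of "{0, \<delta>}", OF _ Psi'_regular_cont Psi'_regular_deriv Psi''_bound]) auto

lemma Psi_zero: "Psi 0 = 0" and Psi'_regular_zero: "Psi'_regular 0 = 0"
  using delta_pos by (simp_all add: Psi_def Psi'_regular_def iter_sum_zero iter_sum'_zero)

lemma Abel_Psi_deriv: "(Abel Psi has_real_derivative Abel Psi' r) (at r)"
  unfolding Abel_def[abs_def]
  by (rule has_real_derivative_convolution[where N="{0, \<delta>}", OF integrable_abel_kernel _ Psi_lipschitz _ _ Psi_deriv])
    (auto intro: integrable_lipschitz_times_kernel[OF Psi_cont Psi_zero Psi_lipschitz])

lemma Abel_Psi'_regular_deriv: "(Abel Psi'_regular has_real_derivative Abel Psi'' r) (at r)"
  unfolding Abel_def[abs_def]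
  by (rule has_real_derivative_convolution[where N="{0, \<delta>}", OF integrable_abel_kernel _ Psi'_regular_lipschitz _ _ Psi'_regular_deriv])
    (auto intro: integrable_lipschitz_times_kernel[OF Psi'_regular_cont Psi'_regular_zero Psi'_regular_lipschitz])

lemma Abel_step:
  assumes "r \<le> 2"
  shows "has_bochner_integral lborel (\<lambda>y. indicator {0<..} (r - y) * abel_kernel y) (2 * sqrt (max 0 r))"
proof (cases "0 \<le> r")
  case True
  have "AE y in lborel. y \<noteq> r" by (rule AE_lborel_singleton)
  then have "AE y in lborel. indicator {0..r} y * abel_kernel y = indicator {0<..} (r - y) * abel_kernel y"
    by eventually_elim (auto simp: abel_kernel_def indicator_def)
  then show ?thesis
    using has_bochner_integral_abel_kernel_Icc[of r] assms True
    by (subst (asm) has_bochner_integral_cong_AE) (auto simp: max_def)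
next
  case False
  then have "(\<lambda>y. indicator {0<..} (r - y) * abel_kernel y) = (\<lambda>y. 0)"
    by (auto simp: abel_kernel_def indicator_def fun_eq_iff)
  moreover have "2 * sqrt (max 0 r) = 0" using False by simp
  ultimately show ?thesis by (simp only: has_bochner_integral_zero)
qed

text \<open>Each step in \<open>Psi'\<close> becomes a square root starting at the location of the
  step. The transform of the regular part is kept separate because it can be differentiated under
  the integral.\<close>

lemma Abel_Psi'_eq:
  assumes "r \<le> 2"
  shows "Abel Psi' r = 2 * sqrt (max 0 r) / \<Gamma> + jump * (2 * sqrt (max 0 (r - \<delta>))) + Abel Psi'_regular r"
proof -
  have "AE y in lborel. y \<noteq> r" "AE y in lborel. y \<noteq> r - \<delta>" by (rule AE_lborel_singleton)+
  then have ae: "AE y in lborel. Psi' (r - y) * abel_kernel y = indicator {0<..} (r - y) * abel_kernel y / \<Gamma>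
      + jump * (indicator {0<..} (r - \<delta> - y) * abel_kernel y) + Psi'_regular (r - y) * abel_kernel y"
    by eventually_elim (subst Psi'_decomp, auto simp: algebra_simps add_divide_distrib)
  have "has_bochner_integral lborel (\<lambda>y. Psi'_regular (r - y) * abel_kernel y) (Abel Psi'_regular r)"
    unfolding Abel_def
    by (intro has_bochner_integral_integrable integrable_lipschitz_times_kernel[OF Psi'_regular_cont Psi'_regular_zero Psi'_regular_lipschitz])
  then have "has_bochner_integral lborel (\<lambda>y. indicator {0<..} (r - y) * abel_kernel y / \<Gamma>
      + jump * (indicator {0<..} (r - \<delta> - y) * abel_kernel y) + Psi'_regular (r - y) * abel_kernel y)
      (2 * sqrt (max 0 r) / \<Gamma> + jump * (2 * sqrt (max 0 (r - \<delta>))) + Abel Psi'_regular r)"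
    using assms delta_pos
    by (intro has_bochner_integral_add has_bochner_integral_divide_zero has_bochner_integral_mult_right Abel_step) auto
  then show ?thesis
    unfolding Abel_def[of Psi'] using integral_cong_AE[OF _ _ ae] borel_measurable_continuous_onI[OF Psi'_regular_cont]
    by (simp add: has_bochner_integral_iff)
qed

lemma Psi_nonpos: "s \<le> 0 \<Longrightarrow> Psi s = 0"
  using Psi_zero by (cases "s = 0") (auto simp: Psi_def)

text \<open>For r up to 1 neither the extension of \<open>psi\<close> by zero nor the truncated
  kernel changes the defining integral, and its derivative falls on the Lipschitz function
  \<open>Psi\<close>. At 0 the formula gives the prescribed value 0.\<close>

lemma phi_Gamma_eq:
  assumes "s \<in> {0..1}"
  shows "phi_Gamma \<Gamma> s = 1 / pi\<^sup>2 * Abel Psi' s"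
proof (cases "s = 0")
  case True
  have "Abel Psi'_regular 0 = 0"
  proof -
    have "Psi'_regular (0 - y) * abel_kernel y = 0" for y
      by (auto simp: Psi'_regular_def abel_kernel_def)
    then show ?thesis unfolding Abel_def by (simp only: Bochner_Integration.integral_zero)
  qed
  then show ?thesis using True delta_pos by (simp add: phi_Gamma_def Abel_Psi'_eq)
next
  case False
  have eq: "(LINT \<sigma>:{0..r}|lborel. psi \<Gamma> (r - \<sigma>) / sqrt \<sigma>) = Abel Psi r" if "r \<in> {0..1}" for r
    unfolding Abel_def set_lebesgue_integral_def
  proof (rule Bochner_Integration.integral_cong)
    fix y
    show "indicator {0..r} y *\<^sub>R (psi \<Gamma> (r - y) / sqrt y) = Psi (r - y) * abel_kernel y"
    proof (cases "0 < y \<and> y \<le> r")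
      case True
      then have "psi \<Gamma> (r - y) = Psi (r - y)"
        using psi_eq[of "r - y"] by (auto simp: Psi_def)
      then show ?thesis using True that by (simp add: abel_kernel_def)
    next
      case False
      then show ?thesis by (auto simp: indicator_def abel_kernel_def Psi_nonpos)
    qed
  qed simp
  have "(Abel Psi has_vector_derivative Abel Psi' s) (at s within {0..1})"
    using Abel_Psi_deriv[of s] by (auto simp: has_real_derivative_iff_has_vector_derivative intro: has_vector_derivative_at_within)
  then have "((\<lambda>r. LINT \<sigma>:{0..r}|lborel. psi \<Gamma> (r - \<sigma>) / sqrt \<sigma>) has_vector_derivative Abel Psi' s) (at s within {0..1})"
    by (rule has_vector_derivative_transform[OF assms, rotated]) (simp add: eq)
  then have "vector_derivative (\<lambda>r. LINT \<sigma>:{0..r}|lborel. psi \<Gamma> (r - \<sigma>) / sqrt \<sigma>) (at s within {0..1}) = Abel Psi' s"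
    using assms by (intro vector_derivative_within_closed_interval) auto
  then show ?thesis using False by (simp add: phi_Gamma_def)
qed

text \<open>The derivative of \<open>phi_Gamma\<close> away from 0 and \<open>\<delta>\<close>, as a
  total function. The two inverse square roots stem from the jumps of \<open>Psi'\<close>; on
  nonpositive arguments everything vanishes.\<close>

definition Phi :: "real \<Rightarrow> real" where
  "Phi s = 1 / pi\<^sup>2 * (abel_kernel s / \<Gamma> + jump * abel_kernel (s - \<delta>) + Abel Psi'' s)"

lemma sqrt_max_deriv:
  assumes "s \<noteq> 0" "s < 2"
  shows "((\<lambda>s. 2 * sqrt (max 0 s)) has_real_derivative abel_kernel s) (at s)"
proof (cases "0 < s")
  case True
  then have "((\<lambda>s. 2 * sqrt s) has_real_derivative abel_kernel s) (at s)"
    using assms by (auto intro!: derivative_eq_intros simp: abel_kernel_def field_simps)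
  then show ?thesis
    by (rule has_field_derivative_transform_within_open[of _ _ _ "{0<..}"]) (use True in auto)
next
  case False
  have "((\<lambda>s. 2 * sqrt (max 0 s)) has_real_derivative 0) (at s)"
    by (rule has_field_derivative_transform_within_open[of "\<lambda>_. 0" _ _ "{..<0}"]) (use False assms in auto)
  then show ?thesis using False by (simp add: abel_kernel_def)
qed

lemma phi_Gamma_deriv:
  assumes "s \<in> {0<..1} - {\<delta>}"
  shows "vector_derivative (phi_Gamma \<Gamma>) (at s within {0..1}) = Phi s"
proof -
  have *: "((\<lambda>r. 1 / pi\<^sup>2 * ((2 * sqrt (max 0 r)) / \<Gamma> + jump * (2 * sqrt (max 0 (r - \<delta>))) + Abel Psi'_regular r))
    has_real_derivative Phi s) (at s)"
    unfolding Phi_def using assms delta_pos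
    by (intro DERIV_cmult DERIV_add DERIV_cdivide sqrt_max_deriv Abel_Psi'_regular_deriv
        DERIV_chain2[where g="\<lambda>r. r - \<delta>" and Db=1 and f="\<lambda>s. 2 * sqrt (max 0 s)", simplified])
      (auto intro!: derivative_eq_intros)
  then have "((\<lambda>r. 1 / pi\<^sup>2 * ((2 * sqrt (max 0 r)) / \<Gamma> + jump * (2 * sqrt (max 0 (r - \<delta>))) + Abel Psi'_regular r))
    has_vector_derivative Phi s) (at s within {0..1})"
    by (auto simp: has_real_derivative_iff_has_vector_derivative intro: has_vector_derivative_at_within)
  then have "(phi_Gamma \<Gamma> has_vector_derivative Phi s) (at s within {0..1})"
    by (rule has_vector_derivative_transform[rotated 2]) (use assms in \<open>auto simp: phi_Gamma_eq Abel_Psi'_eq\<close>)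
  then show ?thesis
    using assms by (intro vector_derivative_within_closed_interval) auto
qed

lemma Phi_isCont:
  assumes "s \<in> {0<..<2} - {\<delta>}" shows "isCont Phi s"
proof -
  have k: "isCont abel_kernel s" if "s \<noteq> 0" "s < 2" for s
  proof (cases "0 < s")
    case True
    have "isCont abel_kernel s \<longleftrightarrow> isCont (\<lambda>y. 1 / sqrt y) s"
      by (rule isCont_cong) (use True that in \<open>auto simp: abel_kernel_def eventually_nhds intro!: exI[of _ "{0<..<2}"]\<close>)
    then show ?thesis using True by (auto intro!: continuous_intros)
  next
    case False
    have "isCont abel_kernel s \<longleftrightarrow> isCont (\<lambda>_. 0::real) s"
      by (rule isCont_cong) (use False that in \<open>auto simp: abel_kernel_def eventually_nhds intro!: exI[of _ "{..<0}"]\<close>)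
    then show ?thesis by simp
  qed
  have "isCont (Abel Psi'') s"
    unfolding Abel_def[abs_def]
    by (rule isCont_convolution[where N="{0, \<delta>}", OF integrable_abel_kernel _ Psi''_bound _ Psi''_isCont]) auto
  moreover have "isCont (\<lambda>s. abel_kernel (s - \<delta>)) s"
    using assms delta_pos by (intro isCont_o2[OF _ k] continuous_intros) auto
  ultimately show ?thesis
    unfolding Phi_def[abs_def] using k[of s] assms Gamma_pos by (auto intro!: continuous_intros)
qed

lemma Phi_measurable [measurable]: "Phi \<in> borel_measurable borel"
proof -
  have [measurable]: "Abel Psi'' \<in> borel_measurable borel"
    unfolding Abel_def[abs_def] by measurable
  show ?thesis unfolding Phi_def[abs_def] by measurable
qed

lemma Phi_nonpos: assumes "s \<le> 0" shows "Phi s = 0"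
proof -
  have "Psi'' (s - y) * abel_kernel y = 0" for y
    using assms by (auto simp: Psi''_def abel_kernel_def)
  then have "Abel Psi'' s = 0"
    unfolding Abel_def by (simp only: Bochner_Integration.integral_zero)
  then show ?thesis using assms delta_pos by (simp add: Phi_def abel_kernel_def)
qed

text \<open>The correction term \<open>Abel Psi''\<close> is dominated by the singular part \<open>s\<^bsup>-1/2\<^esup> / \<Gamma>\<close>, because \<open>Psi''\<close> is
  bounded and supported in the short interval \<open>[0, \<delta>]\<close>.\<close>

lemma Phi_nonneg: assumes "s \<le> 1" shows "0 \<le> Phi s"
proof (cases "s \<le> 0")
  case True then show ?thesis by (simp add: Phi_nonpos)
next
  case False
  then have s: "0 < s" by simp
  have int: "integrable lborel (\<lambda>y. Psi'' (s - y) * abel_kernel y)"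
    by (rule Bochner_Integration.integrable_bound[OF integrable_mult_right[OF integrable_abel_kernel, of 24]])
      (use Psi''_bound in \<open>auto simp: abs_mult intro!: mult_right_mono\<close>)
  \<comment> \<open>For s up to \<open>2 * \<delta>\<close> the whole kernel mass
    \<open>2 * sqrt s\<close> is used: 24 times it is \<open>48 * s / sqrt s\<close>, and
    \<open>48 * s\<close> is at most \<open>96 * \<delta>\<close>.\<close>
  have "\<bar>Abel Psi'' s\<bar> \<le> 1 / sqrt s"
  proof (cases "s \<le> 2 * \<delta>")
    case True
    have "norm (Abel Psi'' s) \<le> (\<integral>y. 24 * (indicator {0..s} y * abel_kernel y) \<partial>lborel)"
      unfolding Abel_def
    proof (rule Bochner_Integration.integral_norm_bound_integral)
      show "integrable lborel (\<lambda>y. 24 * (indicator {0..s} y * abel_kernel y))"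
        using has_bochner_integral_abel_kernel_Icc[of s] s assms
        by (intro integrable_mult_right) (auto simp: has_bochner_integral_iff)
      show "integrable lborel (\<lambda>y. Psi'' (s - y) * abel_kernel y)" by (rule int)
      fix y show "norm (Psi'' (s - y) * abel_kernel y) \<le> 24 * (indicator {0..s} y * abel_kernel y)"
      proof (cases "y \<in> {0..s}")
        case True
        then show ?thesis
          using mult_right_mono[OF Psi''_bound abel_kernel_nonneg] abel_kernel_nonneg[of y]
          by (simp add: abs_mult)
      next
        case False
        then have "Psi'' (s - y) * abel_kernel y = 0" by (auto simp: Psi''_def abel_kernel_def)
        then show ?thesis using False by simp
      qed
    qed
    also have "\<dots> = 48 * sqrt s"
      using has_bochner_integral_abel_kernel_Icc[of s] s assms by (simp add: has_bochner_integral_iff)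
    also have "\<dots> = 48 * s / sqrt s" using s by (simp add: field_simps)
    also have "\<dots> \<le> 1 / sqrt s"
      using True delta_le s by (intro divide_right_mono) auto
    finally show ?thesis by simp
  next
    case False
    \<comment> \<open>Now the integrand lives on an interval of length \<open>\<delta>\<close> that
      stays away from the singularity: y is at least \<open>s / 4\<close> there, so the kernel is at
      most \<open>2 / sqrt s\<close>.\<close>
    have "norm (Abel Psi'' s) \<le> (\<integral>y. 48 / sqrt s * indicator {s-\<delta>..s} y \<partial>lborel)"
      unfolding Abel_def
    proof (rule Bochner_Integration.integral_norm_bound_integral)
      show "integrable lborel (\<lambda>y. 48 / sqrt s * indicator {s-\<delta>..s} y)"
        by (intro integrable_mult_right integrable_real_indicator) (use delta_pos in auto)
      show "integrable lborel (\<lambda>y. Psi'' (s - y) * abel_kernel y)" by (rule int)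
      fix y show "norm (Psi'' (s - y) * abel_kernel y) \<le> 48 / sqrt s * indicator {s-\<delta>..s} y"
      proof (cases "y \<in> {s-\<delta>..s}")
        case True
        then have y: "s / 4 \<le> y" using False s by auto
        have "sqrt s / 2 = sqrt (s / 4)" by (simp add: real_sqrt_divide)
        also have "\<dots> \<le> sqrt y" using y by simp
        finally have "abel_kernel y \<le> 2 / sqrt s"
          using s y by (auto simp: abel_kernel_def field_simps)
        then have "\<bar>Psi'' (s - y)\<bar> * \<bar>abel_kernel y\<bar> \<le> 24 * (2 / sqrt s)"
          using Psi''_bound[of "s - y"] abel_kernel_nonneg[of y] by (intro mult_mono) auto
        then show ?thesis using True by (simp add: abs_mult)
      next
        case False
        then have "Psi'' (s - y) = 0" by (auto simp: Psi''_def)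
        then show ?thesis using s by simp
      qed
    qed
    also have "\<dots> = 48 * \<delta> / sqrt s" using delta_pos by simp
    also have "\<dots> \<le> 1 / sqrt s"
      using delta_le s by (intro divide_right_mono) auto
    finally show ?thesis by simp
  qed
  moreover have "1 / sqrt s \<le> abel_kernel s / \<Gamma>"
    using s assms Gamma_pos Gamma_less by (simp add: abel_kernel_def field_simps)
  moreover have "0 \<le> jump * abel_kernel (s - \<delta>)"
    using jump_nonneg abel_kernel_nonneg by simp
  ultimately have "0 \<le> abel_kernel s / \<Gamma> + jump * abel_kernel (s - \<delta>) + Abel Psi'' s" by linarith
  then show ?thesis by (simp add: Phi_def)
qed

text \<open>Abel inversion: integrating the kernel \<open>(p - u\<^sup>2 - w)\<^bsup>-1/2\<^esup>\<close> over \<open>u\<close> gives \<open>\<pi>\<close> for every \<open>w < p\<close>.\<close>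

lemma Abel_Psi''_eq: "Abel Psi'' s = (\<integral>w. Psi'' w * abel_kernel (s - w) \<partial>lborel)"
  unfolding Abel_def using lborel_integral_real_affine[of "-1" "\<lambda>y. Psi'' (s - y) * abel_kernel y" s]
  by simp

lemma integral_Psi''_below:
  assumes "0 < p"
  shows "has_bochner_integral lborel (\<lambda>w. Psi'' w * indicator {..<p} w) (Psi'_regular p)"
proof -
  have "(Psi'' has_integral Psi'_regular p - Psi'_regular 0) {0..p}"
    using assms continuous_on_subset[OF Psi'_regular_cont] Psi'_regular_deriv
    by (intro fundamental_theorem_of_calculus_interior_strong[of "{0, \<delta>}"])
      (auto simp: has_real_derivative_iff_has_vector_derivative)
  moreover have int: "set_integrable lborel {0..p} Psi''"
    unfolding set_integrable_def
    by (rule integrableI_bounded_set[where A="{0..p}" and B=24])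
      (use Psi''_bound assms in \<open>auto simp: indicator_def\<close>)
  ultimately have "(LINT w:{0..p}|lborel. Psi'' w) = Psi'_regular p"
    using set_borel_integral_eq_integral(2)[OF int] by (simp add: Psi'_regular_zero integral_unique)
  with int have "has_bochner_integral lborel (\<lambda>w. indicator {0..p} w *\<^sub>R Psi'' w) (Psi'_regular p)"
    by (simp add: has_bochner_integral_iff set_integrable_def set_lebesgue_integral_def)
  moreover have "AE w in lborel. indicator {0..p} w *\<^sub>R Psi'' w = Psi'' w * indicator {..<p} w"
    using AE_lborel_singleton[of p] by eventually_elim (auto simp: indicator_def Psi''_def)
  ultimately show ?thesis
    by (subst (asm) has_bochner_integral_cong_AE) auto
qed

text \<open>Fubini with the inner value \<open>pi\<close> turns \<open>Abel Psi''\<close> into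
  \<open>pi\<close> times \<open>Psi'_regular\<close>, and the two square root terms contribute
  \<open>pi\<close> times the jumps below p. Together they rebuild
  \<open>pi * Psi' p\<close>.\<close>

lemma Phi_integral:
  assumes "0 < p" "p \<le> 1" "p \<noteq> \<delta>"
  shows "has_bochner_integral lborel (\<lambda>u. Phi (p - u\<^sup>2)) (Psi' p / pi)"
proof -
  let ?F = "\<lambda>(w, u). Psi'' w * abel_kernel (p - w - u\<^sup>2)"
  let ?k = "\<lambda>w. if 0 < p - w then pi else 0"
  \<comment> \<open>The integral formula for the kernel requires \<open>p - w < 2\<close>. For
    nonnegative w this follows from \<open>p <= 1\<close>; for negative w the factor
    \<open>Psi''\<close> vanishes.\<close>
  have k: "has_bochner_integral lborel (\<lambda>u. Psi'' w * abel_kernel (p - w - u\<^sup>2)) (Psi'' w * ?k w)" for w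
  proof (cases "w < 0")
    case False
    then show ?thesis using assms
      by (intro has_bochner_integral_mult_right has_bochner_integral_abel_kernel_quadratic) auto
  qed (simp add: Psi''_def has_bochner_integral_zero)
  have eq: "Psi'' w * ?k w = pi * (Psi'' w * indicator {..<p} w)" for w
    by (auto simp: indicator_def)
  have "integrable (lborel \<Otimes>\<^sub>M lborel) ?F"
  proof (rule lborel_pair.Fubini_integrable)
    have "(\<integral>u. norm (?F (w, u)) \<partial>lborel) = \<bar>pi * (Psi'' w * indicator {..<p} w)\<bar>" for w
    proof -
      have "(\<integral>u. norm (?F (w, u)) \<partial>lborel) = (\<integral>u. \<bar>Psi'' w\<bar> * abel_kernel (p - w - u\<^sup>2) \<partial>lborel)"
        by (simp add: abs_mult abel_kernel_nonneg)
      also have "\<dots> = \<bar>Psi'' w\<bar> * ?k w"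
      proof (cases "w < 0")
        case False
        then show ?thesis using assms has_bochner_integral_abel_kernel_quadratic[of "p - w"]
          by (simp add: has_bochner_integral_iff)
      qed (simp add: Psi''_def)
      finally show ?thesis by (auto simp: abs_mult indicator_def)
    qed
    then show "integrable lborel (\<lambda>w. \<integral>u. norm (?F (w, u)) \<partial>lborel)"
      using integral_Psi''_below[OF assms(1)]
      by (auto simp: has_bochner_integral_iff simp del: abs_mult intro!: integrable_abs integrable_mult_right)
    show "AE w in lborel. integrable lborel (\<lambda>u. ?F (w, u))"
      using k by (auto simp: has_bochner_integral_iff)
  qed measurable
  then have F: "integrable (lborel \<Otimes>\<^sub>M lborel) (case_prod (\<lambda>w u. Psi'' w * abel_kernel (p - w - u\<^sup>2)))"
    by simp
  have A: "Abel Psi'' (p - u\<^sup>2) = (\<integral>w. Psi'' w * abel_kernel (p - w - u\<^sup>2) \<partial>lborel)" for u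
    unfolding Abel_Psi''_eq by (intro Bochner_Integration.integral_cong) (auto simp: algebra_simps)
  have "has_bochner_integral lborel (\<lambda>u. Abel Psi'' (p - u\<^sup>2)) (pi * Psi'_regular p)"
    unfolding has_bochner_integral_iff
  proof
    show "integrable lborel (\<lambda>u. Abel Psi'' (p - u\<^sup>2))"
      unfolding A using lborel_pair.integrable_snd[OF F] .
    have "(\<integral>u. Abel Psi'' (p - u\<^sup>2) \<partial>lborel) = (\<integral>w. \<integral>u. Psi'' w * abel_kernel (p - w - u\<^sup>2) \<partial>lborel \<partial>lborel)"
      unfolding A by (rule lborel_pair.Fubini_integral[OF F])
    also have "\<dots> = (\<integral>w. pi * (Psi'' w * indicator {..<p} w) \<partial>lborel)"
    proof (rule Bochner_Integration.integral_cong)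
      show "(\<integral>u. Psi'' w * abel_kernel (p - w - u\<^sup>2) \<partial>lborel) = pi * (Psi'' w * indicator {..<p} w)" for w
        using k[of w] unfolding eq by (simp only: has_bochner_integral_iff)
    qed simp
    also have "\<dots> = pi * Psi'_regular p"
      using integral_Psi''_below[OF assms(1)] by (simp add: has_bochner_integral_iff)
    finally show "(\<integral>u. Abel Psi'' (p - u\<^sup>2) \<partial>lborel) = pi * Psi'_regular p" .
  qed
  moreover have "has_bochner_integral lborel (\<lambda>u. abel_kernel (p - u\<^sup>2)) (if 0 < p then pi else 0)"
    "has_bochner_integral lborel (\<lambda>u. abel_kernel (p - \<delta> - u\<^sup>2)) (if 0 < p - \<delta> then pi else 0)"
    using assms delta_pos has_bochner_integral_abel_kernel_quadratic[of p]
      has_bochner_integral_abel_kernel_quadratic[of "p - \<delta>"] by simp_all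
  ultimately have "has_bochner_integral lborel (\<lambda>u. 1 / pi\<^sup>2 * (abel_kernel (p - u\<^sup>2) / \<Gamma> + jump * abel_kernel (p - \<delta> - u\<^sup>2) + Abel Psi'' (p - u\<^sup>2)))
     (1 / pi\<^sup>2 * ((if 0 < p then pi else 0) / \<Gamma> + jump * (if 0 < p - \<delta> then pi else 0) + pi * Psi'_regular p))"
    by (intro has_bochner_integral_mult_right has_bochner_integral_add has_bochner_integral_divide_zero) auto
  moreover have "1 / pi\<^sup>2 * ((if 0 < p then pi else 0) / \<Gamma> + jump * (if 0 < p - \<delta> then pi else 0) + pi * Psi'_regular p) = Psi' p / pi"
    using assms by (subst Psi'_decomp) (auto simp: field_simps power2_eq_square)
  moreover have "(\<lambda>u. 1 / pi\<^sup>2 * (abel_kernel (p - u\<^sup>2) / \<Gamma> + jump * abel_kernel (p - \<delta> - u\<^sup>2) + Abel Psi'' (p - u\<^sup>2))) = (\<lambda>u. Phi (p - u\<^sup>2))"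
    by (auto simp: Phi_def fun_eq_iff algebra_simps)
  ultimately show ?thesis by simp
qed

end

section \<open>Volume preserving linear maps and the Newton potential of a ball\<close>

lemma nn_integral_lborel_affine:
  fixes F :: "'a::euclidean_space \<Rightarrow> ennreal"
  assumes "c \<noteq> 0" and [measurable]: "F \<in> borel_measurable borel"
  shows "(\<integral>\<^sup>+x. F x \<partial>lborel) = ennreal (\<bar>c\<bar> ^ DIM('a)) * (\<integral>\<^sup>+x. F (t + c *\<^sub>R x) \<partial>lborel)"
  by (subst lborel_affine[OF assms(1), of t])
    (simp add: nn_integral_density nn_integral_distr nn_integral_cmult ennreal_power)

text \<open>A matrix in \<open>SL\<^sub>2(\<real>)\<close> acts on pairs of vectors with determinant \<open>1\<close>.\<close>

lemma nn_integral_SL2: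
  fixes F :: "'a::euclidean_space \<times> 'a \<Rightarrow> ennreal"
  assumes det: "a * d - b * c = 1" and F: "F \<in> borel_measurable borel"
  shows "(\<integral>\<^sup>+(x, v). F (a *\<^sub>R x + b *\<^sub>R v, c *\<^sub>R x + d *\<^sub>R v) \<partial>lborel) = (\<integral>\<^sup>+p. F p \<partial>lborel)" (is "?L = _")
proof -
  have cm: "(\<lambda>p. F (g p)) \<in> borel_measurable borel" if "continuous_on UNIV g"
    for g :: "'b::euclidean_space \<Rightarrow> 'a \<times> 'a"
    using measurable_compose[OF borel_measurable_continuous_onI[OF that] F] .
  have m: "(\<lambda>(x, v). F (a *\<^sub>R x + b *\<^sub>R v, c *\<^sub>R x + d *\<^sub>R v)) \<in> borel_measurable borel"
    unfolding case_prod_beta by (intro cm continuous_intros)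
  have "(\<lambda>(y, w). F (y, w)) \<in> borel_measurable (lborel \<Otimes>\<^sub>M lborel)"
    using F by (simp add: lborel_prod)
  then have M': "(\<lambda>y. \<integral>\<^sup>+w. F (y, w) \<partial>lborel) \<in> borel_measurable lborel"
    by (rule lborel.borel_measurable_nn_integral)
  then have M: "(\<lambda>y. \<integral>\<^sup>+w. F (y, w) \<partial>lborel) \<in> borel_measurable borel" by simp
  let ?k = "DIM('a)"
  show ?thesis
  proof (cases "a = 0")
    case False
    \<comment> \<open>Replace x by y = a x + b v first. The determinant condition leaves v with
      coefficient \<open>1 / a\<close> in the second slot, so the two rescalings cancel.\<close>
    have "?L = (\<integral>\<^sup>+v. \<integral>\<^sup>+x. F (a *\<^sub>R x + b *\<^sub>R v, c *\<^sub>R x + d *\<^sub>R v) \<partial>lborel \<partial>lborel)"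
      by (subst nn_integral_lborel_pair'[OF m]) simp
    also have "\<dots> = (\<integral>\<^sup>+v. ennreal (\<bar>1 / a\<bar> ^ ?k) * (\<integral>\<^sup>+y. F (y, (c / a) *\<^sub>R y + (1 / a) *\<^sub>R v) \<partial>lborel) \<partial>lborel)"
    proof (rule nn_integral_cong)
      fix v :: 'a
      let ?A = "\<integral>\<^sup>+x. F (a *\<^sub>R x + b *\<^sub>R v, c *\<^sub>R x + d *\<^sub>R v) \<partial>lborel"
      have "?A = ennreal (\<bar>1 / a\<bar> ^ ?k) * (\<integral>\<^sup>+y. F (a *\<^sub>R (- (b / a) *\<^sub>R v + (1 / a) *\<^sub>R y) + b *\<^sub>R v, c *\<^sub>R (- (b / a) *\<^sub>R v + (1 / a) *\<^sub>R y) + d *\<^sub>R v) \<partial>lborel)"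
        using False by (intro nn_integral_lborel_affine cm continuous_intros) auto
      moreover have "a *\<^sub>R (- (b / a) *\<^sub>R v + (1 / a) *\<^sub>R y) + b *\<^sub>R v = y" for y
        using False by (simp add: algebra_simps)
      moreover have "c *\<^sub>R (- (b / a) *\<^sub>R v + (1 / a) *\<^sub>R y) + d *\<^sub>R v = (c / a) *\<^sub>R y + (1 / a) *\<^sub>R v" for y
      proof -
        have "c *\<^sub>R (- (b / a) *\<^sub>R v + (1 / a) *\<^sub>R y) + d *\<^sub>R v = (c / a) *\<^sub>R y + (d - b * c / a) *\<^sub>R v"
          by (simp add: algebra_simps)
        also have "d - b * c / a = 1 / a" using det False by (simp add: field_simps)
        finally show ?thesis .
      qed
      ultimately show "?A = ennreal (\<bar>1 / a\<bar> ^ ?k) * (\<integral>\<^sup>+y. F (y, (c / a) *\<^sub>R y + (1 / a) *\<^sub>R v) \<partial>lborel)"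
        by (simp only:)
    qed
    also have "\<dots> = ennreal (\<bar>1 / a\<bar> ^ ?k) * (\<integral>\<^sup>+v. \<integral>\<^sup>+y. F (y, (c / a) *\<^sub>R y + (1 / a) *\<^sub>R v) \<partial>lborel \<partial>lborel)"
    proof (rule nn_integral_cmult)
      have "(\<lambda>p. F (snd p, (c / a) *\<^sub>R snd p + (1 / a) *\<^sub>R fst p)) \<in> borel_measurable borel"
        by (intro cm continuous_intros)
      then have "(\<lambda>(v, y). F (y, (c / a) *\<^sub>R y + (1 / a) *\<^sub>R v)) \<in> borel_measurable (lborel \<Otimes>\<^sub>M lborel)"
        by (simp add: lborel_prod case_prod_unfold)
      then show "(\<lambda>v. \<integral>\<^sup>+y. F (y, (c / a) *\<^sub>R y + (1 / a) *\<^sub>R v) \<partial>lborel) \<in> borel_measurable lborel"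
        by (rule lborel.borel_measurable_nn_integral)
    qed
    also have "(\<integral>\<^sup>+v. \<integral>\<^sup>+y. F (y, (c / a) *\<^sub>R y + (1 / a) *\<^sub>R v) \<partial>lborel \<partial>lborel)
      = (\<integral>\<^sup>+y. \<integral>\<^sup>+v. F (y, (c / a) *\<^sub>R y + (1 / a) *\<^sub>R v) \<partial>lborel \<partial>lborel)"
    proof -
      have "(\<lambda>(y, v). F (y, (c / a) *\<^sub>R y + (1 / a) *\<^sub>R v)) \<in> borel_measurable borel"
        unfolding case_prod_beta by (intro cm continuous_intros)
      from nn_integral_lborel_pair'[OF this] nn_integral_lborel_pair[OF this] show ?thesis by simp
    qed
    also have "\<dots> = (\<integral>\<^sup>+y. ennreal (\<bar>a\<bar> ^ ?k) * (\<integral>\<^sup>+w. F (y, w) \<partial>lborel) \<partial>lborel)"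
    proof (rule nn_integral_cong)
      fix y :: 'a
      have "(\<integral>\<^sup>+v. F (y, (c / a) *\<^sub>R y + (1 / a) *\<^sub>R v) \<partial>lborel)
        = ennreal (\<bar>a\<bar> ^ ?k) * (\<integral>\<^sup>+w. F (y, (c / a) *\<^sub>R y + (1 / a) *\<^sub>R (- c *\<^sub>R y + a *\<^sub>R w)) \<partial>lborel)"
        using False by (intro nn_integral_lborel_affine cm continuous_intros) auto
      then show "(\<integral>\<^sup>+v. F (y, (c / a) *\<^sub>R y + (1 / a) *\<^sub>R v) \<partial>lborel) = ennreal (\<bar>a\<bar> ^ ?k) * (\<integral>\<^sup>+w. F (y, w) \<partial>lborel)"
        using False by (simp add: algebra_simps)
    qed
    also have "\<dots> = ennreal (\<bar>a\<bar> ^ ?k) * (\<integral>\<^sup>+y. \<integral>\<^sup>+w. F (y, w) \<partial>lborel \<partial>lborel)"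
      by (rule nn_integral_cmult[OF M'])
    also have "ennreal (\<bar>1 / a\<bar> ^ ?k) * \<dots> = ennreal (\<bar>1 / a\<bar> ^ ?k * \<bar>a\<bar> ^ ?k) * (\<integral>\<^sup>+y. \<integral>\<^sup>+w. F (y, w) \<partial>lborel \<partial>lborel)"
      by (simp add: ennreal_mult mult.assoc)
    also have "\<bar>1 / a\<bar> ^ ?k * \<bar>a\<bar> ^ ?k = 1"
      using False by (simp flip: power_mult_distrib abs_mult)
    also have "ennreal 1 * (\<integral>\<^sup>+y. \<integral>\<^sup>+w. F (y, w) \<partial>lborel \<partial>lborel) = (\<integral>\<^sup>+p. F p \<partial>lborel)"
      using nn_integral_lborel_pair[OF F] by simp
    finally show ?thesis .
  next
    case True
    \<comment> \<open>Here the first slot depends on v alone and x is free in the second slot; the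
      Jacobians of the two rescalings multiply to 1 because \<open>b * c = - 1\<close>.\<close>
    then have bc: "b * c = - 1" "b \<noteq> 0" "c \<noteq> 0" using det by auto
    have "?L = (\<integral>\<^sup>+v. \<integral>\<^sup>+x. F (b *\<^sub>R v, c *\<^sub>R x + d *\<^sub>R v) \<partial>lborel \<partial>lborel)"
      using True by (subst nn_integral_lborel_pair'[OF m]) simp
    also have "\<dots> = (\<integral>\<^sup>+v. ennreal (\<bar>1 / c\<bar> ^ ?k) * (\<integral>\<^sup>+y. F (b *\<^sub>R v, y) \<partial>lborel) \<partial>lborel)"
    proof (rule nn_integral_cong)
      fix v :: 'a
      have "(\<integral>\<^sup>+x. F (b *\<^sub>R v, c *\<^sub>R x + d *\<^sub>R v) \<partial>lborel)
        = ennreal (\<bar>1 / c\<bar> ^ ?k) * (\<integral>\<^sup>+y. F (b *\<^sub>R v, c *\<^sub>R (- (d / c) *\<^sub>R v + (1 / c) *\<^sub>R y) + d *\<^sub>R v) \<partial>lborel)"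
        using bc by (intro nn_integral_lborel_affine cm continuous_intros) auto
      then show "(\<integral>\<^sup>+x. F (b *\<^sub>R v, c *\<^sub>R x + d *\<^sub>R v) \<partial>lborel) = ennreal (\<bar>1 / c\<bar> ^ ?k) * (\<integral>\<^sup>+y. F (b *\<^sub>R v, y) \<partial>lborel)"
        using bc by (simp add: algebra_simps)
    qed
    also have "\<dots> = ennreal (\<bar>1 / b\<bar> ^ ?k) * (\<integral>\<^sup>+v. ennreal (\<bar>1 / c\<bar> ^ ?k) * (\<integral>\<^sup>+y. F (v, y) \<partial>lborel) \<partial>lborel)"
    proof -
      have "(\<lambda>v. ennreal (\<bar>1 / c\<bar> ^ ?k) * (\<integral>\<^sup>+y. F (b *\<^sub>R v, y) \<partial>lborel)) \<in> borel_measurable borel"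
        by (intro borel_measurable_times_ennreal borel_measurable_const measurable_compose[OF _ M]) measurable
      from nn_integral_lborel_affine[OF _ this, of "1 / b" 0] bc show ?thesis by simp
    qed
    also have "\<dots> = ennreal (\<bar>1 / b\<bar> ^ ?k) * (ennreal (\<bar>1 / c\<bar> ^ ?k) * (\<integral>\<^sup>+v. (\<integral>\<^sup>+y. F (v, y) \<partial>lborel) \<partial>lborel))"
      by (simp only: nn_integral_cmult[OF M'])
    also have "\<dots> = ennreal (\<bar>1 / b\<bar> ^ ?k * \<bar>1 / c\<bar> ^ ?k) * (\<integral>\<^sup>+v. (\<integral>\<^sup>+y. F (v, y) \<partial>lborel) \<partial>lborel)"
      by (simp add: ennreal_mult mult.assoc)
    also have "\<bar>1 / b\<bar> ^ ?k * \<bar>1 / c\<bar> ^ ?k = 1"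
      using bc by (simp flip: power_mult_distrib abs_mult)
    also have "ennreal 1 * (\<integral>\<^sup>+y. \<integral>\<^sup>+w. F (y, w) \<partial>lborel \<partial>lborel) = (\<integral>\<^sup>+p. F p \<partial>lborel)"
      using nn_integral_lborel_pair[OF F] by simp
    finally show ?thesis .
  qed
qed

lemma distr_SL2:
  assumes "a * d - b * c = 1"
  shows "distr lborel borel (\<lambda>(x, v). (a *\<^sub>R x + b *\<^sub>R v, c *\<^sub>R x + d *\<^sub>R v)) = (lborel :: ('a::euclidean_space \<times> 'a) measure)"
proof (rule measure_eqI)
  let ?T = "\<lambda>(x :: 'a, v). (a *\<^sub>R x + b *\<^sub>R v, c *\<^sub>R x + d *\<^sub>R v)"
  have T: "?T \<in> borel_measurable borel"
    unfolding case_prod_beta by (intro borel_measurable_continuous_onI continuous_intros)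
  fix A assume A: "A \<in> sets (distr lborel borel ?T)"
  then have A': "A \<in> sets borel" by simp
  have "emeasure (distr lborel borel ?T) A = (\<integral>\<^sup>+p. indicator A p \<partial>distr lborel borel ?T)"
    using A by (simp only: nn_integral_indicator)
  also have "\<dots> = (\<integral>\<^sup>+p. indicator A (?T p) \<partial>lborel)"
    using T A' by (subst nn_integral_distr) auto
  also have "\<dots> = (\<integral>\<^sup>+p. indicator A p \<partial>lborel)"
    using nn_integral_SL2[OF assms, of "indicator A"] A' by (simp add: case_prod_unfold)
  finally show "emeasure (distr lborel borel ?T) A = emeasure lborel A" using A' by simp
qed simp

text \<open>Inner integral of the Newton potential of a ball of radius R, evaluated on the axis at
  height r: the squared distance is \<open>(r - u)^2 + q\<close>, the kernel has the primitive
  \<open>2 * sqrt ((r - u)^2 + q)\<close>, and the ball ends at q =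
  \<open>R^2 - u^2\<close>.\<close>

lemma nn_integral_newton_radial:
  fixes r u R :: real
  assumes "0 < R"
  shows "(\<integral>\<^sup>+q. (indicator {..<R\<^sup>2} (u\<^sup>2 + q) / sqrt ((r - u)\<^sup>2 + q)) * indicator {0..} q \<partial>lborel)
    = ennreal (indicator {-R..R} u * (2 * (sqrt (R\<^sup>2 + r\<^sup>2 - 2 * r * u) - \<bar>r - u\<bar>)))"
proof (cases "u \<in> {-R..R}")
  case True
  then have u: "u\<^sup>2 \<le> R\<^sup>2" by (metis atLeastAtMost_iff abs_le_iff minus_le_iff abs_le_square_iff abs_of_pos assms)
  have "has_bochner_integral lborel (\<lambda>q. indicator {0..R\<^sup>2 - u\<^sup>2} q * (1 / sqrt ((r - u)\<^sup>2 + q)))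
    (2 * sqrt ((r - u)\<^sup>2 + (R\<^sup>2 - u\<^sup>2)) - 2 * sqrt ((r - u)\<^sup>2 + 0))"
  proof (rule has_bochner_integral_FTC[of "{}"])
    fix q assume "q \<in> {0<..<R\<^sup>2 - u\<^sup>2} - {}"
    then have "(r - u)\<^sup>2 + q > 0" by (simp add: add_nonneg_pos)
    then show "((\<lambda>q. 2 * sqrt ((r - u)\<^sup>2 + q)) has_real_derivative 1 / sqrt ((r - u)\<^sup>2 + q)) (at q)"
      by (auto intro!: derivative_eq_intros simp: field_simps)
  qed (use u in \<open>auto intro!: continuous_intros\<close>)
  then have "(\<integral>\<^sup>+q. ennreal (indicator {0..R\<^sup>2 - u\<^sup>2} q * (1 / sqrt ((r - u)\<^sup>2 + q))) \<partial>lborel)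
     = ennreal (2 * sqrt ((r - u)\<^sup>2 + (R\<^sup>2 - u\<^sup>2)) - 2 * sqrt ((r - u)\<^sup>2 + 0))"
    by (rule nn_integral_has_bochner_integral) (simp add: indicator_def)
  also have "2 * sqrt ((r - u)\<^sup>2 + (R\<^sup>2 - u\<^sup>2)) - 2 * sqrt ((r - u)\<^sup>2 + 0) = 2 * (sqrt (R\<^sup>2 + r\<^sup>2 - 2 * r * u) - \<bar>r - u\<bar>)"
    by (simp add: power2_diff algebra_simps real_sqrt_abs[symmetric] del: real_sqrt_abs)
  also have "(\<integral>\<^sup>+q. ennreal (indicator {0..R\<^sup>2 - u\<^sup>2} q * (1 / sqrt ((r - u)\<^sup>2 + q))) \<partial>lborel)
    = (\<integral>\<^sup>+q. (indicator {..<R\<^sup>2} (u\<^sup>2 + q) / sqrt ((r - u)\<^sup>2 + q)) * indicator {0..} q \<partial>lborel)"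
    by (intro nn_integral_cong_AE eventually_mono[OF AE_lborel_singleton[of "R\<^sup>2 - u\<^sup>2"]])
      (auto simp: indicator_def)
  finally show ?thesis using True by simp
next
  case False
  then have "R < \<bar>u\<bar>" by auto
  then have "R\<^sup>2 < u\<^sup>2" using assms by (metis abs_of_pos abs_le_square_iff linorder_not_le)
  then have z: "(indicator {..<R\<^sup>2} (u\<^sup>2 + q) / sqrt ((r - u)\<^sup>2 + q)) * indicator {0..} q = (0::real)" for q
    by (auto simp: indicator_def)
  show ?thesis unfolding z using False by simp
qed

text \<open>With w = \<open>R^2 + r^2 - 2 * r * u\<close>, the square root has the primitive
  -w^(3/2) / (3 r); at the centre r = 0 it is the constant R. At both ends w is a perfect square, so
  the boundary values are rational in r and R.\<close>

lemma nn_integral_newton_axial: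
  fixes r R :: real
  assumes "0 \<le> r" "r < R"
  shows "(\<integral>\<^sup>+u. ennreal (indicator {-R..R} u * (2 * (sqrt (R\<^sup>2 + r\<^sup>2 - 2 * r * u) - \<bar>r - u\<bar>))) \<partial>lborel)
    = ennreal (2 * (R\<^sup>2 - r\<^sup>2 / 3))"
proof -
  let ?w = "\<lambda>u. R\<^sup>2 + r\<^sup>2 - 2 * r * u"
  define S where "S u = (if r = 0 then R * u else - (?w u * sqrt (?w u)) / (3 * r))" for u
  let ?G = "\<lambda>u. 2 * (S u + (r - u) * \<bar>r - u\<bar> / 2)"
  have R: "0 < R" using assms by simp
  have w: "(R - r)\<^sup>2 \<le> ?w u" if "u \<in> {-R..R}" for u
  proof -
    have "r * u \<le> r * R" using that assms by (intro mult_left_mono) auto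
    then show ?thesis by (simp add: power2_diff mult.commute)
  qed
  have w_pos: "0 < ?w u" if "u \<in> {-R..R}" for u
    using w[OF that] assms by (smt (verit) zero_less_power)
  have S: "(S has_real_derivative sqrt (?w u)) (at u)" if "u \<in> {-R<..<R}" for u
  proof (cases "r = 0")
    case True
    then show ?thesis using R unfolding S_def by (auto intro!: derivative_eq_intros)
  next
    case False
    have p: "0 < ?w u" using w_pos that by simp
    have "((\<lambda>u. - (?w u * sqrt (?w u)) / (3 * r)) has_real_derivative
       - ((- 2 * r) * sqrt (?w u) + (- 2 * r) * (inverse (sqrt (?w u)) / 2) * ?w u) / (3 * r)) (at u)"
      using p by (intro DERIV_cdivide) (auto intro!: derivative_eq_intros)
    moreover have "- ((- 2 * r) * sqrt (?w u) + (- 2 * r) * (inverse (sqrt (?w u)) / 2) * ?w u) / (3 * r) = sqrt (?w u)"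
    proof -
      have *: "(inverse (sqrt w) / 2) * w = sqrt w / 2" if "0 < w" for w :: real
        using that by (simp add: field_simps)
      have "- ((- 2 * r) * A + (- 2 * r) * (A / 2)) / (3 * r) = A" for A
        using False by (simp add: field_simps)
      from this[of "sqrt (?w u)"] show ?thesis
        unfolding mult.assoc *[OF p, unfolded mult.assoc] .
    qed
    ultimately have "((\<lambda>u. - (?w u * sqrt (?w u)) / (3 * r)) has_real_derivative sqrt (?w u)) (at u)"
      by (simp only:)
    then show ?thesis
      using False unfolding S_def by (simp only: if_False)
  qed
  have sqrt_ge: "\<bar>r - u\<bar> \<le> sqrt (?w u)" if "u \<in> {-R..R}" for u
  proof (rule real_le_rsqrt)
    have "u\<^sup>2 \<le> R\<^sup>2" using that R by (metis atLeastAtMost_iff abs_le_iff minus_le_iff abs_le_square_iff abs_of_pos)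
    then show "\<bar>r - u\<bar>\<^sup>2 \<le> ?w u" by (simp add: power2_diff)
  qed
  have "has_bochner_integral lborel (\<lambda>u. indicator {-R..R} u * (2 * (sqrt (?w u) - \<bar>r - u\<bar>))) (?G R - ?G (- R))"
  proof (rule has_bochner_integral_FTC[of "{r}"])
    fix u assume u: "u \<in> {-R<..<R} - {r}"
    have "((\<lambda>u. (r - u) * \<bar>r - u\<bar> / 2) has_real_derivative - \<bar>r - u\<bar>) (at u)"
    proof (cases "u < r")
      case True
      have "((\<lambda>u. (r - u) * (r - u) / 2) has_real_derivative - \<bar>r - u\<bar>) (at u)"
        using True by (auto intro!: derivative_eq_intros)
      then show ?thesis
        by (rule has_field_derivative_transform_within_open[of _ _ _ "{..<r}"]) (use True in auto)
    next
      case False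
      then have "r < u" using u by auto
      have "((\<lambda>u. (r - u) * (u - r) / 2) has_real_derivative - \<bar>r - u\<bar>) (at u)"
        using \<open>r < u\<close> by (auto intro!: derivative_eq_intros)
      then show ?thesis
        by (rule has_field_derivative_transform_within_open[of _ _ _ "{r<..}"]) (use \<open>r < u\<close> in auto)
    qed
    from DERIV_cmult[OF DERIV_add[OF S this], of 2] u
    show "(?G has_real_derivative 2 * (sqrt (?w u) - \<bar>r - u\<bar>)) (at u)" by simp
  next
    have "continuous_on {-R..R} S"
      unfolding S_def by (cases "r = 0") (auto intro!: continuous_intros)
    then show "continuous_on {-R..R} ?G" by (intro continuous_intros) auto
  next
    fix u assume u: "u \<in> {-R..R}"
    have "\<bar>r - u\<bar> \<le> sqrt (?w u)" by (rule sqrt_ge[OF u])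
    then show "0 \<le> 2 * (sqrt (?w u) - \<bar>r - u\<bar>)" by simp
  qed (use R in auto)
  moreover have "?G R - ?G (- R) = 2 * (R\<^sup>2 - r\<^sup>2 / 3)"
  proof -
    have a: "\<bar>r - R\<bar> = R - r" "\<bar>r + R\<bar> = R + r" using assms by auto
    have wR: "?w R = (R - r)\<^sup>2" "?w (- R) = (R + r)\<^sup>2"
      by (simp_all add: power2_eq_square algebra_simps)
    have s: "sqrt (?w R) = R - r" "sqrt (?w (- R)) = R + r"
      unfolding wR real_sqrt_abs using assms by auto
    show ?thesis
    proof (cases "r = 0")
      case True
      then show ?thesis using R by (simp add: S_def power2_eq_square)
    next
      case False
      have "S R = - ((R - r)^3) / (3 * r)" "S (- R) = - ((R + r)^3) / (3 * r)"
        unfolding S_def s unfolding wR using False by (simp_all add: power3_eq_cube power2_eq_square)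
      then have "?G R - ?G (- R) = 2 * (- ((R - r)^3) / (3 * r) + (r - R) * (R - r) / 2) - 2 * (- ((R + r)^3) / (3 * r) + (r + R) * (R + r) / 2)"
        using a by simp
      also have "\<dots> = 2 * (R\<^sup>2 - r\<^sup>2 / 3)"
        using False by (simp add: field_simps power2_eq_square power3_eq_cube)
      finally show ?thesis .
    qed
  qed
  ultimately have "has_bochner_integral lborel (\<lambda>u. indicator {-R..R} u * (2 * (sqrt (?w u) - \<bar>r - u\<bar>))) (2 * (R\<^sup>2 - r\<^sup>2 / 3))"
    by (simp only:)
  then show ?thesis
    by (rule nn_integral_has_bochner_integral) (use sqrt_ge in \<open>simp add: indicator_def\<close>)
qed

section \<open>The static solution\<close>

text \<open>By Lagrange's identity only the velocity component orthogonal to the axis enters the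
  cross product; the remaining bracket is its square, the cylindrical variable q.\<close>

lemma ang_axial:
  fixes x v e :: "real^3"
  assumes "x = r *\<^sub>R e" "norm e = 1"
  shows "(norm (cross3 x v))\<^sup>2 = r\<^sup>2 * ((norm v)\<^sup>2 - (v \<bullet> e)\<^sup>2)"
    and "s_fun x v = (1 - r\<^sup>2) * (1 - ((norm v)\<^sup>2 - (v \<bullet> e)\<^sup>2)) - (v \<bullet> e)\<^sup>2"
proof -
  show 1: "(norm (cross3 x v))\<^sup>2 = r\<^sup>2 * ((norm v)\<^sup>2 - (v \<bullet> e)\<^sup>2)"
    using assms by (simp add: norm_cross power_mult_distrib inner_commute algebra_simps)
  show "s_fun x v = (1 - r\<^sup>2) * (1 - ((norm v)\<^sup>2 - (v \<bullet> e)\<^sup>2)) - (v \<bullet> e)\<^sup>2"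
    unfolding s_fun_def 1 using assms by (simp add: power_mult_distrib algebra_simps)
qed

lemma exists_axis:
  fixes x :: "real^3"
  obtains e where "x = norm x *\<^sub>R e" "norm e = 1"
proof (cases "x = 0")
  case True
  have "norm (axis 1 1 :: real^3) = 1" by simp
  then show ?thesis using True that[of "axis 1 1"] by simp
next
  case False
  then show ?thesis using that[of "x /\<^sub>R norm x"] by simp
qed

lemma inner_sq_le_norm_sq: "norm e = 1 \<Longrightarrow> (v \<bullet> e)\<^sup>2 \<le> (norm v)\<^sup>2"
  using Cauchy_Schwarz_ineq2[of v e] abs_le_square_iff[of "v \<bullet> e" "norm v"] by simp

text \<open>A positive product \<open>(1 - r2) * (1 - q)\<close> leaves two options, and both
  factors negative would force \<open>r2 * q > 1\<close>.\<close>

lemma product_bounds: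
  fixes r2 q u :: real
  assumes "0 \<le> r2" "0 \<le> q" "r2 * q < 1" "0 < (1 - r2) * (1 - q) - u\<^sup>2"
  shows "r2 < 1" "q < 1" "(1 - r2) * (1 - q) - u\<^sup>2 \<le> 1"
proof -
  have p: "0 < (1 - r2) * (1 - q)" using assms(4) zero_le_power2[of u] by linarith
  have "r2 < 1 \<and> q < 1"
  proof (rule ccontr)
    assume "\<not> (r2 < 1 \<and> q < 1)"
    with p have "1 < r2" "1 < q" by (auto simp: zero_less_mult_iff)
    then have "1 * 1 < r2 * q" by (intro mult_strict_mono) auto
    then show False using assms(3) by simp
  qed
  then show 1: "r2 < 1" "q < 1" by auto
  have "(1 - r2) * (1 - q) \<le> 1 * 1" using 1 assms by (intro mult_mono) auto
  then show "(1 - r2) * (1 - q) - u\<^sup>2 \<le> 1" using zero_le_power2[of u] by linarith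
qed

text \<open>The region \<open>s > 0\<close> has an unbounded branch where both |x| and the
  orthogonal velocity exceed 1. The bound on the angular momentum excludes it and makes the support
  bounded.\<close>

lemma s_fun_bounds:
  fixes x v :: "real^3"
  assumes "(norm (cross3 x v))\<^sup>2 < 1" "0 < s_fun x v"
  shows "norm x < 1" "s_fun x v \<le> 1" "norm v < 2"
proof -
  obtain e where e: "x = norm x *\<^sub>R e" "norm e = 1" by (rule exists_axis)
  let ?q = "(norm v)\<^sup>2 - (v \<bullet> e)\<^sup>2"
  have q: "0 \<le> ?q" using inner_sq_le_norm_sq[OF e(2)] by simp
  note pb = product_bounds[of "(norm x)\<^sup>2" ?q "v \<bullet> e"]
  have "(norm x)\<^sup>2 * ?q < 1" "0 < (1 - (norm x)\<^sup>2) * (1 - ?q) - (v \<bullet> e)\<^sup>2"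
    using assms unfolding ang_axial[OF e] by auto
  note b = pb[OF zero_le_power2 q this]
  have "(norm x)\<^sup>2 < 1\<^sup>2" using b(1) by simp
  then show "norm x < 1" by (rule power_less_imp_less_base) simp
  show "s_fun x v \<le> 1" using b(3) unfolding ang_axial[OF e] .
  have "(norm v)\<^sup>2 < 1 + 1 - (norm x)\<^sup>2"
    using assms by (simp add: s_fun_def)
  also have "\<dots> \<le> 2\<^sup>2" by (simp, smt (verit) zero_le_power2)
  finally show "norm v < 2" by (rule power_less_imp_less_base) simp
qed

lemma nn_integral_newton_ball:
  fixes x :: "real^3"
  assumes "norm x < R"
  shows "(\<integral>\<^sup>+y. ennreal (indicator (ball 0 R) y / norm (x - y)) \<partial>lborel) = ennreal (2 * pi * (R\<^sup>2 - (norm x)\<^sup>2 / 3))"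
proof -
  obtain e where e: "x = norm x *\<^sub>R e" "norm e = 1" by (rule exists_axis)
  let ?r = "norm x"
  have R: "0 < R" using assms norm_ge_zero[of x] by linarith
  let ?F = "\<lambda>(u, q). ennreal (indicator {..<R\<^sup>2} (u\<^sup>2 + q) / sqrt ((?r - u)\<^sup>2 + q))"
  have "(\<integral>\<^sup>+y. ennreal (indicator (ball 0 R) y / norm (x - y)) \<partial>lborel)
      = (\<integral>\<^sup>+y. ?F (y \<bullet> e, (norm y)\<^sup>2 - (y \<bullet> e)\<^sup>2) \<partial>lborel)"
  proof (rule nn_integral_cong)
    fix y :: "real^3"
    have "(norm (x - y))\<^sup>2 = ?r\<^sup>2 - 2 * ?r * (y \<bullet> e) + (norm y)\<^sup>2"
    proof -
      have "x \<bullet> y = norm x * (y \<bullet> e)"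
        by (metis e(1) inner_commute inner_scaleR_right)
      then show ?thesis by (simp add: power2_norm_eq_inner inner_diff inner_commute)
    qed
    then have "norm (x - y) = sqrt ((?r - y \<bullet> e)\<^sup>2 + ((norm y)\<^sup>2 - (y \<bullet> e)\<^sup>2))"
      by (intro real_sqrt_unique[symmetric]) (simp_all add: power2_diff)
    moreover have "y \<in> ball 0 R \<longleftrightarrow> (norm y)\<^sup>2 < R\<^sup>2"
      using R by (auto intro: power_strict_mono power2_less_imp_less)
    ultimately show "ennreal (indicator (ball 0 R) y / norm (x - y)) = ?F (y \<bullet> e, (norm y)\<^sup>2 - (y \<bullet> e)\<^sup>2)"
      by (auto simp: indicator_def)
  qed
  also have "\<dots> = (\<integral>\<^sup>+u. ennreal pi * (\<integral>\<^sup>+q. ?F (u, q) * indicator {0..} q \<partial>lborel) \<partial>lborel)"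
  proof (rule nn_integral_cylindrical[OF e(2)])
    have "?F \<in> borel_measurable (borel \<Otimes>\<^sub>M borel)" by measurable
    then show "?F \<in> borel_measurable borel" by (simp add: borel_prod)
  qed
  also have "\<dots> = (\<integral>\<^sup>+u. ennreal pi * ennreal (indicator {-R..R} u * (2 * (sqrt (R\<^sup>2 + ?r\<^sup>2 - 2 * ?r * u) - \<bar>?r - u\<bar>))) \<partial>lborel)"
    by (intro nn_integral_cong arg_cong2[where f="(*)"] refl, subst nn_integral_newton_radial[OF R, symmetric])
      (auto intro!: nn_integral_cong simp: indicator_def)
  also have "\<dots> = ennreal pi * ennreal (2 * (R\<^sup>2 - ?r\<^sup>2 / 3))"
    by (subst nn_integral_cmult, measurable, subst nn_integral_newton_axial) (use assms in auto)
  also have "\<dots> = ennreal (2 * pi * (R\<^sup>2 - ?r\<^sup>2 / 3))"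
    by (subst ennreal_mult'[symmetric]) (auto simp: algebra_simps)
  finally show ?thesis .
qed

lemma cross_sq_continuous: "continuous_on S (\<lambda>p :: (real^3) \<times> (real^3). (norm (cross3 (fst p) (snd p)))\<^sup>2)"
  unfolding norm_cross by (intro continuous_intros)

lemma s_fun_continuous: "continuous_on S (\<lambda>p. s_fun (fst p) (snd p))"
  unfolding s_fun_def by (intro continuous_intros cross_sq_continuous)

context static_parameter
begin

text \<open>Under the cut, \<open>s > 0\<close> implies \<open>s <= 1\<close>, and
  \<open>Phi\<close> vanishes for \<open>s <= 0\<close>; so membership in the half-open interval is
  absorbed into \<open>Phi\<close>.\<close>

lemma f_Gamma_eq:
  "f_Gamma \<Gamma> x v = (if (norm (cross3 x v))\<^sup>2 \<le> \<Gamma> \<and> s_fun x v \<noteq> \<delta> then 3 / (4 * pi) * Phi (s_fun x v) else 0)"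
proof (cases "0 < s_fun x v")
  case True
  then have "(norm (cross3 x v))\<^sup>2 \<le> \<Gamma> \<Longrightarrow> s_fun x v \<le> 1"
    using s_fun_bounds(2)[of x v] Gamma_less by auto
  then show ?thesis
    using True phi_Gamma_deriv[of "s_fun x v"] by (auto simp: f_Gamma_def \<delta>_def)
next
  case False
  then show ?thesis using Phi_nonpos[of "s_fun x v"] by (auto simp: f_Gamma_def)
qed

lemma f_Gamma_nonzeroD:
  assumes "f_Gamma \<Gamma> x v \<noteq> 0"
  shows "norm x < 1" "norm v < 2"
proof -
  have "(norm (cross3 x v))\<^sup>2 \<le> \<Gamma>" "0 < s_fun x v"
    using assms by (auto simp: f_Gamma_def split: if_splits)
  then show "norm x < 1" "norm v < 2"
    using s_fun_bounds[of x v] Gamma_less by auto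
qed

lemma f_Gamma_nonneg: "0 \<le> f_Gamma \<Gamma> x v"
proof (cases "(norm (cross3 x v))\<^sup>2 \<le> \<Gamma> \<and> 0 < s_fun x v")
  case True
  then have "s_fun x v \<le> 1" using s_fun_bounds(2)[of x v] Gamma_less by auto
  then show ?thesis using Phi_nonneg[of "s_fun x v"] by (auto simp: f_Gamma_eq)
next
  case False
  then show ?thesis by (auto simp: f_Gamma_def)
qed

lemma f_Gamma_measurable: "(\<lambda>p. f_Gamma \<Gamma> (fst p) (snd p)) \<in> borel_measurable borel"
proof -
  note [measurable] = borel_measurable_continuous_onI[OF cross_sq_continuous] borel_measurable_continuous_onI[OF s_fun_continuous]
  show ?thesis unfolding f_Gamma_eq by measurable
qed

section \<open>The velocity integral of \<open>f_Gamma\<close>\<close>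

lemma Psi'_pos: assumes "0 \<le> s" shows "0 < Psi' s"
proof (cases "s \<le> \<delta>")
  case True
  then have s: "s \<in> {0..\<delta>}" using assms by simp
  have "\<bar>h' s * iter_sum' (h s)\<bar> \<le> 1 / 4 * 2"
    unfolding abs_mult using h'_bound[OF s] iter_sum'_bound[OF h_in(1)[OF s]] by (intro mult_mono) auto
  then have "0 < iter_sum' s" unfolding iter_sum'_eq[OF s] by linarith
  then show ?thesis using True assms by (simp add: Psi'_def)
qed (use assms in \<open>simp add: Psi'_def\<close>)

text \<open>The second argument is \<open>a (1 - q)\<close> at the largest admissible q. It is
  \<open>h a\<close> for a below \<open>\<delta>\<close>, where the functional equation of
  \<open>iter_sum\<close> applies; otherwise it is 0, and \<open>Psi a = a\<close> already.\<close>

lemma Psi_increment: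
  assumes "0 < a" "a \<le> 1"
  shows "Psi a - Psi (a * (1 - (if 1 - a \<le> \<Gamma> then 1 else \<Gamma> / (1 - a)))) = a"
proof (cases "1 - a \<le> \<Gamma>")
  case True
  then have "\<delta> \<le> a" by (simp add: \<delta>_def)
  then show ?thesis using True delta_pos by (auto simp: Psi_def iter_sum_zero iter_sum_delta)
next
  case False
  then have a: "a \<in> {0..\<delta>}" using assms by (simp add: \<delta>_def)
  then have "h a \<in> {0..\<delta>}" by (rule h_in)
  then show ?thesis using False a iter_sum_eq[OF a] by (simp add: Psi_def h_def[symmetric])
qed

lemma nn_integral_Phi:
  assumes "0 < p" "p \<le> 1" "p \<noteq> \<delta>"
  shows "(\<integral>\<^sup>+u. ennreal (if p - u\<^sup>2 \<noteq> \<delta> then 3 / (4 * pi) * Phi (p - u\<^sup>2) else 0) \<partial>lborel) = ennreal (3 / (4 * pi) * (Psi' p / pi))"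
proof -
  have nn: "0 \<le> Phi (p - u\<^sup>2)" for u
    using assms zero_le_power2[of u] by (intro Phi_nonneg) linarith
  \<comment> \<open>The level \<open>s = \<delta>\<close>, where \<open>f_Gamma\<close> is set to 0,
    is met by at most two values of u.\<close>
  have "finite {u. u\<^sup>2 = p - \<delta>}"
  proof (rule finite_subset)
    show "{u. u\<^sup>2 = p - \<delta>} \<subseteq> {sqrt (p - \<delta>), - sqrt (p - \<delta>)}"
      by (auto simp: real_sqrt_abs[symmetric] simp del: real_sqrt_abs) (metis abs_if real_sqrt_abs minus_minus)
  qed simp
  then have ae: "AE u in lborel. \<forall>n\<in>{u. u\<^sup>2 = p - \<delta>}. u \<noteq> n"
    by (subst AE_finite_all) (auto intro: AE_lborel_singleton)
  have "(\<integral>\<^sup>+u. ennreal (if p - u\<^sup>2 \<noteq> \<delta> then 3 / (4 * pi) * Phi (p - u\<^sup>2) else 0) \<partial>lborel)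
    = (\<integral>\<^sup>+u. ennreal (3 / (4 * pi) * Phi (p - u\<^sup>2)) \<partial>lborel)"
    by (intro nn_integral_cong_AE eventually_mono[OF ae]) (auto simp: algebra_simps)
  also have "\<dots> = ennreal (3 / (4 * pi) * (Psi' p / pi))"
    using has_bochner_integral_mult_right[OF Phi_integral[OF assms], of "3 / (4 * pi)"] nn
    by (intro nn_integral_has_bochner_integral) auto
  finally show ?thesis .
qed

lemma nn_integral_f_Gamma_velocity:
  "(\<integral>\<^sup>+v. ennreal (f_Gamma \<Gamma> x v) \<partial>lborel) = ennreal (3 / (4 * pi) * indicator (ball 0 1) x)"
proof (cases "norm x < 1")
  case False
  then have "f_Gamma \<Gamma> x v = 0" for v using f_Gamma_nonzeroD(1)[of x v] by auto
  then show ?thesis using False by simp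
next
  case True
  obtain e where e: "x = norm x *\<^sub>R e" "norm e = 1" by (rule exists_axis)
  define a where "a = 1 - (norm x)\<^sup>2"
  have a: "0 < a" "a \<le> 1" using True by (auto simp: a_def power_less_one_iff)
  \<comment> \<open>The largest q that contributes: the cut stops q at
    \<open>\<Gamma> / (1 - a)\<close> when this is below 1, and for \<open>q > 1\<close> the value
    of s is negative.\<close>
  define m where "m = (if 1 - a \<le> \<Gamma> then 1 else \<Gamma> / (1 - a))"
  have m: "0 < m" "m \<le> 1" using Gamma_pos a by (auto simp: m_def)
  let ?F = "\<lambda>(u, q). ennreal (if q \<le> m \<and> a * (1 - q) - u\<^sup>2 \<noteq> \<delta> then 3 / (4 * pi) * Phi (a * (1 - q) - u\<^sup>2) else 0)"
  have F_meas: "?F \<in> borel_measurable (borel \<Otimes>\<^sub>M borel)" by measurable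
  have "(\<integral>\<^sup>+v. ennreal (f_Gamma \<Gamma> x v) \<partial>lborel) = (\<integral>\<^sup>+v. ?F (v \<bullet> e, (norm v)\<^sup>2 - (v \<bullet> e)\<^sup>2) \<partial>lborel)"
  proof (rule nn_integral_cong)
    fix v :: "real^3"
    define q where "q = (norm v)\<^sup>2 - (v \<bullet> e)\<^sup>2"
    have q: "0 \<le> q" using inner_sq_le_norm_sq[OF e(2)] by (simp add: q_def)
    have L: "(norm (cross3 x v))\<^sup>2 = (1 - a) * q" and s: "s_fun x v = a * (1 - q) - (v \<bullet> e)\<^sup>2"
      unfolding ang_axial[OF e] by (simp_all add: a_def q_def)
    have "f_Gamma \<Gamma> x v = (if q \<le> m \<and> a * (1 - q) - (v \<bullet> e)\<^sup>2 \<noteq> \<delta> then 3 / (4 * pi) * Phi (a * (1 - q) - (v \<bullet> e)\<^sup>2) else 0)"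
    proof (cases "1 - a \<le> \<Gamma>")
      case le: True
      show ?thesis
      proof (cases "q \<le> 1")
        case True
        have "(1 - a) * q \<le> \<Gamma> * 1" using le True q Gamma_pos by (intro mult_mono) auto
        then show ?thesis unfolding f_Gamma_eq L s using le True by (simp add: m_def)
      next
        case False
        then have "a * (1 - q) \<le> 0" using a by (simp add: mult_le_0_iff)
        then have "a * (1 - q) - (v \<bullet> e)\<^sup>2 \<le> 0" using zero_le_power2[of "v \<bullet> e"] by linarith
        then show ?thesis unfolding f_Gamma_eq L s using Phi_nonpos le False by (simp add: m_def)
      qed
    next
      case False
      then have "0 < 1 - a" using Gamma_pos by linarith
      then have "(1 - a) * q \<le> \<Gamma> \<longleftrightarrow> q \<le> m" using False by (simp add: m_def field_simps)
      then show ?thesis unfolding f_Gamma_eq L s by simp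
    qed
    then show "ennreal (f_Gamma \<Gamma> x v) = ?F (v \<bullet> e, (norm v)\<^sup>2 - (v \<bullet> e)\<^sup>2)"
      by (simp add: q_def)
  qed
  also have "\<dots> = (\<integral>\<^sup>+u. ennreal pi * (\<integral>\<^sup>+q. ?F (u, q) * indicator {0..} q \<partial>lborel) \<partial>lborel)"
    using F_meas by (intro nn_integral_cylindrical[OF e(2)]) (simp add: borel_prod)
  also have "\<dots> = ennreal pi * (\<integral>\<^sup>+u. \<integral>\<^sup>+q. ?F (u, q) * indicator {0..} q \<partial>lborel \<partial>lborel)"
    by (rule nn_integral_cmult) measurable
  also have "(\<integral>\<^sup>+u. \<integral>\<^sup>+q. ?F (u, q) * indicator {0..} q \<partial>lborel \<partial>lborel)
     = (\<integral>\<^sup>+q. \<integral>\<^sup>+u. ?F (u, q) * indicator {0..} q \<partial>lborel \<partial>lborel)"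
    by (rule lborel_pair.Fubini'[symmetric]) measurable
  also have "\<dots> = (\<integral>\<^sup>+q. ennreal (indicator {0..m} q * (3 / (4 * pi) * (Psi' (a * (1 - q)) / pi))) \<partial>lborel)"
  proof (rule nn_integral_cong_AE)
    \<comment> \<open>The two excluded values of q are those where p = \<open>a * (1 - q)\<close>
      equals 0 or \<open>\<delta>\<close>, outside the range of
      \<open>nn_integral_Phi\<close>.\<close>
    have "AE q in lborel. q \<noteq> 1" "AE q in lborel. q \<noteq> 1 - \<delta> / a" by (rule AE_lborel_singleton)+
    then show "AE q in lborel. (\<integral>\<^sup>+u. ?F (u, q) * indicator {0..} q \<partial>lborel) = ennreal (indicator {0..m} q * (3 / (4 * pi) * (Psi' (a * (1 - q)) / pi)))"
    proof eventually_elim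
      case (elim q)
      show ?case
      proof (cases "q \<in> {0..m}")
        case True
        then have q: "0 \<le> q" "q < 1" using m elim by auto
        have "a * (1 - q) \<le> 1 * 1" using a q by (intro mult_mono) auto
        moreover have "a * (1 - q) \<noteq> \<delta>" using elim(2) a by (auto simp: field_simps)
        moreover have "0 < a * (1 - q)" using a q by simp
        ultimately show ?thesis
          using nn_integral_Phi[of "a * (1 - q)"] True by simp
      next
        case False
        then have z: "?F (u, q) * indicator {0..} q = 0" for u by (auto simp: indicator_def)
        show ?thesis unfolding z using False by simp
      qed
    qed
  qed
  also have "\<dots> = ennreal (3 / (4 * pi) / pi)"
  proof -
    have "has_bochner_integral lborel (\<lambda>q. indicator {0..m} q * (3 / (4 * pi) * (Psi' (a * (1 - q)) / pi)))
      (- 3 / (4 * pi) / pi / a * Psi (a * (1 - m)) - (- 3 / (4 * pi) / pi / a * Psi (a * (1 - 0))))"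
    proof (rule has_bochner_integral_FTC[of "{1, 1 - \<delta> / a}"])
      fix q assume "q \<in> {0<..<m} - {1, 1 - \<delta> / a}"
      then have "a * (1 - q) \<notin> {0, \<delta>}" using a by (auto simp: field_simps)
      moreover have "((\<lambda>q. a * (1 - q)) has_real_derivative - a) (at q)"
        by (auto intro!: derivative_eq_intros)
      ultimately have "((\<lambda>q. Psi (a * (1 - q))) has_real_derivative Psi' (a * (1 - q)) * (- a)) (at q)"
        using DERIV_chain2[where f=Psi and g="\<lambda>q. a * (1 - q)"] Psi_deriv by blast
      from DERIV_cmult[OF this, of "- 3 / (4 * pi) / pi / a"]
      show "((\<lambda>q. - 3 / (4 * pi) / pi / a * Psi (a * (1 - q))) has_real_derivative 3 / (4 * pi) * (Psi' (a * (1 - q)) / pi)) (at q)"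
        using a by (simp add: field_simps)
    next
      show "continuous_on {0..m} (\<lambda>q. - 3 / (4 * pi) / pi / a * Psi (a * (1 - q)))"
        by (intro continuous_intros continuous_on_compose2[OF Psi_cont]) (use a in auto)
    next
      fix q assume "q \<in> {0..m}"
      then have "0 \<le> a * (1 - q)" using a m by simp
      then have "0 < Psi' (a * (1 - q))" by (rule Psi'_pos)
      then show "0 \<le> 3 / (4 * pi) * (Psi' (a * (1 - q)) / pi)" by simp
    qed (use m in auto)
    moreover have "- 3 / (4 * pi) / pi / a * Psi (a * (1 - m)) - (- 3 / (4 * pi) / pi / a * Psi (a * (1 - 0))) = 3 / (4 * pi) / pi / a * (Psi a - Psi (a * (1 - m)))"
      by (simp add: algebra_simps diff_divide_distrib)
    moreover have "\<dots> = 3 / (4 * pi) / pi"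
      using Psi_increment[OF a] a unfolding m_def by simp
    moreover have "0 \<le> indicator {0..m} q * (3 / (4 * pi) * (Psi' (a * (1 - q)) / pi))" for q
      using Psi'_pos[of "a * (1 - q)"] a m by (auto simp: indicator_def)
    ultimately show ?thesis
      by (intro nn_integral_has_bochner_integral) (simp_all only:)
  qed
  \<comment> \<open>The \<open>pi\<close> from the cylindrical measure cancels the factor
    \<open>1 / pi\<close> left by the Abel inversion.\<close>
  also have "ennreal pi * ennreal (3 / (4 * pi) / pi) = ennreal (3 / (4 * pi) * indicator (ball 0 1) x)"
    using True by (subst ennreal_mult'[symmetric]) auto
  finally show ?thesis .
qed

lemma nn_integral_f_Gamma:
  "(\<integral>\<^sup>+p. ennreal (f_Gamma \<Gamma> (fst p) (snd p)) \<partial>lborel) < \<infinity>"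
proof -
  have "(\<integral>\<^sup>+p. ennreal (f_Gamma \<Gamma> (fst p) (snd p)) \<partial>lborel)
      = (\<integral>\<^sup>+x. (\<integral>\<^sup>+v. ennreal (f_Gamma \<Gamma> x v) \<partial>lborel) \<partial>lborel)"
    using f_Gamma_measurable by (subst nn_integral_lborel_pair) auto
  also have "\<dots> = (\<integral>\<^sup>+x. ennreal (3 / (4 * pi)) * indicator (ball (0::real^3) 1) x \<partial>lborel)"
    unfolding nn_integral_f_Gamma_velocity by (auto intro!: nn_integral_cong simp: indicator_def)
  also have "\<dots> = ennreal (3 / (4 * pi)) * emeasure lborel (ball (0::real^3) 1)"
    by (subst nn_integral_cmult_indicator) auto
  also have "\<dots> < \<infinity>"
    by (simp add: emeasure_ball ennreal_mult_less_top)
  finally show ?thesis .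
qed

lemma integrable_f_Gamma: "integrable lborel (\<lambda>p. f_Gamma \<Gamma> (fst p) (snd p))"
  using nn_integral_f_Gamma f_Gamma_measurable f_Gamma_nonneg
  by (intro integrableI_nonneg) auto

text \<open>Within the cut a ray from the origin meets a level set of s at most once, as the null
  set criterion for starlike sets requires. Along the ray s is \<open>1 + c^4 * L - c^2 * E\<close>;
  a second hit forces E = \<open>(c^2 + 1) * L\<close>, which contradicts
  \<open>4 * L <= E^2\<close> because L and \<open>c^4 * L\<close> are below 1. The case L = 0
  leaves only the level 1, excluded by assumption.\<close>

lemma s_level_starlike:
  fixes p :: "(real^3) \<times> (real^3)"
  assumes "0 \<le> c" "k \<noteq> 1"
    and 1: "(norm (cross3 (fst p) (snd p)))\<^sup>2 \<le> \<Gamma>" "s_fun (fst p) (snd p) = k"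
    and 2: "(norm (cross3 (c *\<^sub>R fst p) (c *\<^sub>R snd p)))\<^sup>2 \<le> \<Gamma>" "s_fun (c *\<^sub>R fst p) (c *\<^sub>R snd p) = k"
  shows "c = 1"
proof (rule ccontr)
  assume "c \<noteq> 1"
  define L where "L = (norm (cross3 (fst p) (snd p)))\<^sup>2"
  define E where "E = (norm (fst p))\<^sup>2 + (norm (snd p))\<^sup>2"
  have sc: "(norm (cross3 (c *\<^sub>R fst p) (c *\<^sub>R snd p)))\<^sup>2 = c^4 * L"
    by (simp add: cross_mult_left cross_mult_right L_def power_mult_distrib)
  have L: "0 \<le> L" "L < 1" "c^4 * L < 1"
    using 1 2 Gamma_less unfolding sc by (auto simp: L_def)
  have "1 + L - E = k" "1 + c^4 * L - c\<^sup>2 * E = k"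
    using 1(2) 2(2) unfolding s_fun_def sc by (auto simp: L_def E_def power_mult_distrib algebra_simps)
  then have "(c\<^sup>2 - 1) * ((c\<^sup>2 + 1) * L - E) = 0" by (simp add: algebra_simps power4_eq_xxxx power2_eq_square)
  moreover have "c\<^sup>2 \<noteq> 1" using \<open>c \<noteq> 1\<close> \<open>0 \<le> c\<close> by (simp add: power2_eq_1_iff)
  ultimately have E: "E = (c\<^sup>2 + 1) * L" by simp
  have EL: "4 * L \<le> E\<^sup>2"
  proof -
    have "L \<le> (norm (fst p))\<^sup>2 * (norm (snd p))\<^sup>2" by (simp add: L_def norm_cross)
    moreover have "4 * ((norm (fst p))\<^sup>2 * (norm (snd p))\<^sup>2) \<le> E\<^sup>2"
      unfolding E_def using zero_le_power2[of "(norm (fst p))\<^sup>2 - (norm (snd p))\<^sup>2"]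
      by (simp add: power2_eq_square algebra_simps)
    ultimately show ?thesis by linarith
  qed
  show False
  proof (cases "L = 0")
    case True
    then show False using E \<open>1 + L - E = k\<close> \<open>k \<noteq> 1\<close> by simp
  next
    case False
    then have L0: "0 < L" using L by simp
    have "4 * L \<le> (c\<^sup>2 + 1)\<^sup>2 * L * L" using EL unfolding E by (simp add: power_mult_distrib power2_eq_square mult_ac)
    then have "4 \<le> (c\<^sup>2 + 1)\<^sup>2 * L" using L0 by simp
    also have "(c\<^sup>2 + 1)\<^sup>2 * L \<le> (2 * c^4 + 2) * L"
    proof (rule mult_right_mono)
      show "(c\<^sup>2 + 1)\<^sup>2 \<le> 2 * c^4 + 2"
        using zero_le_power2[of "c\<^sup>2 - 1"] by (simp add: power2_eq_square power4_eq_xxxx algebra_simps)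
    qed (use L in simp)
    also have "\<dots> < 4" using L by (simp add: algebra_simps)
    finally show False by simp
  qed
qed

text \<open>A closed null set that contains all discontinuities: the boundary of the cut and the two
  singular levels of \<open>Phi\<close>. The cut is repeated in the level sets so that they meet
  each ray only once.\<close>

definition f_Gamma_singular :: "((real^3) \<times> (real^3)) set" where
  "f_Gamma_singular = {p. (norm (cross3 (fst p) (snd p)))\<^sup>2 = \<Gamma>}
    \<union> {p. (norm (cross3 (fst p) (snd p)))\<^sup>2 \<le> \<Gamma> \<and> s_fun (fst p) (snd p) = 0}
    \<union> {p. (norm (cross3 (fst p) (snd p)))\<^sup>2 \<le> \<Gamma> \<and> s_fun (fst p) (snd p) = \<delta>}"

lemma closed_f_Gamma_singular: "closed f_Gamma_singular"
  unfolding f_Gamma_singular_def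
  by (intro closed_Un closed_Collect_conj closed_Collect_le closed_Collect_eq cross_sq_continuous s_fun_continuous continuous_intros)

lemma negligible_f_Gamma_singular: "negligible f_Gamma_singular"
proof -
  have lev: "negligible {p. (norm (cross3 (fst p) (snd p)))\<^sup>2 \<le> \<Gamma> \<and> s_fun (fst p) (snd p) = k}" if "k \<noteq> 1" for k
  proof (rule starlike_negligible[where a=0])
    show "closed {p. (norm (cross3 (fst p) (snd p)))\<^sup>2 \<le> \<Gamma> \<and> s_fun (fst p) (snd p) = k}"
      by (intro closed_Collect_conj closed_Collect_le closed_Collect_eq cross_sq_continuous s_fun_continuous continuous_intros)
  qed (use s_level_starlike[OF _ that] in auto)
  have "negligible {p :: (real^3) \<times> (real^3). (norm (cross3 (fst p) (snd p)))\<^sup>2 = \<Gamma>}"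
  proof (rule starlike_negligible[where a=0])
    show "closed {p :: (real^3) \<times> (real^3). (norm (cross3 (fst p) (snd p)))\<^sup>2 = \<Gamma>}"
      by (intro closed_Collect_eq cross_sq_continuous continuous_intros)
    fix c :: real and p :: "(real^3) \<times> (real^3)"
    assume "0 + c *\<^sub>R p \<in> {p. (norm (cross3 (fst p) (snd p)))\<^sup>2 = \<Gamma>}" "0 \<le> c" "0 + p \<in> {p. (norm (cross3 (fst p) (snd p)))\<^sup>2 = \<Gamma>}"
    then have "c^4 * \<Gamma> = \<Gamma>"
      by (auto simp: cross_mult_left cross_mult_right power_mult_distrib power4_eq_xxxx power2_eq_square mult_ac)
    then have "c^4 = 1" using Gamma_pos by simp
    then have "(c\<^sup>2)\<^sup>2 = 1" by simp
    then have "c\<^sup>2 = 1" using zero_le_power2[of c] unfolding power2_eq_1_iff by auto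
    then show "c = 1" using \<open>0 \<le> c\<close> unfolding power2_eq_1_iff by auto
  qed
  then show ?thesis
    unfolding f_Gamma_singular_def using lev delta_pos delta_le by (intro negligible_Un) auto
qed

lemma f_Gamma_isCont:
  assumes "p \<notin> f_Gamma_singular"
  shows "isCont (\<lambda>p. f_Gamma \<Gamma> (fst p) (snd p)) p"
proof -
  let ?L = "\<lambda>p :: (real^3) \<times> (real^3). (norm (cross3 (fst p) (snd p)))\<^sup>2"
  let ?s = "\<lambda>p :: (real^3) \<times> (real^3). s_fun (fst p) (snd p)"
  have LC: "continuous_on UNIV ?L" and sC: "continuous_on UNIV ?s"
    by (rule cross_sq_continuous s_fun_continuous)+
  have zero: ?thesis if "open A" "p \<in> A" "\<And>p. p \<in> A \<Longrightarrow> f_Gamma \<Gamma> (fst p) (snd p) = 0" for A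
  proof -
    have "isCont (\<lambda>p. f_Gamma \<Gamma> (fst p) (snd p)) p \<longleftrightarrow> isCont (\<lambda>_. 0::real) p"
      by (rule isCont_cong) (use that in \<open>auto simp: eventually_nhds\<close>)
    then show ?thesis by simp
  qed
  consider "\<Gamma> < ?L p" | "?s p < 0" | "?L p < \<Gamma>" "0 < ?s p" "?s p \<noteq> \<delta>"
    using assms unfolding f_Gamma_singular_def by fastforce
  then show ?thesis
  proof cases
    case 1
    then show ?thesis
      by (intro zero[of "{p. \<Gamma> < ?L p}"] open_Collect_less LC continuous_intros) (auto simp: f_Gamma_def)
  next
    case 2
    then show ?thesis
      by (intro zero[of "{p. ?s p < 0}"] open_Collect_less sC continuous_intros) (auto simp: f_Gamma_def)
  next
    case 3
    let ?A = "{p. ?L p < \<Gamma>} \<inter> {p. ?s p \<noteq> \<delta>}"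
    have A: "open ?A" "p \<in> ?A"
      using 3 by (auto intro!: open_Int open_Collect_less open_Collect_neq LC sC continuous_intros)
    have eq: "isCont (\<lambda>p. f_Gamma \<Gamma> (fst p) (snd p)) p \<longleftrightarrow> isCont (\<lambda>p. 3 / (4 * pi) * Phi (?s p)) p"
      by (rule isCont_cong) (use A in \<open>auto simp: eventually_nhds f_Gamma_eq intro!: exI[of _ ?A]\<close>)
    have "?s p \<le> 1" using s_fun_bounds(2)[of "fst p" "snd p"] 3 Gamma_less by auto
    then have 1: "isCont Phi (?s p)" using 3 by (intro Phi_isCont) auto
    have 2: "isCont ?s p" by (rule bspec[OF sC[unfolded continuous_on_eq_continuous_at[OF open_UNIV]] UNIV_I])
    have "isCont (\<lambda>p. 3 / (4 * pi) * Phi (?s p)) p"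
      by (rule continuous_mult[OF continuous_const isCont_o2[OF 2 1]])
    then show ?thesis unfolding eq .
  qed
qed

end

section \<open>Test functions and integration along a flow\<close>

lemma gradient_eq:
  assumes "(g has_derivative (\<lambda>h. h \<bullet> D)) (at x)"
  shows "gradient g x = D"
  unfolding gradient_def gderiv_def
proof (rule the_equality)
  fix D' assume "(g has_derivative (\<lambda>h. h \<bullet> D')) (at x)"
  from has_derivative_unique[OF this assms] have "h \<bullet> D' = h \<bullet> D" for h by meson
  then show "D' = D" by (metis inner_commute vector_eq_rdot)
qed (rule assms)

lemma has_derivative_imp_gradient:
  fixes g :: "'a::euclidean_space \<Rightarrow> real"
  assumes "(g has_derivative g') (at x)"
  shows "w \<bullet> gradient g x = g' w"
proof -
  interpret bounded_linear g' using assms by (rule has_derivative_bounded_linear)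
  have "g' h = h \<bullet> (\<Sum>b\<in>Basis. g' b *\<^sub>R b)" for h
  proof -
    have "g' h = g' (\<Sum>b\<in>Basis. (h \<bullet> b) *\<^sub>R b)" by (simp add: euclidean_representation)
    also have "\<dots> = (\<Sum>b\<in>Basis. (h \<bullet> b) * g' b)" by (simp add: sum scaleR)
    also have "\<dots> = h \<bullet> (\<Sum>b\<in>Basis. g' b *\<^sub>R b)" by (simp add: inner_sum_right mult.commute)
    finally show ?thesis .
  qed
  then have "g' = (\<lambda>h. h \<bullet> (\<Sum>b\<in>Basis. g' b *\<^sub>R b))" by (rule ext)
  then show ?thesis using gradient_eq assms by metis
qed

lemma gradient_ball_potential:
  fixes g :: "real^3 \<Rightarrow> real"
  assumes "norm x < R" and g: "\<And>y. norm y < R \<Longrightarrow> g y = c + k * (norm y)\<^sup>2 / 2"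
  shows "gradient g x = k *\<^sub>R x"
proof (rule gradient_eq)
  have "((\<lambda>y. c + k * (y \<bullet> y) / 2) has_derivative (\<lambda>h. h \<bullet> (k *\<^sub>R x))) (at x)"
    by (auto intro!: derivative_eq_intros simp: inner_commute)
  then show "(g has_derivative (\<lambda>h. h \<bullet> (k *\<^sub>R x))) (at x)"
    by (rule has_derivative_transform_within_open[of _ _ _ _ "ball 0 R"])
      (use assms in \<open>auto simp: power2_norm_eq_inner\<close>)
qed

section \<open>Test functions and their derivatives\<close>

lemma test_function_diff:
  assumes "test_function S g"
  shows "(g has_derivative frechet_derivative g (at z)) (at z)"
proof -
  have "C_k (Suc 0) g" using assms by (auto simp: test_function_def)
  then show ?thesis by (simp add: frechet_derivative_works[symmetric])
qed

lemma test_function_deriv_eq: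
  assumes "test_function S g"
  shows "frechet_derivative g (at z) w = (\<Sum>b\<in>Basis. (w \<bullet> b) * frechet_derivative g (at z) b)"
proof -
  interpret bounded_linear "frechet_derivative g (at z)"
    using test_function_diff[OF assms] by (rule has_derivative_bounded_linear)
  have "frechet_derivative g (at z) w = frechet_derivative g (at z) (\<Sum>b\<in>Basis. (w \<bullet> b) *\<^sub>R b)"
    by (simp add: euclidean_representation)
  also have "\<dots> = (\<Sum>b\<in>Basis. (w \<bullet> b) * frechet_derivative g (at z) b)" by (simp add: sum scaleR)
  finally show ?thesis .
qed

text \<open>\<open>C_k\<close> speaks only about partial derivatives in basis directions, so a
  varying direction is expanded in the basis.\<close>

lemma test_function_deriv_continuous:
  assumes "test_function S g" "continuous_on A p" "continuous_on A w"
  shows "continuous_on A (\<lambda>a. frechet_derivative g (at (p a)) (w a))"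
proof -
  have "continuous_on UNIV (\<lambda>z. frechet_derivative g (at z) b)" if "b \<in> Basis" for b
  proof -
    have "C_k (Suc 0) g" using assms by (auto simp: test_function_def)
    then show ?thesis using that by simp
  qed
  then have "continuous_on A (\<lambda>a. frechet_derivative g (at (p a)) b)" if "b \<in> Basis" for b
    using that by (intro continuous_on_compose2[OF _ assms(2)]) auto
  then show ?thesis
    unfolding test_function_deriv_eq[OF assms(1), of "p _" "w _"]
    by (intro continuous_intros assms)
qed

lemma test_function_deriv_zero:
  assumes "test_function S g" "compact K" "\<And>x. x \<notin> K \<Longrightarrow> g x = 0" "z \<notin> K"
  shows "frechet_derivative g (at z) = (\<lambda>_. 0)"
proof -
  have "(g has_derivative (\<lambda>_. 0)) (at z)"
    by (rule has_derivative_transform_within_open[of "\<lambda>_. 0" _ _ _ "- K"])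
      (use assms compact_imp_closed in auto)
  then show ?thesis using frechet_derivative_at by metis
qed

text \<open>The majorants \<open>k t\<close> may be unbounded; only their common integral M enters.
  This suits an unbounded phase density transported by volume preserving maps.\<close>

lemma integrable_lborel_pair_dominated:
  fixes G :: "real \<times> 'b::euclidean_space \<Rightarrow> real"
  assumes G: "G \<in> borel_measurable borel"
    and bd: "\<And>t z. \<bar>G (t, z)\<bar> \<le> indicator {a..b} t * (C * k t z)"
    and k: "\<And>t. t \<in> {a..b} \<Longrightarrow> integrable lborel (k t)" "\<And>t. t \<in> {a..b} \<Longrightarrow> (\<integral>z. k t z \<partial>lborel) = M"
  shows "integrable (lborel \<Otimes>\<^sub>M lborel) G"
proof -
  have G': "G \<in> borel_measurable (lborel \<Otimes>\<^sub>M lborel)" using G by (simp add: lborel_prod)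
  note [measurable] = G'
  have int: "integrable lborel (\<lambda>z. G (t, z))" for t
  proof (cases "t \<in> {a..b}")
    case True
    show ?thesis
      by (rule Bochner_Integration.integrable_bound[OF integrable_mult_right[OF k(1)[OF True], of C]])
        (use bd[of t] True in \<open>auto intro!: AE_I2 order_trans[OF _ abs_ge_self]\<close>)
  next
    case False
    then have "(\<lambda>z. G (t, z)) = (\<lambda>_. 0)" using bd[of t] by (auto simp: fun_eq_iff)
    then show ?thesis by simp
  qed
  show ?thesis
  proof (rule lborel_pair.Fubini_integrable)
    show "integrable lborel (\<lambda>t. \<integral>z. norm (G (t, z)) \<partial>lborel)"
    proof (rule Bochner_Integration.integrable_bound)
      show "integrable lborel (\<lambda>t. indicator {a..b} t * \<bar>C * M\<bar>)"
        by (intro integrable_mult_left integrable_real_indicator) (auto simp: emeasure_lborel_Icc_eq)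
      show "(\<lambda>t. \<integral>z. norm (G (t, z)) \<partial>lborel) \<in> borel_measurable lborel" by measurable
      show "AE t in lborel. norm (\<integral>z. norm (G (t, z)) \<partial>lborel) \<le> norm (indicator {a..b} t * \<bar>C * M\<bar>)"
      proof (rule AE_I2)
        fix t
        show "norm (\<integral>z. norm (G (t, z)) \<partial>lborel) \<le> norm (indicator {a..b} t * \<bar>C * M\<bar>)"
        proof (cases "t \<in> {a..b}")
          case True
          have "(\<integral>z. norm (G (t, z)) \<partial>lborel) \<le> (\<integral>z. C * k t z \<partial>lborel)"
            using int[of t] k(1)[OF True] bd[of t] True
            by (intro integral_mono integrable_norm integrable_mult_right) auto
          also have "\<dots> = C * M" using k[OF True] by simp
          finally have "(\<integral>z. norm (G (t, z)) \<partial>lborel) \<le> \<bar>C * M\<bar>" by linarith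
          then show ?thesis using True by simp
        next
          case False
          then have z: "G (t, z) = 0" for z using bd[of t z] by simp
          show ?thesis unfolding z by simp
        qed
      qed
    qed
    show "AE t in lborel. integrable lborel (\<lambda>z. G (t, z))" using int by simp
  qed (rule G')
qed

text \<open>A skew product of volume preserving maps preserves space-time integrals.\<close>

lemma has_bochner_integral_along_flow:
  fixes F H :: "real \<times> 'b::euclidean_space \<Rightarrow> real"
  assumes F: "F \<in> borel_measurable borel" and H: "H \<in> borel_measurable borel"
    and Z: "\<And>t. t \<in> {a..b} \<Longrightarrow> Z t \<in> borel_measurable borel" "\<And>t. t \<in> {a..b} \<Longrightarrow> distr lborel borel (Z t) = lborel"
    and FH: "\<And>t z. t \<in> {a..b} \<Longrightarrow> F (t, Z t z) = H (t, z)"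
    and bdF: "\<And>t z. \<bar>F (t, z)\<bar> \<le> indicator {a..b} t * (C * kF t z)"
    and kF: "\<And>t. t \<in> {a..b} \<Longrightarrow> integrable lborel (kF t)" "\<And>t. t \<in> {a..b} \<Longrightarrow> (\<integral>z. kF t z \<partial>lborel) = M"
    and bdH: "\<And>t z. \<bar>H (t, z)\<bar> \<le> indicator {a..b} t * (C * kH t z)"
    and kH: "\<And>t. t \<in> {a..b} \<Longrightarrow> integrable lborel (kH t)" "\<And>t. t \<in> {a..b} \<Longrightarrow> (\<integral>z. kH t z \<partial>lborel) = M"
    and zero: "\<And>z. (\<integral>t. H (t, z) \<partial>lborel) = 0"
  shows "has_bochner_integral lborel F 0"
proof -
  have iF: "integrable (lborel \<Otimes>\<^sub>M lborel) F"
    by (rule integrable_lborel_pair_dominated[OF F bdF kF])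
  have iH: "integrable (lborel \<Otimes>\<^sub>M lborel) H"
    by (rule integrable_lborel_pair_dominated[OF H bdH kH])
  have "(\<integral>p. F p \<partial>(lborel \<Otimes>\<^sub>M lborel)) = (\<integral>t. \<integral>z. F (t, z) \<partial>lborel \<partial>lborel)"
    by (rule lborel_pair.integral_fst'[OF iF, symmetric])
  also have "\<dots> = (\<integral>t. \<integral>z. H (t, z) \<partial>lborel \<partial>lborel)"
  proof (rule Bochner_Integration.integral_cong)
    fix t
    show "(\<integral>z. F (t, z) \<partial>lborel) = (\<integral>z. H (t, z) \<partial>lborel)"
    proof (cases "t \<in> {a..b}")
      case True
      have Fm: "(\<lambda>z. F (t, z)) \<in> borel_measurable borel"
        by (intro measurable_compose[OF borel_measurable_continuous_onI F] continuous_intros)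
      have "(\<integral>z. F (t, z) \<partial>lborel) = (\<integral>z. F (t, z) \<partial>distr lborel borel (Z t))"
        by (simp add: Z(2)[OF True])
      also have "\<dots> = (\<integral>z. F (t, Z t z) \<partial>lborel)"
        using Z(1)[OF True] Fm by (intro integral_distr) auto
      also have "\<dots> = (\<integral>z. H (t, z) \<partial>lborel)" using FH[OF True] by simp
      finally show ?thesis .
    next
      case False
      then have "F (t, z) = 0" "H (t, z) = 0" for z using bdF[of t z] bdH[of t z] by auto
      then show ?thesis by simp
    qed
  qed simp
  also have "\<dots> = (\<integral>z. \<integral>t. H (t, z) \<partial>lborel \<partial>lborel)"
    using lborel_pair.Fubini_integral[of "\<lambda>t z. H (t, z)"] iH by simp
  also have "\<dots> = 0" by (simp add: zero)
  finally show ?thesis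
    using iF by (simp add: has_bochner_integral_iff lborel_prod)
qed

lemma has_bochner_integral_lebesgue_on:
  fixes f :: "'a::euclidean_space \<Rightarrow> real"
  assumes "A \<in> sets borel" "F \<in> borel_measurable borel" "has_bochner_integral lborel F c"
    and "\<And>x. F x = indicator A x * f x"
  shows "has_bochner_integral (lebesgue_on A) f c"
proof -
  have "has_bochner_integral lebesgue F c"
  proof -
    have "F \<in> borel_measurable lborel" using assms(2) by simp
    from integrable_completion[OF this] integral_completion[OF this] assms(3) show ?thesis
      by (simp add: has_bochner_integral_iff)
  qed
  moreover have "F = (\<lambda>x. indicator A x * f x)" using assms(4) by (rule ext)
  ultimately show ?thesis
    using assms(1) by (simp add: has_bochner_integral_restrict_space)
qed

lemma measurable_lebesgue_on_cong:
  fixes f g :: "'a::euclidean_space \<Rightarrow> real"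
  assumes "g \<in> borel_measurable borel" "\<And>x. x \<in> A \<Longrightarrow> f x = g x"
  shows "f \<in> borel_measurable (lebesgue_on A)"
proof -
  have "g \<in> borel_measurable (lebesgue_on A)"
    using assms(1) by (intro measurable_restrict_space1 measurable_completion) simp
  then show ?thesis
    using assms(2) by (subst measurable_cong[of _ _ g]) (auto simp: space_restrict_space)
qed

lemma compact_bound:
  fixes g :: "'a::topological_space \<Rightarrow> real"
  assumes "compact A" "continuous_on A g"
  obtains B where "\<And>t. t \<in> A \<Longrightarrow> \<bar>g t\<bar> \<le> B"
proof -
  have "bounded (g ` A)" using compact_continuous_image[OF assms(2,1)] by (rule compact_imp_bounded)
  then show ?thesis using that by (auto simp: bounded_iff)
qed

section \<open>The transformed solution\<close>

lemma cross3_linear_combination: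
  "cross3 (a *\<^sub>R x + b *\<^sub>R v) (c *\<^sub>R x + d *\<^sub>R v) = (a * d - b * c) *\<^sub>R cross3 x v"
proof -
  have "cross3 (a *\<^sub>R x + b *\<^sub>R v) (c *\<^sub>R x + d *\<^sub>R v) = (a * d) *\<^sub>R cross3 x v + (b * c) *\<^sub>R cross3 v x"
    by (simp add: cross_add_left cross_add_right cross_mult_left cross_mult_right cross_refl mult.commute)
  also have "cross3 v x = - cross3 x v" by (rule cross_skew)
  finally show ?thesis by (simp add: algebra_simps)
qed

text \<open>The rotation has determinant 1 and so keeps the cross product; being orthogonal it keeps
  \<open>|x|^2 + |v|^2\<close>. These are the angular momentum and the energy of the harmonic
  oscillator, and \<open>f_Gamma\<close> depends on nothing else.\<close>

lemma f_Gamma_rotate: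
  "f_Gamma \<Gamma> (cos \<theta> *\<^sub>R x + sin \<theta> *\<^sub>R v) (- sin \<theta> *\<^sub>R x + cos \<theta> *\<^sub>R v) = f_Gamma \<Gamma> x v"
proof -
  let ?X = "cos \<theta> *\<^sub>R x + sin \<theta> *\<^sub>R v" and ?V = "- sin \<theta> *\<^sub>R x + cos \<theta> *\<^sub>R v"
  have "cos \<theta> * cos \<theta> - sin \<theta> * - sin \<theta> = 1"
    using sin_cos_squared_add[of \<theta>] by (simp add: power2_eq_square)
  then have L: "cross3 ?X ?V = cross3 x v"
    using cross3_linear_combination[of "cos \<theta>" x "sin \<theta>" v "- sin \<theta>" "cos \<theta>"] by simp
  have "(norm (c *\<^sub>R x + s *\<^sub>R v))\<^sup>2 + (norm (- s *\<^sub>R x + c *\<^sub>R v))\<^sup>2 = (c\<^sup>2 + s\<^sup>2) * ((norm x)\<^sup>2 + (norm v)\<^sup>2)" for c s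
    unfolding power2_norm_eq_inner
    by (simp add: inner_add_left inner_add_right inner_commute power2_eq_square algebra_simps)
  from this[of "cos \<theta>" "sin \<theta>"] have "(norm ?X)\<^sup>2 + (norm ?V)\<^sup>2 = (norm x)\<^sup>2 + (norm v)\<^sup>2"
    by (simp only: sin_cos_squared_add2 mult_1)
  then have s: "s_fun ?X ?V = s_fun x v"
    unfolding s_fun_def L by linarith
  show ?thesis unfolding f_Gamma_def L s ..
qed

locale transformed_static = static_parameter +
  fixes I :: "real set" and \<phi> :: "real \<Rightarrow> real"
  assumes I_open: "open I" and I_interval: "is_interval I" and radial: "radial_solution I \<phi>"
begin

abbreviation f :: "real \<Rightarrow> phase_density" where "f \<equiv> f_Gamma_phi \<Gamma> \<phi>"

abbreviation fG :: "(real^3) \<times> (real^3) \<Rightarrow> real" where "fG p \<equiv> f_Gamma \<Gamma> (fst p) (snd p)"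

lemmas phi_pos = radial_solutionD(1)[OF radial]
lemmas phi_deriv = radial_solutionD(2)[OF radial]
lemmas phi_deriv2 = radial_solutionD(3)[OF radial]

lemma phi_cont: "continuous_on I \<phi>" and phi'_cont: "continuous_on I (deriv \<phi>)"
  by (auto intro!: continuous_at_imp_continuous_on DERIV_isCont[OF phi_deriv] DERIV_isCont[OF phi_deriv2])

text \<open>Total Borel versions of \<open>\<phi>\<close> and its derivative. The value 1 outside I
  keeps \<open>scale\<close> positive, so that \<open>to_static t\<close> preserves volume for every
  t.\<close>

definition scale :: "real \<Rightarrow> real" where "scale t = (if t \<in> I then \<phi> t else 1)"
definition scale' :: "real \<Rightarrow> real" where "scale' t = (if t \<in> I then deriv \<phi> t else 0)"

lemma scale_pos: "0 < scale t" and scale_in: "t \<in> I \<Longrightarrow> scale t = \<phi> t" and scale'_in: "t \<in> I \<Longrightarrow> scale' t = deriv \<phi> t"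
  using phi_pos by (auto simp: scale_def scale'_def)

lemma scale_measurable [measurable]: "scale \<in> borel_measurable borel" and scale'_measurable [measurable]: "scale' \<in> borel_measurable borel"
proof -
  have I: "I \<in> sets borel" using I_open by simp
  note * = borel_measurable_continuous_on_indicator[OF I phi_cont] borel_measurable_continuous_on_indicator[OF I phi'_cont]
  have "scale = (\<lambda>t. indicator I t *\<^sub>R \<phi> t + indicator (- I) t)" "scale' = (\<lambda>t. indicator I t *\<^sub>R deriv \<phi> t)"
    by (auto simp: scale_def scale'_def fun_eq_iff)
  then show "scale \<in> borel_measurable borel" "scale' \<in> borel_measurable borel"
    using I * by (simp_all only:) (intro borel_measurable_add borel_measurable_indicator, auto)
qed

text \<open>The term with coefficient 0 gives the four-coefficient form of \<open>distr_SL2\<close>,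
  here with determinant 1.\<close>

definition to_static :: "real \<Rightarrow> (real^3) \<times> (real^3) \<Rightarrow> (real^3) \<times> (real^3)" where
  "to_static t = (\<lambda>(x, v). ((1 / scale t) *\<^sub>R x + 0 *\<^sub>R v, (- scale' t) *\<^sub>R x + scale t *\<^sub>R v))"

lemma f_eq: "t \<in> I \<Longrightarrow> f t x v = fG (to_static t (x, v))"
  by (simp add: f_Gamma_phi_def to_static_def scale_in scale'_in inverse_eq_divide)

lemma to_static_distr: "distr lborel borel (to_static t) = lborel"
  unfolding to_static_def using scale_pos[of t] by (intro distr_SL2) simp

lemma to_static_cont: "continuous_on UNIV (to_static t)"
  unfolding to_static_def case_prod_unfold by (intro continuous_intros)

lemma to_static_measurable [measurable]: "to_static t \<in> borel_measurable borel"
  by (rule borel_measurable_continuous_onI[OF to_static_cont])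

lemma fG_to_static_measurable: "(\<lambda>z. fG (to_static t z)) \<in> borel_measurable borel"
  by (rule measurable_compose[OF to_static_measurable f_Gamma_measurable])

lemma fG_to_static_joint_measurable: "(\<lambda>p. fG (to_static (fst p) (snd p))) \<in> borel_measurable borel"
proof (rule measurable_compose[OF _ f_Gamma_measurable])
  have [measurable]: "(\<lambda>p :: real \<times> (real^3) \<times> (real^3). scale (fst p)) \<in> borel_measurable borel"
    "(\<lambda>p :: real \<times> (real^3) \<times> (real^3). scale' (fst p)) \<in> borel_measurable borel"
    "(\<lambda>p :: real \<times> (real^3) \<times> (real^3). fst (snd p)) \<in> borel_measurable borel"
    "(\<lambda>p :: real \<times> (real^3) \<times> (real^3). snd (snd p)) \<in> borel_measurable borel"
    by (intro measurable_compose[OF borel_measurable_continuous_onI scale_measurable]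
        measurable_compose[OF borel_measurable_continuous_onI scale'_measurable]
        borel_measurable_continuous_onI continuous_intros)+
  show "(\<lambda>p. to_static (fst p) (snd p)) \<in> borel_measurable borel"
    unfolding to_static_def case_prod_unfold by (intro borel_measurable_Pair) measurable
qed

lemma integrable_fG_to_static: "integrable lborel (\<lambda>z. fG (to_static t z))"
  and integral_fG_to_static: "(\<integral>z. fG (to_static t z) \<partial>lborel) = (\<integral>z. fG z \<partial>lborel)"
proof -
  have "integrable (distr lborel borel (to_static t)) fG" unfolding to_static_distr by (rule integrable_f_Gamma)
  then show "integrable lborel (\<lambda>z. fG (to_static t z))"
    using f_Gamma_measurable by (subst (asm) integrable_distr_eq) auto
  have "(\<integral>z. fG z \<partial>distr lborel borel (to_static t)) = (\<integral>z. fG (to_static t z) \<partial>lborel)"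
    using f_Gamma_measurable by (intro integral_distr) auto
  then show "(\<integral>z. fG (to_static t z) \<partial>lborel) = (\<integral>z. fG z \<partial>lborel)" by (simp add: to_static_distr)
qed

lemma nn_integral_fG_to_static: "(\<integral>\<^sup>+z. ennreal (fG (to_static t z)) \<partial>lborel) = (\<integral>\<^sup>+z. ennreal (fG z) \<partial>lborel)"
proof -
  have "(\<integral>\<^sup>+z. ennreal (fG z) \<partial>distr lborel borel (to_static t)) = (\<integral>\<^sup>+z. ennreal (fG (to_static t z)) \<partial>lborel)"
    using f_Gamma_measurable by (intro nn_integral_distr) auto
  then show ?thesis by (simp add: to_static_distr)
qed

section \<open>Measurability, integrability and continuity in L1\<close>

lemma f_prod_eq: "t \<in> I \<Longrightarrow> (\<lambda>(x, v). f t x v) = (\<lambda>z. fG (to_static t z))"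
  by (auto simp: f_eq)

lemma joint_measurable: "(\<lambda>(t, x, v). f t x v) \<in> borel_measurable (lebesgue_on (I \<times> UNIV))"
  by (rule measurable_lebesgue_on_cong[OF fG_to_static_joint_measurable]) (auto simp: f_eq)

lemma L1_nonneg_f: assumes "t \<in> I" shows "L1_nonneg (f t)"
proof -
  have "integrable lebesgue (\<lambda>z. fG (to_static t z))"
    using integrable_fG_to_static fG_to_static_measurable by (subst integrable_completion) auto
  then show ?thesis
    using assms f_Gamma_nonneg by (simp add: L1_nonneg_def f_prod_eq) (simp add: f_eq)
qed

lemma L1_dist_eq:
  assumes "s \<in> I" "t \<in> I"
  shows "L1_dist (f s) (f t) = (\<integral>z. \<bar>fG (to_static s z) - fG (to_static t z)\<bar> \<partial>lborel)"
proof -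
  have "L1_dist (f s) (f t) = (\<integral>z. \<bar>fG (to_static s z) - fG (to_static t z)\<bar> \<partial>lebesgue)"
    unfolding L1_dist_def by (intro Bochner_Integration.integral_cong) (auto simp: f_eq assms)
  also have "\<dots> = (\<integral>z. \<bar>fG (to_static s z) - fG (to_static t z)\<bar> \<partial>lborel)"
    using fG_to_static_measurable[of s] fG_to_static_measurable[of t] by (intro integral_completion) simp
  finally show ?thesis .
qed

text \<open>Scheffe's lemma: \<open>f_Gamma\<close> is continuous off a null set, which gives
  convergence almost everywhere, and all time slices have the same integral.\<close>

lemma L1_continuous:
  assumes t: "t \<in> I"
  shows "((\<lambda>s. L1_dist (f s) (f t)) \<longlongrightarrow> 0) (at t within I)"
  unfolding tendsto_at_iff_sequentially o_def
proof (intro allI impI)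
  fix X assume X: "\<forall>i. X i \<in> I - {t}" "X \<longlonglongrightarrow> t"
  have "f_Gamma_singular \<in> null_sets lborel"
    using negligible_f_Gamma_singular closed_f_Gamma_singular
    by (simp add: negligible_iff_null_sets null_sets_completion_iff)
  then have "AE z in lborel. z \<notin> f_Gamma_singular" by (rule AE_not_in)
  \<comment> \<open>The exceptional set lives in static coordinates; as \<open>to_static t\<close>
    preserves volume, its preimage is a null set too.\<close>
  then have "AE z in distr lborel borel (to_static t). z \<notin> f_Gamma_singular" by (simp only: to_static_distr)
  then have AE: "AE z in lborel. to_static t z \<notin> f_Gamma_singular"
    by (rule AE_distrD[rotated]) simp
  have "isCont scale t" "isCont scale' t"
  proof -
    have "isCont scale t \<longleftrightarrow> isCont \<phi> t"
      by (rule isCont_cong) (use t I_open in \<open>auto simp: eventually_nhds scale_def intro!: exI[of _ I]\<close>)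
    moreover have "isCont scale' t \<longleftrightarrow> isCont (deriv \<phi>) t"
      by (rule isCont_cong) (use t I_open in \<open>auto simp: eventually_nhds scale'_def intro!: exI[of _ I]\<close>)
    ultimately show "isCont scale t" "isCont scale' t"
      using DERIV_isCont[OF phi_deriv[OF t]] DERIV_isCont[OF phi_deriv2[OF t]] by auto
  qed
  then have scale_X: "(\<lambda>i. scale (X i)) \<longlonglongrightarrow> scale t" "(\<lambda>i. scale' (X i)) \<longlonglongrightarrow> scale' t"
    using X(2) by (auto intro: isCont_tendsto_compose)
  have "(\<lambda>n. \<integral>\<^sup>+z. norm (fG (to_static (X n) z) - fG (to_static t z)) \<partial>lborel) \<longlonglongrightarrow> 0"
  proof (rule Scheffe_lemma2)
    show "AE z in lborel. (\<lambda>n. fG (to_static (X n) z)) \<longlonglongrightarrow> fG (to_static t z)"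
      using AE
    proof eventually_elim
      case (elim z)
      have "(\<lambda>n. to_static (X n) z) \<longlonglongrightarrow> to_static t z"
        unfolding to_static_def case_prod_unfold using scale_pos[of t]
        by (intro tendsto_intros scale_X) simp
      then show ?case by (rule isCont_tendsto_compose[OF f_Gamma_isCont[OF elim]])
    qed
    show "(\<integral>\<^sup>+z. norm (fG (to_static (X n) z)) \<partial>lborel) \<le> (\<integral>\<^sup>+z. norm (fG (to_static t z)) \<partial>lborel)" for n
      using nn_integral_fG_to_static by (simp add: f_Gamma_nonneg)
  qed (use fG_to_static_measurable integrable_fG_to_static in auto)
  then have "(\<lambda>n. enn2real (\<integral>\<^sup>+z. norm (fG (to_static (X n) z) - fG (to_static t z)) \<partial>lborel)) \<longlonglongrightarrow> enn2real 0"
    by (intro tendsto_enn2real) auto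
  moreover have "L1_dist (f (X n)) (f t) = enn2real (\<integral>\<^sup>+z. norm (fG (to_static (X n) z) - fG (to_static t z)) \<partial>lborel)" for n
  proof -
    have "(\<lambda>z. \<bar>fG (to_static (X n) z) - fG (to_static t z)\<bar>) \<in> borel_measurable lborel"
      using fG_to_static_measurable[of "X n"] fG_to_static_measurable[of t] by simp
    then show ?thesis
      using X(1) t by (subst L1_dist_eq) (auto simp: integral_eq_nn_integral)
  qed
  ultimately show "(\<lambda>n. L1_dist (f (X n)) (f t)) \<longlonglongrightarrow> 0" by simp
qed

section \<open>Support, density and potential of the transformed solution\<close>

lemma f_nonzeroD:
  assumes "t \<in> I" "f t x v \<noteq> 0"
  shows "norm x < \<phi> t" "norm v \<le> (2 + \<bar>deriv \<phi> t\<bar> * \<phi> t) / \<phi> t"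
proof -
  have p: "0 < \<phi> t" using phi_pos assms by simp
  have "norm (x /\<^sub>R \<phi> t) < 1" and 2: "norm (\<phi> t *\<^sub>R v - deriv \<phi> t *\<^sub>R x) < 2"
    using f_Gamma_nonzeroD[of "x /\<^sub>R \<phi> t" "\<phi> t *\<^sub>R v - deriv \<phi> t *\<^sub>R x"] assms by (auto simp: f_Gamma_phi_def)
  then show x: "norm x < \<phi> t" using p by (simp add: field_simps)
  have "norm (\<phi> t *\<^sub>R v) \<le> norm (\<phi> t *\<^sub>R v - deriv \<phi> t *\<^sub>R x) + norm (deriv \<phi> t *\<^sub>R x)"
    by (metis diff_add_cancel norm_triangle_ineq)
  also have "\<dots> \<le> 2 + \<bar>deriv \<phi> t\<bar> * \<phi> t"
    using 2 x by (intro add_mono) (auto intro: mult_left_mono)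
  finally show "norm v \<le> (2 + \<bar>deriv \<phi> t\<bar> * \<phi> t) / \<phi> t" using p by (simp add: field_simps)
qed

lemma compact_support:
  assumes ab: "{a..b} \<subseteq> I"
  shows "\<exists>K. compact K \<and> (\<forall>t\<in>{a..b}. AE (x, v) in lebesgue. (x, v) \<notin> K \<longrightarrow> f t x v = 0)"
proof -
  have c: "continuous_on {a..b} \<phi>" "continuous_on {a..b} (deriv \<phi>)"
    using phi_cont phi'_cont ab continuous_on_subset by blast+
  obtain B where B: "\<And>t. t \<in> {a..b} \<Longrightarrow> \<bar>\<phi> t\<bar> \<le> B" using compact_bound[OF compact_Icc c(1)] by blast
  have "\<phi> t \<noteq> 0" if "t \<in> {a..b}" for t using phi_pos[of t] that ab by auto
  then have "continuous_on {a..b} (\<lambda>t. (2 + \<bar>deriv \<phi> t\<bar> * \<phi> t) / \<phi> t)"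
    using c by (intro continuous_intros) auto
  then obtain B' where B': "\<And>t. t \<in> {a..b} \<Longrightarrow> \<bar>(2 + \<bar>deriv \<phi> t\<bar> * \<phi> t) / \<phi> t\<bar> \<le> B'"
    using compact_bound[OF compact_Icc] by blast
  have "f t x v = 0" if "t \<in> {a..b}" "(x, v) \<notin> cball 0 B \<times> cball 0 B'" for t x v
  proof (rule ccontr)
    assume "f t x v \<noteq> 0"
    from f_nonzeroD[OF _ this] that ab have "norm x < \<phi> t" "norm v \<le> (2 + \<bar>deriv \<phi> t\<bar> * \<phi> t) / \<phi> t" by auto
    then have "norm x \<le> B" "norm v \<le> B'" using B[OF that(1)] B'[OF that(1)] by linarith+
    then show False using that(2) by simp
  qed
  then show ?thesis
    by (intro exI[of _ "cball 0 B \<times> cball 0 B'"]) (auto intro!: compact_Times AE_I2)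
qed

lemma density_eq:
  assumes t: "t \<in> I"
  shows "spatial_density (f t) x = 3 / (4 * pi) / \<phi> t ^ 3 * indicator (ball 0 (\<phi> t)) x"
proof -
  have p: "0 < \<phi> t" using phi_pos t by simp
  have fm: "(\<lambda>v. f_Gamma \<Gamma> y (g v)) \<in> borel_measurable borel" if "continuous_on UNIV g" for y and g :: "real^3 \<Rightarrow> real^3"
    using measurable_compose[OF borel_measurable_continuous_onI[OF continuous_on_Pair[OF continuous_on_const that]] f_Gamma_measurable]
    by simp
  have m: "(\<lambda>v. f t x v) \<in> borel_measurable borel"
    unfolding f_Gamma_phi_def by (intro fm continuous_intros)
  \<comment> \<open>The substitution is chosen so that the second argument of \<open>f_Gamma\<close>
    becomes w; its Jacobian is the inverse cube of \<open>\<phi> t\<close>.\<close>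
  have "(\<integral>\<^sup>+v. ennreal (f t x v) \<partial>lborel) = ennreal (\<bar>1 / \<phi> t\<bar> ^ DIM(real^3)) *
      (\<integral>\<^sup>+w. ennreal (f t x ((deriv \<phi> t / \<phi> t) *\<^sub>R x + (1 / \<phi> t) *\<^sub>R w)) \<partial>lborel)"
    using p m by (intro nn_integral_lborel_affine) auto
  also have "(\<lambda>w. f t x ((deriv \<phi> t / \<phi> t) *\<^sub>R x + (1 / \<phi> t) *\<^sub>R w)) = (\<lambda>w. f_Gamma \<Gamma> (x /\<^sub>R \<phi> t) w)"
    using p by (auto simp: f_Gamma_phi_def algebra_simps)
  also have "(\<integral>\<^sup>+w. ennreal (f_Gamma \<Gamma> (x /\<^sub>R \<phi> t) w) \<partial>lborel) = ennreal (3 / (4 * pi) * indicator (ball 0 1) (x /\<^sub>R \<phi> t))"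
    by (rule nn_integral_f_Gamma_velocity)
  also have "ennreal (\<bar>1 / \<phi> t\<bar> ^ DIM(real^3)) * \<dots> = ennreal (3 / (4 * pi) / \<phi> t ^ 3 * indicator (ball 0 (\<phi> t)) x)"
    using p by (subst ennreal_mult[symmetric]) (auto simp: indicator_def field_simps power_divide power3_eq_cube)
  finally have nn: "(\<integral>\<^sup>+v. ennreal (f t x v) \<partial>lborel) = ennreal (3 / (4 * pi) / \<phi> t ^ 3 * indicator (ball 0 (\<phi> t)) x)" .
  have "spatial_density (f t) x = (\<integral>v. f t x v \<partial>lborel)"
    unfolding spatial_density_def using m by (intro integral_completion) simp
  also have "\<dots> = enn2real (\<integral>\<^sup>+v. ennreal (f t x v) \<partial>lborel)"
    using m by (intro integral_eq_nn_integral) (auto simp: f_Gamma_phi_def f_Gamma_nonneg)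
  also have "\<dots> = 3 / (4 * pi) / \<phi> t ^ 3 * indicator (ball 0 (\<phi> t)) x"
    unfolding nn using p by (intro enn2real_ennreal) simp
  finally show ?thesis .
qed

lemma density_measurable:
  assumes ab: "{a..b} \<subseteq> I"
  shows "(\<lambda>(t, x). spatial_density (f t) x) \<in> borel_measurable (lebesgue_on ({a..b} \<times> UNIV))"
proof (rule measurable_lebesgue_on_cong)
  have [measurable]: "(\<lambda>p :: real \<times> (real^3). scale (fst p)) \<in> borel_measurable borel"
    "(\<lambda>p :: real \<times> (real^3). norm (snd p)) \<in> borel_measurable borel"
    by (intro measurable_compose[OF borel_measurable_continuous_onI scale_measurable]
        borel_measurable_continuous_onI continuous_intros)+
  show "(\<lambda>p :: real \<times> (real^3). if norm (snd p) < scale (fst p) then 3 / (4 * pi) / scale (fst p) ^ 3 else 0) \<in> borel_measurable borel"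
    by measurable
qed (use ab in \<open>auto simp: density_eq scale_in subset_eq\<close>)

lemma density_bounded:
  assumes ab: "{a..b} \<subseteq> I"
  shows "\<exists>C. AE (t, x) in lebesgue_on ({a..b} \<times> UNIV). \<bar>spatial_density (f t) x\<bar> \<le> C"
proof -
  have "\<phi> t \<noteq> 0" if "t \<in> {a..b}" for t using phi_pos[of t] that ab by auto
  then have "continuous_on {a..b} (\<lambda>t. 3 / (4 * pi) / \<phi> t ^ 3)"
    using continuous_on_subset[OF phi_cont ab] by (intro continuous_intros) auto
  then obtain B where B: "\<And>t. t \<in> {a..b} \<Longrightarrow> \<bar>3 / (4 * pi) / \<phi> t ^ 3\<bar> \<le> B"
    using compact_bound[OF compact_Icc] by blast
  have "\<bar>spatial_density (f t) x\<bar> \<le> B" if "t \<in> {a..b}" for t x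
    using B[OF that] order_trans[OF abs_ge_zero B[OF that]] that ab
    by (subst density_eq) (auto simp: indicator_def)
  then show ?thesis
    by (intro exI[of _ B] AE_I2) (auto simp: space_restrict_space)
qed

lemma potential_eq:
  assumes t: "t \<in> I" and x: "norm x < \<phi> t"
  shows "potential (f t) x = - 3 / (2 * \<phi> t) + 1 / \<phi> t ^ 3 * (norm x)\<^sup>2 / 2"
proof -
  have p: "0 < \<phi> t" using phi_pos t by simp
  let ?k = "3 / (4 * pi) / \<phi> t ^ 3"
  let ?g = "\<lambda>y. indicator (ball 0 (\<phi> t)) y / norm (x - y)"
  have m: "?g \<in> borel_measurable borel"
    by (intro borel_measurable_divide borel_measurable_indicator borel_measurable_continuous_onI continuous_intros) auto
  have "0 \<le> (\<phi> t)\<^sup>2 - (norm x)\<^sup>2 / 3"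
  proof -
    have "(norm x)\<^sup>2 \<le> (\<phi> t)\<^sup>2" using x by (intro power_mono) auto
    then show ?thesis using zero_le_power2[of "norm x"] by linarith
  qed
  then have "(\<integral>y. ?g y \<partial>lborel) = 2 * pi * ((\<phi> t)\<^sup>2 - (norm x)\<^sup>2 / 3)"
    using m by (subst integral_eq_nn_integral) (auto simp: nn_integral_newton_ball[OF x])
  moreover have "(\<integral>y. spatial_density (f t) y / norm (x - y) \<partial>lebesgue) = ?k * (\<integral>y. ?g y \<partial>lborel)"
  proof -
    have "(\<integral>y. spatial_density (f t) y / norm (x - y) \<partial>lebesgue) = (\<integral>y. ?k * ?g y \<partial>lebesgue)"
      by (simp only: density_eq[OF t] times_divide_eq_right)
    also have "\<dots> = (\<integral>y. ?k * ?g y \<partial>lborel)"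
    proof (rule integral_completion)
      have "(\<lambda>y. ?k * ?g y) \<in> borel_measurable borel"
        by (intro borel_measurable_times borel_measurable_const m)
      then show "(\<lambda>y. ?k * ?g y) \<in> borel_measurable lborel" by (simp only: measurable_lborel2)
    qed
    also have "\<dots> = ?k * (\<integral>y. ?g y \<partial>lborel)" by (rule integral_mult_right_zero)
    finally show ?thesis .
  qed
  ultimately have "potential (f t) x = - (?k * (2 * pi * ((\<phi> t)\<^sup>2 - (norm x)\<^sup>2 / 3)))"
    by (simp only: potential_def)
  also have "\<dots> = - 3 / (2 * \<phi> t) + 1 / \<phi> t ^ 3 * (norm x)\<^sup>2 / 2"
    using p by (simp add: field_simps power2_eq_square power3_eq_cube)
  finally show ?thesis .
qed

lemma gradient_potential:
  assumes t: "t \<in> I" and x: "norm x < \<phi> t"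
  shows "gradient (potential (f t)) x = (1 / \<phi> t ^ 3) *\<^sub>R x"
  by (rule gradient_ball_potential[OF x potential_eq[OF t]])

lemma weak_formulation:
  assumes \<zeta>: "test_function (I \<times> UNIV \<times> UNIV) \<zeta>"
  shows "has_bochner_integral (lebesgue_on (I \<times> UNIV \<times> UNIV))
          (\<lambda>(t, x, v). f t x v *
             (deriv (\<lambda>\<tau>. \<zeta> (\<tau>, x, v)) t
              + v \<bullet> gradient (\<lambda>y. \<zeta> (t, y, v)) x
              - gradient (potential (f t)) x \<bullet> gradient (\<lambda>w. \<zeta> (t, x, w)) v))
          0"
    (is "has_bochner_integral _ ?g 0")
proof -
  obtain K where K: "compact K" "K \<subseteq> I \<times> UNIV \<times> UNIV" "\<And>z. z \<notin> K \<Longrightarrow> \<zeta> z = 0"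
    using \<zeta> unfolding test_function_def by blast
  define D where "D z w = frechet_derivative \<zeta> (at z) w" for z w
  have D: "(\<zeta> has_derivative D z) (at z)" for z
    unfolding D_def using test_function_diff[OF \<zeta>] by (simp add: eta_contract_eq)
  \<comment> \<open>The derivative of \<open>\<zeta>\<close> along the characteristics, with the
    linear force used in all of space. This agrees with the true integrand after multiplication by
    f, since f vanishes for \<open>norm x >= \<phi> t\<close>.\<close>
  define W where "W = (\<lambda>(t, x, v). D (t, x, v) (1, v, - (1 / \<phi> t ^ 3) *\<^sub>R x))"
  define F where "F = (\<lambda>(t, z). indicator I t * fG (to_static t z) * W (t, z))"
  have W_zero: "W z = 0" if "z \<notin> K" for z
    unfolding W_def D_def case_prod_unfold using test_function_deriv_zero[OF \<zeta> K(1,3)] that by simp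
  have nz: "\<phi> t \<noteq> 0" if "t \<in> I" for t using phi_pos[OF that] by simp
  have W_cont: "continuous_on (I \<times> UNIV) W"
    unfolding W_def D_def case_prod_unfold
    by (intro test_function_deriv_continuous[OF \<zeta>] continuous_intros continuous_on_compose2[OF phi_cont])
      (use nz in auto)
  have integrand: "F p = indicator (I \<times> UNIV \<times> UNIV) p * ?g p" for p
  proof -
    obtain t x v where p: "p = (t, x, v)" by (metis prod.exhaust)
    show ?thesis
    proof (cases "t \<in> I \<and> f t x v \<noteq> 0")
      case False
      then show ?thesis by (auto simp: p F_def indicator_def f_eq)
    next
      case True
      then have t: "t \<in> I" and x: "norm x < \<phi> t" using f_nonzeroD by auto
      interpret D: bounded_linear "D (t, x, v)" using D by (rule has_derivative_bounded_linear)
      have "((\<lambda>\<tau>. \<zeta> (\<tau>, x, v)) has_derivative (\<lambda>h. D (t, x, v) (h, 0, 0))) (at t)"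
        using has_derivative_compose[OF has_derivative_Pair[OF has_derivative_ident has_derivative_const[of "(x, v)"]] D]
        by (simp add: zero_prod_def)
      moreover have eq: "(\<lambda>h. D (t, x, v) (h, 0, 0)) = (*) (D (t, x, v) (1, 0, 0))"
      proof (rule ext)
        fix h show "D (t, x, v) (h, 0, 0) = D (t, x, v) (1, 0, 0) * h"
          using D.scaleR[of h "(1, 0, 0)"] by simp
      qed
      ultimately have "((\<lambda>\<tau>. \<zeta> (\<tau>, x, v)) has_real_derivative D (t, x, v) (1, 0, 0)) (at t)"
        unfolding has_field_derivative_def by (simp only:)
      then have 1: "deriv (\<lambda>\<tau>. \<zeta> (\<tau>, x, v)) t = D (t, x, v) (1, 0, 0)"
        by (rule DERIV_imp_deriv)
      have "((\<lambda>y. \<zeta> (t, y, v)) has_derivative (\<lambda>h. D (t, x, v) (0, h, 0))) (at x)"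
        using has_derivative_compose[OF has_derivative_Pair[OF has_derivative_const[of t] has_derivative_Pair[OF has_derivative_ident has_derivative_const[of v]]] D] .
      from has_derivative_imp_gradient[OF this, of v]
      have 2: "v \<bullet> gradient (\<lambda>y. \<zeta> (t, y, v)) x = D (t, x, v) (0, v, 0)" .
      have "((\<lambda>w. \<zeta> (t, x, w)) has_derivative (\<lambda>h. D (t, x, v) (0, 0, h))) (at v)"
        using has_derivative_compose[OF has_derivative_Pair[OF has_derivative_const[of t] has_derivative_Pair[OF has_derivative_const[of x] has_derivative_ident]] D] .
      from has_derivative_imp_gradient[OF this]
      have 3: "w \<bullet> gradient (\<lambda>w. \<zeta> (t, x, w)) v = D (t, x, v) (0, 0, w)" for w .
      have "D (t, x, v) (1, v, - (1 / \<phi> t ^ 3) *\<^sub>R x)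
        = D (t, x, v) (1, 0, 0) + D (t, x, v) (0, v, 0) - D (t, x, v) (0, 0, (1 / \<phi> t ^ 3) *\<^sub>R x)"
        by (simp add: D.add[symmetric] D.diff[symmetric])
      moreover have "D (t, x, v) (0, 0, c *\<^sub>R x) = c * D (t, x, v) (0, 0, x)" for c
        using D.scaleR[of c "(0, 0, x)"] by simp
      ultimately show ?thesis
        using t by (simp add: p F_def W_def gradient_potential[OF t x] 1 2 3 f_eq)
    qed
  qed
  have F_meas: "F \<in> borel_measurable borel"
  proof -
    have "(\<lambda>p. indicator (I \<times> UNIV) p *\<^sub>R W p) \<in> borel_measurable borel"
      using I_open by (intro borel_measurable_continuous_on_indicator[OF _ W_cont]) (auto intro!: borel_open open_Times)
    from borel_measurable_times[OF fG_to_static_joint_measurable this]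
    have "(\<lambda>p. fG (to_static (fst p) (snd p)) * (indicator (I \<times> UNIV) p *\<^sub>R W p)) \<in> borel_measurable borel" .
    moreover have "(\<lambda>p. fG (to_static (fst p) (snd p)) * (indicator (I \<times> UNIV) p *\<^sub>R W p)) = F"
      by (auto simp: F_def indicator_def fun_eq_iff)
    ultimately show ?thesis by simp
  qed
  obtain C where C: "\<And>z. z \<in> K \<Longrightarrow> \<bar>W z\<bar> \<le> C"
    using compact_bound[OF K(1) continuous_on_subset[OF W_cont]] K(2) by (metis UNIV_Times_UNIV)
  have W_bd: "\<bar>W z\<bar> \<le> \<bar>C\<bar>" for z
    using C[of z] W_zero[of z] by (cases "z \<in> K") auto
  show ?thesis
  proof (cases "K = {}")
    case True
    then have "F = (\<lambda>_. 0)" using W_zero by (auto simp: F_def)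
    then have "has_bochner_integral lborel F 0" by (simp add: has_bochner_integral_zero)
    then show ?thesis
      using I_open by (intro has_bochner_integral_lebesgue_on[OF _ F_meas _ integrand]) (auto intro!: borel_open open_Times)
  next
    case False
    have tK: "compact (fst ` K)" "fst ` K \<noteq> {}" "fst ` K \<subseteq> I"
      using K False by (auto intro!: compact_continuous_image continuous_intros)
    obtain a0 b0 where ab0: "a0 \<in> fst ` K" "b0 \<in> fst ` K" "\<And>t. t \<in> fst ` K \<Longrightarrow> a0 \<le> t \<and> t \<le> b0"
      using compact_attains_inf[OF tK(1,2)] compact_attains_sup[OF tK(1,2)] by metis
    \<comment> \<open>The time interval is widened past the projection of K on both sides, so that
      \<open>\<zeta>\<close> vanishes at times a and b.\<close>
    obtain e where e: "0 < e" "cball a0 e \<subseteq> I" using I_open tK(3) ab0(1) open_contains_cball by blast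
    obtain e' where e': "0 < e'" "cball b0 e' \<subseteq> I" using I_open tK(3) ab0(2) open_contains_cball by blast
    define a where "a = a0 - e"
    define b where "b = b0 + e'"
    have "a0 \<le> b0" using ab0 by blast
    have "a \<in> cball a0 e" "b \<in> cball b0 e'"
      using e(1) e'(1) by (simp_all add: a_def b_def dist_real_def)
    then have ab: "a \<in> I" "b \<in> I" "a < b"
      using e e' \<open>a0 \<le> b0\<close> by (auto simp: a_def b_def)
    have abK: "a < t \<and> t < b" if "t \<in> fst ` K" for t
      using ab0(3)[OF that] e(1) e'(1) by (simp add: a_def b_def)
    have abI: "{a..b} \<subseteq> I"
      using mem_is_interval_1_I[OF I_interval ab(1,2)] by auto
    have "continuous_on I (\<lambda>t. 1 / (\<phi> t)\<^sup>2)"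
      using phi_cont nz by (intro continuous_intros) auto
    then obtain \<theta> where \<theta>: "\<And>t. t \<in> I \<Longrightarrow> (\<theta> has_real_derivative 1 / (\<phi> t)\<^sup>2) (at t)"
      using antiderivative_open_interval[OF I_open I_interval] by blast
    have \<theta>_cont: "continuous_on I \<theta>"
      by (auto intro!: continuous_at_imp_continuous_on DERIV_isCont[OF \<theta>])
    \<comment> \<open>X and V invert \<open>to_static t\<close> after a rotation by
      \<open>\<theta> t\<close>: z is the constant label of a trajectory, and \<open>Z t z\<close>
      is its position in phase space at time t.\<close>
    define X where "X t z = (\<phi> t * cos (\<theta> t)) *\<^sub>R fst z + (\<phi> t * sin (\<theta> t)) *\<^sub>R snd z" for t and z :: "(real^3) \<times> (real^3)"
    define V where "V t z = (- sin (\<theta> t) / \<phi> t + deriv \<phi> t * cos (\<theta> t)) *\<^sub>R fst z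
        + (cos (\<theta> t) / \<phi> t + deriv \<phi> t * sin (\<theta> t)) *\<^sub>R snd z" for t and z :: "(real^3) \<times> (real^3)"
    define Z where "Z t z = (X t z, V t z)" for t z
    define H where "H = (\<lambda>(t, z). indicator I t * fG z * W (t, Z t z))"
    have Z_SL2: "Z t = (\<lambda>(x, v). ((\<phi> t * cos (\<theta> t)) *\<^sub>R x + (\<phi> t * sin (\<theta> t)) *\<^sub>R v,
        (- sin (\<theta> t) / \<phi> t + deriv \<phi> t * cos (\<theta> t)) *\<^sub>R x + (cos (\<theta> t) / \<phi> t + deriv \<phi> t * sin (\<theta> t)) *\<^sub>R v))" for t
      by (auto simp: Z_def X_def V_def fun_eq_iff)
    have Z_distr: "distr lborel borel (Z t) = lborel" if "t \<in> I" for t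
      unfolding Z_SL2
    proof (rule distr_SL2)
      have "p * c * (c / p + q * s) - p * s * (- s / p + q * c) = c\<^sup>2 + s\<^sup>2" if "p \<noteq> 0" for p q c s :: real
        using that by (simp add: field_simps power2_eq_square)
      from this[OF nz[OF that]] show "\<phi> t * cos (\<theta> t) * (cos (\<theta> t) / \<phi> t + deriv \<phi> t * sin (\<theta> t)) - \<phi> t * sin (\<theta> t) * (- sin (\<theta> t) / \<phi> t + deriv \<phi> t * cos (\<theta> t)) = 1"
        by (simp only: sin_cos_squared_add2)
    qed
    have Z_meas: "Z t \<in> borel_measurable borel" for t
      unfolding Z_SL2 case_prod_unfold by (intro borel_measurable_continuous_onI continuous_intros)
    have to_static_Z: "fG (to_static t (Z t z)) = fG z" if t: "t \<in> I" for t z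
    proof -
      have "to_static t (Z t z) = (cos (\<theta> t) *\<^sub>R fst z + sin (\<theta> t) *\<^sub>R snd z, - sin (\<theta> t) *\<^sub>R fst z + cos (\<theta> t) *\<^sub>R snd z)"
        using nz[OF t] unfolding to_static_def Z_def X_def V_def scale_in[OF t] scale'_in[OF t]
        by (simp add: algebra_simps)
      then show ?thesis using f_Gamma_rotate[of \<Gamma> "\<theta> t" "fst z" "snd z"] by simp
    qed
    have XV_cont: "continuous_on (I \<times> UNIV) (\<lambda>p. Z (fst p) (snd p))"
      unfolding Z_def X_def V_def
      by (intro continuous_intros continuous_on_compose2[OF phi_cont] continuous_on_compose2[OF phi'_cont] continuous_on_compose2[OF \<theta>_cont])
        (use nz in auto)
    have WZ_cont: "continuous_on (I \<times> UNIV) (\<lambda>p. W (fst p, Z (fst p) (snd p)))"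
      by (rule continuous_on_compose2[OF W_cont]) (auto intro!: continuous_intros XV_cont)
    have H_meas: "H \<in> borel_measurable borel"
    proof -
      have "(\<lambda>p. indicator (I \<times> UNIV) p *\<^sub>R W (fst p, Z (fst p) (snd p))) \<in> borel_measurable borel"
        using I_open by (intro borel_measurable_continuous_on_indicator[OF _ WZ_cont]) (auto intro!: borel_open open_Times)
      moreover have "(\<lambda>p :: real \<times> (real^3) \<times> (real^3). fG (snd p)) \<in> borel_measurable borel"
        by (intro measurable_compose[OF borel_measurable_continuous_onI f_Gamma_measurable] continuous_intros)
      ultimately have "(\<lambda>p. fG (snd p) * (indicator (I \<times> UNIV) p *\<^sub>R W (fst p, Z (fst p) (snd p)))) \<in> borel_measurable borel"
        by (rule borel_measurable_times[rotated])
      moreover have "(\<lambda>p. fG (snd p) * (indicator (I \<times> UNIV) p *\<^sub>R W (fst p, Z (fst p) (snd p)))) = H"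
        by (auto simp: H_def indicator_def fun_eq_iff)
      ultimately show ?thesis by simp
    qed
    have W_out: "W (t, z) = 0" if "t \<notin> {a..b}" for t z
      using abK[of t] that by (intro W_zero) force
    \<comment> \<open>The choice of \<open>\<theta>\<close> with derivative
      \<open>1 / (\<phi> t)^2\<close> makes V the velocity of X.\<close>
    have X_deriv: "((\<lambda>t. X t z) has_vector_derivative V t z) (at t)" if t: "t \<in> I" for t z
    proof -
      have "((\<lambda>t. \<phi> t * cos (\<theta> t)) has_real_derivative (- sin (\<theta> t) / \<phi> t + deriv \<phi> t * cos (\<theta> t))) (at t)"
        using nz[OF t] by (auto intro!: derivative_eq_intros phi_deriv[OF t] \<theta>[OF t] simp: field_simps power2_eq_square)
      moreover have "((\<lambda>t. \<phi> t * sin (\<theta> t)) has_real_derivative (cos (\<theta> t) / \<phi> t + deriv \<phi> t * sin (\<theta> t))) (at t)"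
        using nz[OF t] by (auto intro!: derivative_eq_intros phi_deriv[OF t] \<theta>[OF t] simp: field_simps power2_eq_square)
      ultimately show ?thesis
        unfolding X_def V_def
        by (intro has_vector_derivative_add has_vector_derivative_scaleR[where g="\<lambda>_. c" and g'=0 for c, simplified])
    qed
    \<comment> \<open>Here the radial equation enters: its term \<open>1 / \<phi>^3\<close> cancels
      the contribution of the rotation, and \<open>- 1 / \<phi>^2\<close> leaves the force
      \<open>- X / \<phi>^3\<close>.\<close>
    have V_deriv: "((\<lambda>t. V t z) has_vector_derivative - (1 / \<phi> t ^ 3) *\<^sub>R X t z) (at t)" if t: "t \<in> I" for t z
    proof -
      have "((\<lambda>t. - sin (\<theta> t) / \<phi> t + deriv \<phi> t * cos (\<theta> t)) has_real_derivative - (1 / \<phi> t ^ 3) * (\<phi> t * cos (\<theta> t))) (at t)"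
      proof -
        have "((\<lambda>t. - sin (\<theta> t) / \<phi> t + deriv \<phi> t * cos (\<theta> t)) has_real_derivative
          ((- (cos (\<theta> t) * (1 / (\<phi> t)\<^sup>2))) * \<phi> t - (- sin (\<theta> t)) * deriv \<phi> t) / (\<phi> t * \<phi> t)
           + ((- 1 / (\<phi> t)\<^sup>2 + 1 / (\<phi> t)^3) * cos (\<theta> t) + (- sin (\<theta> t) * (1 / (\<phi> t)\<^sup>2)) * deriv \<phi> t)) (at t)" (is "(_ has_real_derivative ?d) _")
          using nz[OF t] by (auto intro!: derivative_eq_intros phi_deriv[OF t] phi_deriv2[OF t] \<theta>[OF t])
            (simp add: minus_divide_left)
        also have "?d = - (1 / \<phi> t ^ 3) * (\<phi> t * cos (\<theta> t))"
          using nz[OF t] by (simp add: divide_simps) (simp add: algebra_simps eval_nat_numeral)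
        finally show ?thesis .
      qed
      moreover have "((\<lambda>t. cos (\<theta> t) / \<phi> t + deriv \<phi> t * sin (\<theta> t)) has_real_derivative - (1 / \<phi> t ^ 3) * (\<phi> t * sin (\<theta> t))) (at t)"
      proof -
        have "((\<lambda>t. cos (\<theta> t) / \<phi> t + deriv \<phi> t * sin (\<theta> t)) has_real_derivative
          ((- (sin (\<theta> t) * (1 / (\<phi> t)\<^sup>2))) * \<phi> t - cos (\<theta> t) * deriv \<phi> t) / (\<phi> t * \<phi> t)
           + ((- 1 / (\<phi> t)\<^sup>2 + 1 / (\<phi> t)^3) * sin (\<theta> t) + (cos (\<theta> t) * (1 / (\<phi> t)\<^sup>2)) * deriv \<phi> t)) (at t)" (is "(_ has_real_derivative ?d) _")
          using nz[OF t] by (auto intro!: derivative_eq_intros phi_deriv[OF t] phi_deriv2[OF t] \<theta>[OF t])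
        also have "?d = - (1 / \<phi> t ^ 3) * (\<phi> t * sin (\<theta> t))"
          using nz[OF t] by (simp add: divide_simps) (simp add: algebra_simps eval_nat_numeral)
        finally show ?thesis .
      qed
      ultimately have "((\<lambda>t. V t z) has_vector_derivative ((- (1 / \<phi> t ^ 3) * (\<phi> t * cos (\<theta> t))) *\<^sub>R fst z + (- (1 / \<phi> t ^ 3) * (\<phi> t * sin (\<theta> t))) *\<^sub>R snd z)) (at t)"
        unfolding V_def
        by (intro has_vector_derivative_add has_vector_derivative_scaleR[where g="\<lambda>_. c" and g'=0 for c, simplified])
      then show ?thesis by (simp add: X_def scaleR_add_right)
    qed
    have H_zero: "(\<integral>t. H (t, z) \<partial>lborel) = 0" for z
    proof -
      \<comment> \<open>Along a trajectory w is the time derivative of \<open>\<zeta>\<close>, and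
        the density \<open>fG z\<close> is a constant factor, so the integral is a difference of
        boundary values, both 0.\<close>
      define w where "w t = W (t, Z t z)" for t
      define g where "g t = \<zeta> (t, Z t z)" for t
      have g: "(g has_vector_derivative w t) (at t)" if t: "t \<in> I" for t
      proof -
        have "((\<lambda>t. (t, X t z, V t z)) has_vector_derivative (1, V t z, - (1 / \<phi> t ^ 3) *\<^sub>R X t z)) (at t)"
          by (intro has_vector_derivative_Pair has_vector_derivative_id X_deriv[OF t] V_deriv[OF t])
        then have "((\<lambda>t. (t, X t z, V t z)) has_derivative (\<lambda>h. h *\<^sub>R (1, V t z, - (1 / \<phi> t ^ 3) *\<^sub>R X t z))) (at t)"
          by (simp add: has_vector_derivative_def)
        from has_derivative_compose[OF this D]
        have "(g has_derivative (\<lambda>h. D (t, X t z, V t z) (h *\<^sub>R (1, V t z, - (1 / \<phi> t ^ 3) *\<^sub>R X t z)))) (at t)"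
          by (simp only: g_def[abs_def] Z_def)
        moreover have "D (t, X t z, V t z) (h *\<^sub>R p) = h *\<^sub>R D (t, X t z, V t z) p" for h p
          using linear_scale[OF has_derivative_linear[OF D]] .
        ultimately show ?thesis
          by (simp only: has_vector_derivative_def w_def W_def Z_def prod.case)
      qed
      have w_cont: "continuous_on {a..b} w"
        unfolding w_def
        by (rule continuous_on_compose2[OF WZ_cont, of _ "\<lambda>t. (t, z)", simplified])
          (use abI in \<open>auto intro!: continuous_intros\<close>)
      have "has_bochner_integral lborel (\<lambda>t. indicator {a..b} t *\<^sub>R w t) (g b - g a)"
        using ab(3) abI w_cont
        by (intro has_bochner_integral_FTC_Icc) (auto intro!: has_vector_derivative_at_within g)
      moreover have "g a = 0" "g b = 0"
      proof -
        have "(a, Z a z) \<notin> K" "(b, Z b z) \<notin> K"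
          using abK[of a] abK[of b] by force+
        then show "g a = 0" "g b = 0" using K(3) by (simp_all add: g_def)
      qed
      ultimately have "has_bochner_integral lborel (\<lambda>t. fG z * (indicator {a..b} t *\<^sub>R w t)) (fG z * 0)"
        by (intro has_bochner_integral_mult_right) simp
      moreover have "(\<lambda>t. fG z * (indicator {a..b} t *\<^sub>R w t)) = (\<lambda>t. H (t, z))"
      proof (rule ext)
        fix t
        show "fG z * (indicator {a..b} t *\<^sub>R w t) = H (t, z)"
        proof (cases "t \<in> {a..b}")
          case True
          then have "t \<in> I" using abI by blast
          then show ?thesis using True by (simp add: H_def w_def)
        next
          case False
          then show ?thesis using W_out[OF False, of "Z t z"] by (simp add: H_def)
        qed
      qed
      ultimately have "has_bochner_integral lborel (\<lambda>t. H (t, z)) (fG z * 0)" by (simp only:)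
      then show ?thesis by (simp add: has_bochner_integral_iff)
    qed
    have "has_bochner_integral lborel F 0"
    proof (rule has_bochner_integral_along_flow[OF F_meas H_meas, where Z=Z and a=a and b=b and C="\<bar>C\<bar>" and kF="\<lambda>t z. fG (to_static t z)" and kH="\<lambda>t z. fG z"])
      fix t z
      show "t \<in> {a..b} \<Longrightarrow> F (t, Z t z) = H (t, z)"
        using abI by (auto simp: F_def H_def to_static_Z indicator_def)
      show "\<bar>F (t, z)\<bar> \<le> indicator {a..b} t * (\<bar>C\<bar> * fG (to_static t z))"
      proof (cases "t \<in> {a..b}")
        case True
        then have "t \<in> I" using abI by blast
        moreover have "fG (to_static t z) * \<bar>W (t, z)\<bar> \<le> fG (to_static t z) * \<bar>C\<bar>"
          by (rule mult_left_mono[OF W_bd f_Gamma_nonneg])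
        ultimately show ?thesis
          using True by (simp add: F_def abs_mult f_Gamma_nonneg mult.commute[of "\<bar>C\<bar>"])
      next
        case False
        then show ?thesis using W_out[of t z] by (simp add: F_def)
      qed
      show "\<bar>H (t, z)\<bar> \<le> indicator {a..b} t * (\<bar>C\<bar> * fG z)"
      proof (cases "t \<in> {a..b}")
        case True
        then have "t \<in> I" using abI by blast
        moreover have "fG z * \<bar>W (t, Z t z)\<bar> \<le> fG z * \<bar>C\<bar>"
          by (rule mult_left_mono[OF W_bd f_Gamma_nonneg])
        ultimately show ?thesis
          using True by (simp add: H_def abs_mult f_Gamma_nonneg mult.commute[of "\<bar>C\<bar>"])
      next
        case False
        then show ?thesis using W_out[of t "Z t z"] by (simp add: H_def)
      qed
    qed (use Z_meas Z_distr abI H_zero integrable_f_Gamma integrable_fG_to_static integral_fG_to_static in auto)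
    then show ?thesis
      using I_open by (intro has_bochner_integral_lebesgue_on[OF _ F_meas _ integrand]) (auto intro!: borel_open open_Times)
  qed
qed

lemma weak_solution_f: "weak_solution I f"
  unfolding weak_solution_def
proof (intro conjI, goal_cases)
  case 1 show ?case by (rule joint_measurable)
next
  case 2 show ?case using L1_nonneg_f by blast
next
  case 3 show ?case using L1_continuous by blast
next
  case 4 show ?case using compact_support by blast
next
  case 5 show ?case by (intro allI impI conjI density_measurable density_bounded)
next
  case 6 show ?case by (intro allI impI weak_formulation)
qed

end

theorem theorem1p5:
  fixes \<Gamma> :: real
  assumes "1 - 1 / 2 ^ 12 \<le> \<Gamma>" and "\<Gamma> < 1"
  shows "(\<forall>I \<phi>. open I \<longrightarrow> is_interval I \<longrightarrow> radial_solution I \<phi> \<longrightarrow>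
            weak_solution I (f_Gamma_phi \<Gamma> \<phi>)) \<and>
         (\<forall>\<epsilon>::real. \<bar>\<epsilon>\<bar> < 1 \<longrightarrow>
            (\<exists>!\<phi>. radial_solution UNIV \<phi> \<and> \<phi> 0 = 1 \<and> deriv \<phi> 0 = \<epsilon>) \<and>
            (\<forall>\<phi>. radial_solution UNIV \<phi> \<and> \<phi> 0 = 1 \<and> deriv \<phi> 0 = \<epsilon> \<longrightarrow>
               weak_solution UNIV (f_Gamma_phi \<Gamma> \<phi>) \<and>
               (\<forall>t x v. f_Gamma_phi \<Gamma> \<phi> (t + 2 * pi / (1 - \<epsilon>\<^sup>2) powr (3/2)) x v
                        = f_Gamma_phi \<Gamma> \<phi> t x v)))"
proof -
  have weak: "weak_solution I (f_Gamma_phi \<Gamma> \<phi>)" if "open I" "is_interval I" "radial_solution I \<phi>" for I \<phi>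
  proof -
    interpret transformed_static \<Gamma> I \<phi>
      by unfold_locales (use assms that in auto)
    show ?thesis by (rule weak_solution_f)
  qed
  show ?thesis
  proof (intro conjI allI impI)
    fix \<epsilon> :: real assume \<epsilon>: "\<bar>\<epsilon>\<bar> < 1"
    let ?T = "2 * pi / (1 - \<epsilon>\<^sup>2) powr (3/2)"
    obtain \<phi>0 where \<phi>0: "radial_solution UNIV \<phi>0" "\<phi>0 0 = 1" "deriv \<phi>0 0 = \<epsilon>"
      and per: "\<And>t. \<phi>0 (t + ?T) = \<phi>0 t"
      using radial_solution_exists_periodic[OF \<epsilon>] by blast
    \<comment> \<open>Uniqueness transfers the period from Kepler's orbit to every solution with
      these initial data.\<close>
    have uniq: "\<phi> = \<phi>0" if "radial_solution UNIV \<phi> \<and> \<phi> 0 = 1 \<and> deriv \<phi> 0 = \<epsilon>" for \<phi>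
      using radial_solution_unique[OF \<epsilon> _ _ _ \<phi>0] that by blast
    show "\<exists>!\<phi>. radial_solution UNIV \<phi> \<and> \<phi> 0 = 1 \<and> deriv \<phi> 0 = \<epsilon>"
      using \<phi>0 uniq by (intro ex1I[of _ \<phi>0]) blast+
    fix \<phi> assume \<phi>: "radial_solution UNIV \<phi> \<and> \<phi> 0 = 1 \<and> deriv \<phi> 0 = \<epsilon>"
    then show "weak_solution UNIV (f_Gamma_phi \<Gamma> \<phi>)" using weak by simp
    fix t x v
    \<comment> \<open>The transformed density also involves the derivative of the radius, so this
      must be periodic as well.\<close>
    have "deriv \<phi>0 (t + ?T) = deriv \<phi>0 t"
      unfolding deriv_shift[symmetric] per ..
    then show "f_Gamma_phi \<Gamma> \<phi> (t + ?T) x v = f_Gamma_phi \<Gamma> \<phi> t x v"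
      using per uniq[OF \<phi>] by (simp add: f_Gamma_phi_def)
  qed (rule weak)
qed

end
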